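(* Let $(M,g,V,\lambda,\mu,\alpha,\beta)$ be an $\eta$-Ricci-Yamabe soliton of type $(\alpha,\beta)$ with vertical potential field $V$, and let $\pi:(M,g)\to(N,g_N)$ be a Riemannian submersion between Riemannian manifolds. If the vertical distribution $\mathcal{V}$ is parallel, then any fiber of $\pi$ is an $\eta$-Ricci-Yamabe soliton of type $(\alpha,\beta)$.
   Context: All manifolds, maps and tensor fields are smooth. A Riemannian submersion $\pi:(M,g)\to(N,g_N)$, with $\dim M>\dim N$, is a surjective map of rank $\dim N$ whose differential preserves the lengths of horizontal vectors. The vertical distribution is $\mathcal{V}=\ker\pi_*$; the horizontal distribution $\mathcal{H}$ is its $g$-orthogonal complement. A vector field is vertical if it is a section of $\mathcal{V}$. $\mathcal{V}$ is parallel if $\nabla_E F$ is vertical for every vector field $E$ on $M$ and every vertical $F$, where $\nabla$ is the Levi-Civita connection of $g$. Given a $1$-form $\eta$, a vector field $V$ (the potential field) and real constants $\lambda,\mu,\alpha,\beta$, the data $(M,g,V,\lambda,\mu,\alpha,\beta)$ is an $\eta$-Ricci-Yamabe soliton of type $(\alpha,\beta)$ if $$\mathcal{L}_V g+2\alpha S+(2\lambda-\beta R)g+2\mu\,\eta\otimes\eta=0,$$ where $S$ and $R$ are the Ricci tensor and the scalar curvature of $g$. A fiber $\pi^{-1}(q)$ carries the induced metric $\hat g$, with Ricci tensor $\hat S$ and scalar curvature $\hat R$; it is an $\eta$-Ricci-Yamabe soliton of type $(\alpha,\beta)$ if this equation holds on the fiber, for some real constants in the places of $\lambda,\mu$, with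 $\hat g,\hat S,\hat R$ in place of $g,S,R$ and with $V$ and $\eta$ restricted to the fiber. *)

theory Defs
  imports "HOL-Analysis.Analysis" "HOL-Library.Function_Algebras"
begin

text \<open>
  Smooth manifolds are topologies with an atlas (not necessarily maximal) of charts into a
  finite-dimensional normed space, whose dimension is the dimension of the manifold. They need not
  be connected. The model space is only required to be of class \<open>real_normed_vector\<close> (not
  \<open>euclidean_space\<close>, which excludes dimension 0), so that zero-dimensional manifolds are admitted.
\<close>

section \<open>Smooth functions between normed spaces\<close>

text \<open>Only meant for open sets and finite-dimensional domains.\<close>

primrec Ck_on ::
  "nat \<Rightarrow> 'a::real_normed_vector set \<Rightarrow> ('a \<Rightarrow> 'b::real_normed_vector) \<Rightarrow> bool" where
  "Ck_on 0 S f = continuous_on S f"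
| "Ck_on (Suc k) S f =
     ((\<forall>x\<in>S. f differentiable (at x)) \<and> (\<forall>v. Ck_on k S (\<lambda>x. frechet_derivative f (at x) v)))"

definition smooth_on ::
  "'a::real_normed_vector set \<Rightarrow> ('a \<Rightarrow> 'b::real_normed_vector) \<Rightarrow> bool" where
  "smooth_on S f \<longleftrightarrow> (\<forall>k. Ck_on k S f)"

section \<open>Manifolds and smooth maps\<close>

text \<open>A chart consists of its domain and the coordinate map; the values of the latter outside the
  domain are irrelevant.\<close>

type_synonym ('p, 'e) chart = "'p set \<times> ('p \<Rightarrow> 'e)"

abbreviation cdom :: "('p, 'e) chart \<Rightarrow> 'p set" where "cdom c \<equiv> fst c"
abbreviation cmap :: "('p, 'e) chart \<Rightarrow> 'p \<Rightarrow> 'e" where "cmap c \<equiv> snd c"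
abbreviation cinv :: "('p, 'e) chart \<Rightarrow> 'e \<Rightarrow> 'p" where "cinv c \<equiv> inv_into (fst c) (snd c)"

record ('p, 'e) manifold =
  mtop :: "'p topology"
  atlas :: "('p, 'e) chart set"

abbreviation points :: "('p, 'e) manifold \<Rightarrow> 'p set" where "points M \<equiv> topspace (mtop M)"

definition dimension :: "('p, 'e::real_normed_vector) manifold \<Rightarrow> nat" where
  "dimension M = dim (UNIV :: 'e set)"

definition topological_chart :: "'p topology \<Rightarrow> ('p, 'e::real_normed_vector) chart \<Rightarrow> bool" where
  "topological_chart X c \<longleftrightarrow>
     openin X (cdom c) \<and> open (cmap c ` cdom c) \<and>
     homeomorphic_map (subtopology X (cdom c)) (top_of_set (cmap c ` cdom c)) (cmap c)"

definition coord_rep :: "('p \<Rightarrow> 'q) \<Rightarrow> ('p, 'e) chart \<Rightarrow> ('q, 'f) chart \<Rightarrow> 'e \<Rightarrow> 'f" where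
  "coord_rep f c d = cmap d \<circ> f \<circ> cinv c"

definition coord_deriv :: "('p \<Rightarrow> 'q) \<Rightarrow> ('p, 'e::real_normed_vector) chart \<Rightarrow>
    ('q, 'f::real_normed_vector) chart \<Rightarrow> 'p \<Rightarrow> 'e \<Rightarrow> 'f" where
  "coord_deriv f c d p = frechet_derivative (coord_rep f c d) (at (cmap c p))"

definition smooth_manifold :: "('p, 'e::real_normed_vector) manifold \<Rightarrow> bool" where
  "smooth_manifold M \<longleftrightarrow>
     (\<exists>B :: 'e set. finite B \<and> span B = UNIV) \<and>
     Hausdorff_space (mtop M) \<and> second_countable (mtop M) \<and>
     points M \<subseteq> (\<Union>c\<in>atlas M. cdom c) \<and>
     (\<forall>c\<in>atlas M. topological_chart (mtop M) c) \<and>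
     (\<forall>c\<in>atlas M. \<forall>d\<in>atlas M. smooth_on (cmap c ` (cdom c \<inter> cdom d)) (coord_rep id c d))"

definition charts_at :: "('p, 'e) manifold \<Rightarrow> 'p \<Rightarrow> ('p, 'e) chart set" where
  "charts_at M p = {c \<in> atlas M. p \<in> cdom c}"

definition smooth_map :: "('p, 'e::real_normed_vector) manifold \<Rightarrow>
    ('q, 'f::real_normed_vector) manifold \<Rightarrow> ('p \<Rightarrow> 'q) \<Rightarrow> bool" where
  "smooth_map M N f \<longleftrightarrow>
     continuous_map (mtop M) (mtop N) f \<and>
     (\<forall>c\<in>atlas M. \<forall>d\<in>atlas N. smooth_on (cmap c ` (cdom c \<inter> f -` cdom d)) (coord_rep f c d))"

definition smooth_fun :: "('p, 'e::real_normed_vector) manifold \<Rightarrow> ('p \<Rightarrow> real) \<Rightarrow> bool" where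
  "smooth_fun M f \<longleftrightarrow> (\<forall>c\<in>atlas M. smooth_on (cmap c ` cdom c) (f \<circ> cinv c))"

section \<open>Tangent vectors, vector fields and tensor fields\<close>

text \<open>A tangent vector at \<open>p\<close> assigns to every chart around \<open>p\<close> a coordinate vector, these being
  related by the derivatives of the transition maps; other charts are sent to 0. Thus the
  tangent space at a point outside \<open>M\<close> is \<open>{0}\<close>.\<close>

type_synonym ('p, 'e) tangent = "('p, 'e) chart \<Rightarrow> 'e"

definition tangent_space ::
  "('p, 'e::real_normed_vector) manifold \<Rightarrow> 'p \<Rightarrow> ('p, 'e) tangent set" where
  "tangent_space M p = {v. (\<forall>c. c \<notin> charts_at M p \<longrightarrow> v c = 0) \<and>
     (\<forall>c\<in>charts_at M p. \<forall>d\<in>charts_at M p. v d = coord_deriv id c d p (v c))}"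

text \<open>The tangent vector at \<open>p\<close> with coordinate vector \<open>u\<close> in the chart \<open>c\<close>.\<close>

definition coord_vector :: "('p, 'e::real_normed_vector) manifold \<Rightarrow> ('p, 'e) chart \<Rightarrow> 'p \<Rightarrow>
    'e \<Rightarrow> ('p, 'e) tangent" where
  "coord_vector M c p u = (\<lambda>d. if d \<in> charts_at M p then coord_deriv id c d p u else 0)"

definition tangent_scale ::
  "real \<Rightarrow> ('p, 'e::real_normed_vector) tangent \<Rightarrow> ('p, 'e) tangent" where
  "tangent_scale a v = (\<lambda>c. a *\<^sub>R v c)"

text \<open>The differential of a smooth map. It does not depend on the chart chosen at \<open>p\<close>.\<close>

definition differential :: "('p, 'e::real_normed_vector) manifold \<Rightarrow>
    ('q, 'f::real_normed_vector) manifold \<Rightarrow> ('p \<Rightarrow> 'q) \<Rightarrow> 'p \<Rightarrow> ('p, 'e) tangent \<Rightarrow> ('q, 'f) tangent" where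
  "differential M N f p v =
     (let c = (SOME c. c \<in> charts_at M p)
      in (\<lambda>d. if d \<in> charts_at N (f p) then coord_deriv f c d p (v c) else 0))"

type_synonym ('p, 'e) vfield = "'p \<Rightarrow> ('p, 'e) tangent"

definition vector_field ::
  "('p, 'e::real_normed_vector) manifold \<Rightarrow> ('p, 'e) vfield \<Rightarrow> bool" where
  "vector_field M X \<longleftrightarrow>
     (\<forall>p. X p \<in> tangent_space M p) \<and>
     (\<forall>c\<in>atlas M. smooth_on (cmap c ` cdom c) (\<lambda>x. X (cinv c x) c))"

definition field_scale ::
  "('p \<Rightarrow> real) \<Rightarrow> ('p, 'e::real_normed_vector) vfield \<Rightarrow> ('p, 'e) vfield" where
  "field_scale f X = (\<lambda>p. tangent_scale (f p) (X p))"

type_synonym ('p, 'e) form1 = "'p \<Rightarrow> ('p, 'e) tangent \<Rightarrow> real"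

definition one_form :: "('p, 'e::real_normed_vector) manifold \<Rightarrow> ('p, 'e) form1 \<Rightarrow> bool" where
  "one_form M \<eta> \<longleftrightarrow>
     (\<forall>p\<in>points M. \<forall>v\<in>tangent_space M p. \<forall>w\<in>tangent_space M p. \<forall>a.
        \<eta> p (v + w) = \<eta> p v + \<eta> p w \<and> \<eta> p (tangent_scale a v) = a * \<eta> p v) \<and>
     (\<forall>c\<in>atlas M. \<forall>u. smooth_on (cmap c ` cdom c)
        (\<lambda>x. \<eta> (cinv c x) (coord_vector M c (cinv c x) u)))"

type_synonym ('p, 'e) metric_field = "'p \<Rightarrow> ('p, 'e) tangent \<Rightarrow> ('p, 'e) tangent \<Rightarrow> real"

definition riemannian_metric ::
  "('p, 'e::real_normed_vector) manifold \<Rightarrow> ('p, 'e) metric_field \<Rightarrow> bool" where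
  "riemannian_metric M g \<longleftrightarrow>
     (\<forall>p\<in>points M. \<forall>u\<in>tangent_space M p. \<forall>v\<in>tangent_space M p.
        (\<forall>w\<in>tangent_space M p. g p (u + v) w = g p u w + g p v w) \<and>
        (\<forall>a. g p (tangent_scale a u) v = a * g p u v) \<and>
        g p u v = g p v u) \<and>
     (\<forall>p\<in>points M. \<forall>v\<in>tangent_space M p. v \<noteq> 0 \<longrightarrow> 0 < g p v v) \<and>
     (\<forall>c\<in>atlas M. \<forall>u w. smooth_on (cmap c ` cdom c)
        (\<lambda>x. g (cinv c x) (coord_vector M c (cinv c x) u) (coord_vector M c (cinv c x) w)))"

definition riemannian_manifold ::
  "('p, 'e::real_normed_vector) manifold \<Rightarrow> ('p, 'e) metric_field \<Rightarrow> bool" where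
  "riemannian_manifold M g \<longleftrightarrow> smooth_manifold M \<and> riemannian_metric M g"

text \<open>The derivative \<open>X f\<close> of a function along a vector field.\<close>

definition along :: "('p, 'e::real_normed_vector) manifold \<Rightarrow> ('p, 'e) vfield \<Rightarrow>
    ('p \<Rightarrow> real) \<Rightarrow> 'p \<Rightarrow> real" where
  "along M X f p =
     (let c = (SOME c. c \<in> charts_at M p)
      in frechet_derivative (f \<circ> cinv c) (at (cmap c p)) (X p c))"

text \<open>In coordinates, \<open>[X, Y]\<^sup>k = X\<^sup>i \<partial>\<^sub>i Y\<^sup>k - Y\<^sup>i \<partial>\<^sub>i X\<^sup>k\<close>.\<close>

definition lie_bracket :: "('p, 'e::real_normed_vector) manifold \<Rightarrow> ('p, 'e) vfield \<Rightarrow>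
    ('p, 'e) vfield \<Rightarrow> ('p, 'e) vfield" where
  "lie_bracket M X Y p c =
     (if c \<in> charts_at M p
      then frechet_derivative (\<lambda>x. Y (cinv c x) c) (at (cmap c p)) (X p c)
         - frechet_derivative (\<lambda>x. X (cinv c x) c) (at (cmap c p)) (Y p c)
      else 0)"

text \<open>The Lie derivative of the metric along \<open>V\<close>, evaluated on vector fields.\<close>

definition lie_metric :: "('p, 'e::real_normed_vector) manifold \<Rightarrow> ('p, 'e) metric_field \<Rightarrow>
    ('p, 'e) vfield \<Rightarrow> ('p, 'e) vfield \<Rightarrow> ('p, 'e) vfield \<Rightarrow> 'p \<Rightarrow> real" where
  "lie_metric M g V X Y p =
     along M V (\<lambda>q. g q (X q) (Y q)) p
       - g p (lie_bracket M V X p) (Y p) - g p (X p) (lie_bracket M V Y p)"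

section \<open>Levi-Civita connection and curvature\<close>

definition affine_connection :: "('p, 'e::real_normed_vector) manifold \<Rightarrow>
    (('p, 'e) vfield \<Rightarrow> ('p, 'e) vfield \<Rightarrow> ('p, 'e) vfield) \<Rightarrow> bool" where
  "affine_connection M D \<longleftrightarrow>
     (\<forall>X Y. vector_field M X \<longrightarrow> vector_field M Y \<longrightarrow>
        vector_field M (D X Y) \<and>
        (\<forall>X'. vector_field M X' \<longrightarrow> D (X + X') Y = D X Y + D X' Y) \<and>
        (\<forall>Y'. vector_field M Y' \<longrightarrow> D X (Y + Y') = D X Y + D X Y') \<and>
        (\<forall>f. smooth_fun M f \<longrightarrow>
           D (field_scale f X) Y = field_scale f (D X Y) \<and>
           D X (field_scale f Y) = field_scale (along M X f) Y + field_scale f (D X Y)))"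

definition levi_civita_connection :: "('p, 'e::real_normed_vector) manifold \<Rightarrow>
    ('p, 'e) metric_field \<Rightarrow> (('p, 'e) vfield \<Rightarrow> ('p, 'e) vfield \<Rightarrow> ('p, 'e) vfield) \<Rightarrow> bool" where
  "levi_civita_connection M g D \<longleftrightarrow>
     affine_connection M D \<and>
     (\<forall>X Y. vector_field M X \<longrightarrow> vector_field M Y \<longrightarrow> D X Y - D Y X = lie_bracket M X Y) \<and>
     (\<forall>X Y Z. vector_field M X \<longrightarrow> vector_field M Y \<longrightarrow> vector_field M Z \<longrightarrow>
        (\<forall>p\<in>points M. along M X (\<lambda>q. g q (Y q) (Z q)) p
                        = g p (D X Y p) (Z p) + g p (Y p) (D X Z p)))"

text \<open>By the fundamental theorem of Riemannian geometry the Levi-Civita connection exists and is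
  unique, as far as its values on smooth vector fields are concerned.\<close>

definition levi_civita :: "('p, 'e::real_normed_vector) manifold \<Rightarrow> ('p, 'e) metric_field \<Rightarrow>
    ('p, 'e) vfield \<Rightarrow> ('p, 'e) vfield \<Rightarrow> ('p, 'e) vfield" where
  "levi_civita M g = (SOME D. levi_civita_connection M g D)"

definition curvature :: "('p, 'e::real_normed_vector) manifold \<Rightarrow> ('p, 'e) metric_field \<Rightarrow>
    ('p, 'e) vfield \<Rightarrow> ('p, 'e) vfield \<Rightarrow> ('p, 'e) vfield \<Rightarrow> ('p, 'e) vfield" where
  "curvature M g X Y Z =
     (let D = levi_civita M g in D X (D Y Z) - D Y (D X Z) - D (lie_bracket M X Y) Z)"

text \<open>Smooth vector fields on \<open>M\<close> whose values at the single point \<open>p\<close> form an orthonormal basis of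
  the tangent space. The curvature being a tensor, the traces below depend neither on the
  extension of that basis to vector fields nor on the basis.\<close>

definition orthonormal_at :: "('p, 'e::euclidean_space) manifold \<Rightarrow> ('p, 'e) metric_field \<Rightarrow> 'p \<Rightarrow>
    ('e \<Rightarrow> ('p, 'e) vfield) \<Rightarrow> bool" where
  "orthonormal_at M g p E \<longleftrightarrow>
     (\<forall>i\<in>Basis. vector_field M (E i)) \<and>
     (\<forall>i\<in>Basis. \<forall>j\<in>Basis. g p (E i p) (E j p) = (if i = j then 1 else 0))"

definition frame_at :: "('p, 'e::euclidean_space) manifold \<Rightarrow> ('p, 'e) metric_field \<Rightarrow> 'p \<Rightarrow>
    'e \<Rightarrow> ('p, 'e) vfield" where
  "frame_at M g p = (SOME E. orthonormal_at M g p E)"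

definition ricci :: "('p, 'e::euclidean_space) manifold \<Rightarrow> ('p, 'e) metric_field \<Rightarrow>
    ('p, 'e) vfield \<Rightarrow> ('p, 'e) vfield \<Rightarrow> 'p \<Rightarrow> real" where
  "ricci M g X Y p =
     (let E = frame_at M g p in \<Sum>i\<in>Basis. g p (curvature M g (E i) X Y p) (E i p))"

definition scalar_curvature ::
  "('p, 'e::euclidean_space) manifold \<Rightarrow> ('p, 'e) metric_field \<Rightarrow> 'p \<Rightarrow> real" where
  "scalar_curvature M g p = (let E = frame_at M g p in \<Sum>i\<in>Basis. ricci M g (E i) (E i) p)"

section \<open>Solitons\<close>

definition eta_ricci_yamabe_soliton :: "('p, 'e::euclidean_space) manifold \<Rightarrow>
    ('p, 'e) metric_field \<Rightarrow> ('p, 'e) vfield \<Rightarrow> ('p, 'e) form1 \<Rightarrow>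
    real \<Rightarrow> real \<Rightarrow> real \<Rightarrow> real \<Rightarrow> bool" where
  "eta_ricci_yamabe_soliton M g V \<eta> lam \<mu> \<alpha> \<beta> \<longleftrightarrow>
     riemannian_manifold M g \<and> vector_field M V \<and> one_form M \<eta> \<and>
     (\<forall>X Y. vector_field M X \<longrightarrow> vector_field M Y \<longrightarrow> (\<forall>p\<in>points M.
        lie_metric M g V X Y p + 2 * \<alpha> * ricci M g X Y p
          + (2 * lam - \<beta> * scalar_curvature M g p) * g p (X p) (Y p)
          + 2 * \<mu> * (\<eta> p (X p) * \<eta> p (Y p)) = 0))"

section \<open>Riemannian submersions\<close>

definition vertical_space :: "('p, 'e::real_normed_vector) manifold \<Rightarrow>
    ('q, 'f::real_normed_vector) manifold \<Rightarrow> ('p \<Rightarrow> 'q) \<Rightarrow> 'p \<Rightarrow> ('p, 'e) tangent set" where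
  "vertical_space M N \<pi> p = {v \<in> tangent_space M p. differential M N \<pi> p v = 0}"

definition horizontal_space :: "('p, 'e::real_normed_vector) manifold \<Rightarrow> ('p, 'e) metric_field \<Rightarrow>
    ('q, 'f::real_normed_vector) manifold \<Rightarrow> ('p \<Rightarrow> 'q) \<Rightarrow> 'p \<Rightarrow> ('p, 'e) tangent set" where
  "horizontal_space M g N \<pi> p =
     {v \<in> tangent_space M p. \<forall>w\<in>vertical_space M N \<pi> p. g p v w = 0}"

definition riemannian_submersion :: "('p, 'e::real_normed_vector) manifold \<Rightarrow>
    ('p, 'e) metric_field \<Rightarrow> ('q, 'f::real_normed_vector) manifold \<Rightarrow> ('q, 'f) metric_field \<Rightarrow>
    ('p \<Rightarrow> 'q) \<Rightarrow> bool" where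
  "riemannian_submersion M g N gN \<pi> \<longleftrightarrow>
     riemannian_manifold M g \<and> riemannian_manifold N gN \<and> dimension N < dimension M \<and>
     smooth_map M N \<pi> \<and> \<pi> ` points M = points N \<and>
     (\<forall>p\<in>points M. \<forall>c\<in>charts_at M p. \<forall>d\<in>charts_at N (\<pi> p).
        dim (range (coord_deriv \<pi> c d p)) = dimension N) \<and>
     (\<forall>p\<in>points M. \<forall>v\<in>horizontal_space M g N \<pi> p.
        gN (\<pi> p) (differential M N \<pi> p v) (differential M N \<pi> p v) = g p v v)"

definition vertical_field :: "('p, 'e::real_normed_vector) manifold \<Rightarrow>
    ('q, 'f::real_normed_vector) manifold \<Rightarrow> ('p \<Rightarrow> 'q) \<Rightarrow> ('p, 'e) vfield \<Rightarrow> bool" where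
  "vertical_field M N \<pi> X \<longleftrightarrow>
     vector_field M X \<and> (\<forall>p\<in>points M. X p \<in> vertical_space M N \<pi> p)"

definition vertical_parallel :: "('p, 'e::real_normed_vector) manifold \<Rightarrow>
    ('p, 'e) metric_field \<Rightarrow> ('q, 'f::real_normed_vector) manifold \<Rightarrow> ('p \<Rightarrow> 'q) \<Rightarrow> bool" where
  "vertical_parallel M g N \<pi> \<longleftrightarrow>
     (\<forall>X Y. vector_field M X \<longrightarrow> vertical_field M N \<pi> Y \<longrightarrow>
        vertical_field M N \<pi> (levi_civita M g X Y))"

section \<open>Fibers as submanifolds\<close>

text \<open>A fiber carries the subspace topology. Its charts are all its topological charts whose
  inverse, as a map into \<open>M\<close>, is a smooth immersion; this is the maximal atlas of the fiber as an
  embedded submanifold of \<open>M\<close>. The model space \<open>'k\<close> has to have the dimension of the fiber.\<close>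

definition fiber ::
  "('p, 'e::real_normed_vector) manifold \<Rightarrow> ('p \<Rightarrow> 'q) \<Rightarrow> 'q \<Rightarrow> ('p, 'k::real_normed_vector) manifold" where
  "fiber M \<pi> q =
     (let X = subtopology (mtop M) {p. \<pi> p = q} in
      \<lparr> mtop = X,
        atlas = {c. topological_chart X c \<and>
          (\<forall>d\<in>atlas M.
             smooth_on (cmap c ` (cdom c \<inter> cdom d)) (coord_rep id c d) \<and>
             (\<forall>p\<in>cdom c \<inter> cdom d. inj (coord_deriv id c d p)))} \<rparr>)"

text \<open>Restriction to a submanifold \<open>F\<close> of \<open>M\<close>, the differential of the identity from \<open>F\<close> to \<open>M\<close>
  being that of the inclusion. A vector field has to be tangent to \<open>F\<close> for its restriction to
  make sense.\<close>

definition induced_metric :: "('p, 'k::real_normed_vector) manifold \<Rightarrow>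
    ('p, 'e::real_normed_vector) manifold \<Rightarrow> ('p, 'e) metric_field \<Rightarrow> ('p, 'k) metric_field" where
  "induced_metric F M g = (\<lambda>p v w. g p (differential F M id p v) (differential F M id p w))"

definition restrict_form :: "('p, 'k::real_normed_vector) manifold \<Rightarrow>
    ('p, 'e::real_normed_vector) manifold \<Rightarrow> ('p, 'e) form1 \<Rightarrow> ('p, 'k) form1" where
  "restrict_form F M \<eta> = (\<lambda>p v. \<eta> p (differential F M id p v))"

definition restrict_field :: "('p, 'k::real_normed_vector) manifold \<Rightarrow>
    ('p, 'e::real_normed_vector) manifold \<Rightarrow> ('p, 'e) vfield \<Rightarrow> ('p, 'k) vfield" where
  "restrict_field F M X = (\<lambda>p. if p \<in> points F
     then (THE v. v \<in> tangent_space F p \<and> differential F M id p v = X p) else 0)"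

end

theory Submission
  imports Defs
begin

text \<open>
  Call a map \<open>\<phi>\<close> affine if it intertwines the connections, that is, if in charts
  \<open>d\<phi> (\<Gamma>(u, v)) = \<Gamma>'(d\<phi> u, d\<phi> v) + D\<^sup>2\<phi>(u, v)\<close>; affine maps preserve the curvature. If the vertical
  distribution is parallel, then both the inclusion of a fiber and the submersion itself are affine.
  Hence, for an orthonormal basis adapted to the splitting into vertical and horizontal vectors, the
  Ricci tensor of \<open>M\<close> restricts on vertical vectors to the Ricci tensor of the fiber, and the scalar
  curvature of \<open>M\<close> is the sum of those of the fiber and of \<open>N\<close>. The latter is constant along the
  fiber and is absorbed into \<open>\<lambda>\<close>; all other terms of the soliton equation simply restrict to the fiber.
\<close>

section \<open>Calculus on finite-dimensional normed spaces\<close>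

text \<open>The obstacle is that the definitions are global while the argument is pointwise:
  connection and frames are picked by \<open>SOME\<close>, and parallelism and the soliton equation
  quantify over vector fields on all of \<open>M\<close>. Hence the connection is identified with
  Christoffel symbols in charts, and single vectors are extended to global fields by bump functions.
  Why the two maps are affine: a vertical field \<open>Y\<close> satisfies d\<pi>(Y) = 0.
  Differentiating this along \<open>u\<close>, and using that the covariant derivative of
  \<open>Y\<close> along \<open>u\<close> is again vertical, shows that d\<pi> sends the Christoffel
  symbol of \<open>u\<close> and a vertical \<open>k\<close> to the second derivative of \<pi> at
  \<open>u\<close>, \<open>k\<close>. This is the affine equation with one vertical argument. For
  two horizontal arguments it is the comparison of Koszul formulas valid for every Riemannian
  submersion. For the inclusion, the defect of the affine equation is tangent to the fiber by the
  vertical case and normal to it by Koszul's formula, so it vanishes. Metrics and connections in a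
  chart are only smooth vector by vector; smoothness of solutions of linear systems replaces
  inverting matrices.\<close>

text \<open>The base manifold is modelled on a normed space without an inner product, so the results on
  Euclidean spaces do not apply to it.\<close>

definition fin_dim :: "'a::real_normed_vector itself \<Rightarrow> bool" where
  "fin_dim _ \<longleftrightarrow> (\<exists>B::'a set. finite B \<and> span B = UNIV)"

lemma fin_dim_euclidean: "fin_dim TYPE('a::euclidean_space)"
  unfolding fin_dim_def using finite_Basis span_Basis by blast

text \<open>Equivalence of norms in finite dimension, by induction on \<open>B\<close>. The key
  point is that a new vector \<open>a\<close> has positive distance to \<open>span B\<close>: for a
  sequence in \<open>span B\<close> tending to \<open>- a\<close> the coefficients are Cauchy by the
  induction hypothesis, so the limit would lie in \<open>span B\<close>.\<close>

lemma independent_coeff_bound: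
  fixes B :: "'a::real_normed_vector set"
  assumes "finite B" "independent B"
  shows "\<exists>C>0. \<forall>c. (\<Sum>b\<in>B. \<bar>c b\<bar>) \<le> C * norm (\<Sum>b\<in>B. c b *\<^sub>R b)"
  using assms
proof (induction B rule: finite_induct)
  case empty
  show ?case by (intro exI[of _ 1]) simp
next
  case (insert a B)
  have ind: "independent B" and aB: "a \<notin> span B"
    using insert.prems insert.hyps by (auto simp: independent_insert)
  obtain C where C: "C > 0" "\<And>c. (\<Sum>b\<in>B. \<bar>c b\<bar>) \<le> C * norm (\<Sum>b\<in>B. c b *\<^sub>R b)"
    using insert.IH[OF ind] by blast
  have "\<exists>\<delta>>0. \<forall>y\<in>span B. \<delta> \<le> norm (a + y)"
  proof (rule ccontr)
    assume "\<not> ?thesis"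
    then have "\<forall>n::nat. \<exists>y\<in>span B. norm (a + y) < inverse (real (Suc n))"
      by (meson inverse_positive_iff_positive not_le of_nat_0_less_iff zero_less_Suc)
    then obtain y where y: "\<And>n. y n \<in> span B" "\<And>n. norm (a + y n) < inverse (real (Suc n))"
      by metis
    have "\<forall>n. \<exists>c. y n = (\<Sum>b\<in>B. c b *\<^sub>R b)"
      using y(1) span_finite[OF insert.hyps(1)] by (metis (no_types, lifting) imageE)
    then obtain c where c: "\<And>n. y n = (\<Sum>b\<in>B. c n b *\<^sub>R b)" by metis
    have "(\<lambda>n. a + y n) \<longlonglongrightarrow> 0"
      using LIMSEQ_norm_0 y(2) by (metis inverse_eq_divide)
    then have "(\<lambda>n. (a + y n) - a) \<longlonglongrightarrow> 0 - a" by (intro tendsto_diff tendsto_const)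
    then have lim: "y \<longlonglongrightarrow> - a" by simp
    then have cau: "Cauchy y" by (rule LIMSEQ_imp_Cauchy)
    have "Cauchy (\<lambda>n. c n b)" if b: "b \<in> B" for b
      unfolding Cauchy_iff
    proof (intro allI impI)
      fix e :: real assume e: "e > 0"
      then have "e / C > 0" using C(1) by simp
      then obtain M where M: "\<And>m n. m \<ge> M \<Longrightarrow> n \<ge> M \<Longrightarrow> norm (y m - y n) < e / C"
        using cau unfolding Cauchy_iff by blast
      have "norm (c m b - c n b) < e" if "m \<ge> M" "n \<ge> M" for m n
      proof -
        have "\<bar>c m b - c n b\<bar> \<le> (\<Sum>b\<in>B. \<bar>c m b - c n b\<bar>)"
          using member_le_sum[OF b, of "\<lambda>b. \<bar>c m b - c n b\<bar>"] insert.hyps(1) by auto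
        also have "\<dots> \<le> C * norm (\<Sum>b\<in>B. (c m b - c n b) *\<^sub>R b)" by (rule C(2))
        also have "(\<Sum>b\<in>B. (c m b - c n b) *\<^sub>R b) = y m - y n"
          by (simp add: c scaleR_diff_left sum_subtractf)
        also have "C * norm (y m - y n) < e"
          using M[OF that] C(1) by (simp add: pos_less_divide_eq mult.commute)
        finally show ?thesis by simp
      qed
      then show "\<exists>M. \<forall>m\<ge>M. \<forall>n\<ge>M. norm (c m b - c n b) < e" by blast
    qed
    then have "\<forall>b\<in>B. \<exists>l. (\<lambda>n. c n b) \<longlonglongrightarrow> l"
      using real_Cauchy_convergent unfolding convergent_def by blast
    then obtain l where l: "\<And>b. b \<in> B \<Longrightarrow> (\<lambda>n. c n b) \<longlonglongrightarrow> l b" by metis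
    have "(\<lambda>n. \<Sum>b\<in>B. c n b *\<^sub>R b) \<longlonglongrightarrow> (\<Sum>b\<in>B. l b *\<^sub>R b)"
      by (intro tendsto_sum tendsto_scaleR l tendsto_const)
    moreover have "(\<lambda>n. \<Sum>b\<in>B. c n b *\<^sub>R b) = y" using c by presburger
    ultimately have "- a = (\<Sum>b\<in>B. l b *\<^sub>R b)"
      using lim LIMSEQ_unique by metis
    then have "- a \<in> span B" by (simp add: span_base span_scale span_sum)
    then show False using aB span_neg by fastforce
  qed
  then obtain \<delta> where \<delta>: "\<delta> > 0" "\<And>y. y \<in> span B \<Longrightarrow> \<delta> \<le> norm (a + y)" by blast
  show ?case
  \<comment> \<open>With \<open>n\<close> the norm of the whole combination, the coefficient of
    \<open>a\<close> is at most \<open>n / \<delta>\<close>, and the rest \<open>y\<close> has norm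
    at most \<open>n + (n / \<delta>) * norm a\<close>; \<open>C\<close> times the latter bounds the
    remaining coefficients. The three summands of the constant are the three contributions.\<close>
  proof (intro exI[of _ "1/\<delta> + C + C * norm a / \<delta>"] conjI allI)
    show "1/\<delta> + C + C * norm a / \<delta> > 0" using \<delta>(1) C(1) by (simp add: add_pos_nonneg)
    fix c :: "'a \<Rightarrow> real"
    define y where "y = (\<Sum>b\<in>B. c b *\<^sub>R b)"
    have yB: "y \<in> span B" by (simp add: y_def span_base span_scale span_sum)
    have 1: "\<bar>c a\<bar> * \<delta> \<le> norm (c a *\<^sub>R a + y)"
    proof (cases "c a = 0")
      case False
      have "\<delta> \<le> norm (a + (1 / c a) *\<^sub>R y)" by (rule \<delta>(2)) (simp add: yB span_scale)
      then have "\<bar>c a\<bar> * \<delta> \<le> norm (c a *\<^sub>R (a + (1 / c a) *\<^sub>R y))" by (simp add: mult_left_mono)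
      then show ?thesis using False by (simp add: scaleR_right_distrib)
    qed simp
    have "norm y \<le> norm (c a *\<^sub>R a + y) + norm (c a *\<^sub>R a)"
      using norm_triangle_ineq4[of "c a *\<^sub>R a + y" "c a *\<^sub>R a"] by simp
    then have 2: "norm y \<le> norm (c a *\<^sub>R a + y) + \<bar>c a\<bar> * norm a" by simp
    have 3: "\<bar>c a\<bar> \<le> norm (c a *\<^sub>R a + y) / \<delta>" using 1 \<delta>(1) by (simp add: pos_le_divide_eq)
    have "(\<Sum>b\<in>insert a B. \<bar>c b\<bar>) \<le> \<bar>c a\<bar> + C * norm y"
      using C(2)[of c] insert.hyps by (simp add: y_def)
    also have "\<dots> \<le> \<bar>c a\<bar> + C * (norm (c a *\<^sub>R a + y) + \<bar>c a\<bar> * norm a)"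
      using 2 C(1) by (simp add: mult_left_mono)
    also have "\<dots> \<le> norm (c a *\<^sub>R a + y) / \<delta> + C * (norm (c a *\<^sub>R a + y) + norm (c a *\<^sub>R a + y) / \<delta> *
        norm a)"
      using 3 C(1) by (intro add_mono mult_left_mono mult_right_mono order_refl) auto
    also have "\<dots> = (1/\<delta> + C + C * norm a / \<delta>) * norm (\<Sum>b\<in>insert a B. c b *\<^sub>R b)"
      using insert.hyps by (simp add: y_def algebra_simps)
    finally show "(\<Sum>b\<in>insert a B. \<bar>c b\<bar>) \<le> (1/\<delta> + C + C * norm a / \<delta>) * norm (\<Sum>b\<in>insert a B. c b *\<^sub>R b)" .
  qed
qed

text \<open>The coefficient bound is exactly the continuity of the coordinate functionals
  \<open>r b\<close>. They are the tool for all later statements about maps that are linear in one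
  argument: such a map is a finite sum of its values on \<open>B\<close>.\<close>

lemma fin_dim_coords:
  assumes "fin_dim TYPE('a::real_normed_vector)"
  obtains B :: "'a::real_normed_vector set" and r :: "'a \<Rightarrow> 'a \<Rightarrow> real" where
    "finite B" "independent B" "span B = UNIV" "\<And>b. bounded_linear (r b)" "\<And>x. x = (\<Sum>b\<in>B. r b x *\<^sub>R b)"
proof -
  obtain B0 :: "'a set" where B0: "finite B0" "span B0 = UNIV"
    using assms unfolding fin_dim_def by blast
  obtain B where B: "B \<subseteq> B0" "independent B" "B0 \<subseteq> span B"
    using maximal_independent_subset by metis
  have fB: "finite B" using B(1) B0(1) finite_subset by blast
  have sB: "span B = UNIV" using B(3) B0(2) by (metis span_eq span_superset B(1) dual_order.trans)
  define r where "r b x = representation B x b" for b x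
  have eq: "x = (\<Sum>b\<in>B. r b x *\<^sub>R b)" for x
    unfolding r_def by (rule sum_representation_eq[symmetric]) (use B fB sB in auto)
  have lin: "linear (r b)" for b
    unfolding r_def by (rule linearI) (use B sB in \<open>auto simp: representation_add representation_scale\<close>)
  obtain C where C: "C > 0" "\<And>c. (\<Sum>b\<in>B. \<bar>c b\<bar>) \<le> C * norm (\<Sum>b\<in>B. c b *\<^sub>R b)"
    using independent_coeff_bound[OF fB B(2)] by blast
  have bd: "norm (r b x) \<le> norm x * C" for b x
  proof (cases "b \<in> B")
    case True
    have "\<bar>r b x\<bar> \<le> (\<Sum>b\<in>B. \<bar>r b x\<bar>)" using member_le_sum[OF True, of "\<lambda>b. \<bar>r b x\<bar>"] fB by auto
    also have "\<dots> \<le> C * norm x" using C(2)[of "\<lambda>b. r b x"] eq[of x] by simp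
    finally show ?thesis by (simp add: mult.commute)
  next
    case False
    then have "r b x = 0" unfolding r_def using representation_ne_zero by blast
    then show ?thesis using C(1) by simp
  qed
  have "bounded_linear (r b)" for b
    using lin[of b] bd by (intro bounded_linear_intro[where K=C]) (auto simp: linear_add linear_scale)
  then show ?thesis using that fB B(2) sB eq by blast
qed

lemma fin_dim_bounded_linear:
  fixes f :: "'a::real_normed_vector \<Rightarrow> 'b::real_normed_vector"
  assumes "fin_dim TYPE('a)" "linear f"
  shows "bounded_linear f"
proof -
  obtain B :: "'a set" and r where B: "finite B" "\<And>b. bounded_linear (r b)" "\<And>x. x = (\<Sum>b\<in>B. r b x *\<^sub>R b)"
    using fin_dim_coords[OF assms(1)] by metis
  have "f x = (\<Sum>b\<in>B. r b x *\<^sub>R f b)" for x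
    using arg_cong[OF B(3)[of x], of f] by (simp add: linear_sum[OF assms(2)] linear_scale[OF assms(2)])
  then have "f = (\<lambda>x. \<Sum>b\<in>B. r b x *\<^sub>R f b)" by blast
  moreover have "bounded_linear (\<lambda>x. \<Sum>b\<in>B. r b x *\<^sub>R f b)"
    by (intro bounded_linear_sum bounded_linear_scaleR_const B(2))
  ultimately show ?thesis by simp
qed

section \<open>Functions of class \<open>Ck_on\<close> and smooth functions\<close>

abbreviation \<D> :: "('a::real_normed_vector \<Rightarrow> 'b::real_normed_vector) \<Rightarrow> 'a \<Rightarrow> 'a \<Rightarrow> 'b" where
  "\<D> f x \<equiv> frechet_derivative f (at x)"

lemma frechet_derivative_eq: "(f has_derivative f') (at x) \<Longrightarrow> \<D> f x = f'"
  using frechet_derivative_at by metis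

lemma frechet_derivative_cong_open:
  assumes "open S" "x \<in> S" "\<And>y. y \<in> S \<Longrightarrow> f y = g y"
  shows "\<D> f x = \<D> g x"
proof -
  have "(f has_derivative f') (at x) = (g has_derivative f') (at x)" for f'
    using assms by (metis has_derivative_transform_within_open)
  then show ?thesis unfolding frechet_derivative_def by simp
qed

lemma differentiable_cong_open:
  assumes "open S" "x \<in> S" "\<And>y. y \<in> S \<Longrightarrow> f y = g y"
  shows "f differentiable (at x) \<longleftrightarrow> g differentiable (at x)"
  using assms unfolding differentiable_def by (metis has_derivative_transform_within_open)

lemma Ck_on_cong:
  assumes "open S" "\<And>x. x \<in> S \<Longrightarrow> f x = g x" "Ck_on k S f"
  shows "Ck_on k S g"
  using assms(2,3)
proof (induction k arbitrary: f g)
  case 0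
  then show ?case using continuous_on_eq by auto
next
  case (Suc k)
  have "g differentiable (at x)" if "x \<in> S" for x
    using differentiable_cong_open[OF assms(1) that, of f g] Suc.prems that by auto
  moreover have "Ck_on k S (\<lambda>x. \<D> g x v)" for v
    by (rule Suc.IH[of "\<lambda>x. \<D> f x v"])
      (use Suc.prems frechet_derivative_cong_open[OF assms(1)] in \<open>auto, metis\<close>)
  ultimately show ?case by simp
qed

text \<open>\<open>Ck_on\<close> is stated through \<open>frechet_derivative\<close>, a total
  function that agrees with a given \<open>f'\<close> on \<open>S\<close>; since \<open>S\<close> is
  open, \<open>Ck_on_cong\<close> transfers regularity from one to the other.\<close>

lemma Ck_on_SucI:
  assumes "open S" "\<And>x. x \<in> S \<Longrightarrow> (f has_derivative f' x) (at x)" "\<And>v. Ck_on k S (\<lambda>x. f' x v)"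
  shows "Ck_on (Suc k) S f"
proof -
  have "Ck_on k S (\<lambda>x. \<D> f x v)" for v
    by (rule Ck_on_cong[OF assms(1) _ assms(3)[of v]]) (simp add: frechet_derivative_eq[OF assms(2)])
  then show ?thesis using assms(2) by (auto simp: differentiable_def)
qed

lemma Ck_on_SucD:
  assumes "Ck_on (Suc k) S f"
  shows "x \<in> S \<Longrightarrow> (f has_derivative \<D> f x) (at x)"
    and "Ck_on k S (\<lambda>x. \<D> f x v)"
  using assms by (auto simp: frechet_derivative_works)

lemma Ck_on_Suc_imp: "Ck_on (Suc k) S f \<Longrightarrow> Ck_on k S f"
proof (induction k arbitrary: f)
  case 0
  then show ?case
    by (auto intro!: continuous_at_imp_continuous_on differentiable_imp_continuous_within)
next
  case (Suc k)
  then show ?case by simp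
qed

lemma Ck_on_le: "Ck_on n S f \<Longrightarrow> k \<le> n \<Longrightarrow> Ck_on k S f"
proof (induction n)
  case (Suc n)
  then show ?case using Ck_on_Suc_imp le_Suc_eq by blast
qed simp

lemma Ck_on_continuous: "Ck_on k S f \<Longrightarrow> continuous_on S f"
  using Ck_on_le[of k S f 0] by simp

lemma Ck_on_subset: "Ck_on k S f \<Longrightarrow> T \<subseteq> S \<Longrightarrow> Ck_on k T f"
  by (induction k arbitrary: f) (auto intro: continuous_on_subset)

lemma Ck_on_local:
  assumes "open S" "\<And>x. x \<in> S \<Longrightarrow> \<exists>U. open U \<and> x \<in> U \<and> Ck_on k U f"
  shows "Ck_on k S f"
  using assms(2)
proof (induction k arbitrary: f)
  case 0
  have "isCont f x" if x: "x \<in> S" for x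
  proof -
    obtain U where "open U" "x \<in> U" "continuous_on U f" using 0[OF x] by auto
    then show ?thesis using continuous_on_eq_continuous_at by blast
  qed
  then show ?case by (simp add: continuous_at_imp_continuous_on)
next
  case (Suc k)
  have "f differentiable (at x)" if "x \<in> S" for x
    using Suc.prems[OF that] by auto
  moreover have "Ck_on k S (\<lambda>x. \<D> f x v)" for v
    by (rule Suc.IH) (use Suc.prems in fastforce)
  ultimately show ?case by simp
qed

lemma Ck_on_const: "open S \<Longrightarrow> Ck_on k S (\<lambda>x. c)"
proof (induction k arbitrary: c)
  case (Suc k)
  show ?case by (rule Ck_on_SucI[where f'="\<lambda>x v. 0"]) (use Suc in auto)
qed simp

lemma Ck_on_bounded_linear:
  assumes "open S" "bounded_linear f"
  shows "Ck_on k S f"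
proof (cases k)
  case 0
  then show ?thesis using assms(2) by (simp add: linear_continuous_on)
next
  case (Suc n)
  show ?thesis unfolding Suc
    by (rule Ck_on_SucI[OF assms(1), where f'="\<lambda>x. f"])
      (use assms in \<open>auto intro: Ck_on_const bounded_linear_imp_has_derivative\<close>)
qed

lemma Ck_on_add:
  assumes "open S" "Ck_on k S f" "Ck_on k S g"
  shows "Ck_on k S (\<lambda>x. f x + g x)"
  using assms(2,3)
proof (induction k arbitrary: f g)
  case 0
  then show ?case by (simp add: continuous_on_add)
next
  case (Suc k)
  show ?case
    by (rule Ck_on_SucI[OF assms(1) has_derivative_add[OF Ck_on_SucD(1) Ck_on_SucD(1)]])
      (use Suc.prems Suc.IH in auto)
qed

lemma Ck_on_bounded_linear_comp:
  assumes "open S" "bounded_linear h" "Ck_on k S f"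
  shows "Ck_on k S (\<lambda>x. h (f x))"
  using assms(3)
proof (induction k arbitrary: f)
  case 0
  then show ?case using assms(2) by (simp add: bounded_linear.continuous_on)
next
  case (Suc k)
  show ?case
    by (rule Ck_on_SucI[OF assms(1) bounded_linear.has_derivative[OF assms(2) Ck_on_SucD(1)]])
      (use Suc.prems Suc.IH in auto)
qed

lemma Ck_on_sum:
  assumes "open S" "\<And>i. i \<in> I \<Longrightarrow> Ck_on k S (f i)"
  shows "Ck_on k S (\<lambda>x. \<Sum>i\<in>I. f i x)"
  using assms(2)
proof (induction I rule: infinite_finite_induct)
  case (insert i I)
  then show ?case using Ck_on_add[OF assms(1), of k "f i" "\<lambda>x. \<Sum>i\<in>I. f i x"] by simp
qed (use Ck_on_const[OF assms(1)] in simp_all)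

lemma Ck_on_bilinear:
  assumes "open S" "bounded_bilinear h" "Ck_on k S f" "Ck_on k S g"
  shows "Ck_on k S (\<lambda>x. h (f x) (g x))"
  using assms(3,4)
proof (induction k arbitrary: f g)
  case 0
  then show ?case using assms(2) by (simp add: bounded_bilinear.continuous_on)
next
  case (Suc k)
  note fg = Ck_on_Suc_imp[OF Suc.prems(1)] Ck_on_Suc_imp[OF Suc.prems(2)]
  show ?case
    by (rule Ck_on_SucI[OF assms(1) bounded_bilinear.FDERIV[OF assms(2) Ck_on_SucD(1) Ck_on_SucD(1)]])
      (use Suc.prems Suc.IH fg in \<open>auto intro!: Ck_on_add[OF assms(1)]\<close>)
qed

lemmas Ck_on_scaleR = Ck_on_bilinear[OF _ bounded_bilinear_scaleR]

lemma linear_coords: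
  assumes "linear A" "x = (\<Sum>b\<in>B. r b *\<^sub>R b)"
  shows "A x = (\<Sum>b\<in>B. r b *\<^sub>R A b)"
  using assms by (simp add: linear_sum linear_scale)

text \<open>Regularity of \<open>A\<close> is known for each fixed vector, not for \<open>A\<close>
  as an operator-valued map. Expanding the argument \<open>f x\<close> in a basis turns the
  expression into a finite sum of products of regular functions.\<close>

lemma Ck_on_apply:
  fixes A :: "'x::real_normed_vector \<Rightarrow> 'a::real_normed_vector \<Rightarrow> 'b::real_normed_vector"
  assumes fd: "fin_dim TYPE('a)" and "open S" and lin: "\<And>x. x \<in> S \<Longrightarrow> linear (A x)"
    and A: "\<And>u. Ck_on k S (\<lambda>x. A x u)" and f: "Ck_on k S f"
  shows "Ck_on k S (\<lambda>x. A x (f x))"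
proof -
  obtain B :: "'a set" and r where B: "finite B" "\<And>b. bounded_linear (r b)" "\<And>x. x = (\<Sum>b\<in>B. r b x *\<^sub>R b)"
    using fin_dim_coords[OF fd] by metis
  have "Ck_on k S (\<lambda>x. \<Sum>b\<in>B. r b (f x) *\<^sub>R A x b)"
    using assms by (intro Ck_on_sum Ck_on_scaleR Ck_on_bounded_linear_comp[OF _ B(2)]) auto
  then show ?thesis
    by (rule Ck_on_cong[OF \<open>open S\<close>, rotated]) (use linear_coords[OF lin B(3)] in metis)
qed

text \<open>The derivative of the composite is \<open>\<D> g (f x)\<close> applied to
  \<open>\<D> f x v\<close>, where both the operator and its argument vary.
  \<open>Ck_on_apply\<close> handles this, and it is what brings in finite dimension.\<close>

lemma Ck_on_compose:
  fixes f :: "'x::real_normed_vector \<Rightarrow> 'a::real_normed_vector" and g :: "'a \<Rightarrow> 'b::real_normed_vector"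
  assumes fd: "fin_dim TYPE('a)" and "open S" "open T" "f ` S \<subseteq> T" "Ck_on k S f" "Ck_on k T g"
  shows "Ck_on k S (\<lambda>x. g (f x))"
  using assms(4-6)
proof (induction k arbitrary: g)
  case 0
  then show ?case by (simp, metis (no_types) continuous_on_compose2)
next
  case (Suc k)
  have gd: "x \<in> S \<Longrightarrow> (g has_derivative \<D> g (f x)) (at (f x))" for x
    using Ck_on_SucD(1)[OF Suc.prems(3)] Suc.prems(1) by blast
  have lin: "linear (\<D> g (f x))" if "x \<in> S" for x
    using gd[OF that] has_derivative_linear by blast
  show ?case
  proof (rule Ck_on_SucI[OF \<open>open S\<close> has_derivative_compose[OF Ck_on_SucD(1)[OF Suc.prems(2)] gd]])
    fix v
    show "Ck_on k S (\<lambda>x. \<D> g (f x) (\<D> f x v))"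
    proof (rule Ck_on_apply[OF fd \<open>open S\<close> lin])
      show "Ck_on k S (\<lambda>x. \<D> g (f x) u)" for u
        by (rule Suc.IH[of "\<lambda>y. \<D> g y u"])
          (use Suc.prems Ck_on_Suc_imp Ck_on_SucD(2) in blast)+
      show "Ck_on k S (\<lambda>x. \<D> f x v)"
        by (rule Ck_on_SucD(2)[OF Suc.prems(2)])
    qed
  qed auto
qed

lemma smooth_onD: "smooth_on S f \<Longrightarrow> x \<in> S \<Longrightarrow> (f has_derivative \<D> f x) (at x)"
  unfolding smooth_on_def using Ck_on_SucD(1) by blast

lemma smooth_on_linear: "smooth_on S f \<Longrightarrow> x \<in> S \<Longrightarrow> linear (\<D> f x)"
  using smooth_onD has_derivative_linear by blast

lemma smooth_on_differentiable: "smooth_on S f \<Longrightarrow> x \<in> S \<Longrightarrow> f differentiable (at x)"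
  using smooth_onD unfolding differentiable_def by blast

lemma smooth_on_deriv: "smooth_on S f \<Longrightarrow> smooth_on S (\<lambda>x. \<D> f x v)"
  unfolding smooth_on_def using Ck_on_SucD(2) by blast

lemma smooth_on_cong: "open S \<Longrightarrow> smooth_on S f \<Longrightarrow> (\<And>x. x \<in> S \<Longrightarrow> f x = g x) \<Longrightarrow> smooth_on S g"
  unfolding smooth_on_def using Ck_on_cong by metis

lemma smooth_on_subset: "smooth_on S f \<Longrightarrow> T \<subseteq> S \<Longrightarrow> smooth_on T f"
  unfolding smooth_on_def using Ck_on_subset by blast

lemma smooth_on_continuous: "smooth_on S f \<Longrightarrow> continuous_on S f"
  unfolding smooth_on_def using Ck_on_continuous by blast

lemma smooth_on_local:
  assumes "open S" "\<And>x. x \<in> S \<Longrightarrow> \<exists>U. open U \<and> x \<in> U \<and> smooth_on U f"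
  shows "smooth_on S f"
  unfolding smooth_on_def using Ck_on_local[OF assms(1)] assms(2) unfolding smooth_on_def by metis

lemma smooth_on_const: "open S \<Longrightarrow> smooth_on S (\<lambda>x. c)"
  unfolding smooth_on_def using Ck_on_const by blast

lemma smooth_on_bounded_linear: "open S \<Longrightarrow> bounded_linear f \<Longrightarrow> smooth_on S f"
  unfolding smooth_on_def using Ck_on_bounded_linear by blast

lemma smooth_on_add: "open S \<Longrightarrow> smooth_on S f \<Longrightarrow> smooth_on S g \<Longrightarrow> smooth_on S (\<lambda>x. f x + g x)"
  unfolding smooth_on_def using Ck_on_add by blast

lemma smooth_on_bounded_linear_comp:
  "open S \<Longrightarrow> bounded_linear h \<Longrightarrow> smooth_on S f \<Longrightarrow> smooth_on S (\<lambda>x. h (f x))"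
  unfolding smooth_on_def using Ck_on_bounded_linear_comp by blast

lemma smooth_on_minus: "open S \<Longrightarrow> smooth_on S f \<Longrightarrow> smooth_on S (\<lambda>x. - f x)"
  by (rule smooth_on_bounded_linear_comp) (auto intro: bounded_linear_minus bounded_linear_ident)

lemma smooth_on_diff: "open S \<Longrightarrow> smooth_on S f \<Longrightarrow> smooth_on S g \<Longrightarrow> smooth_on S (\<lambda>x. f x - g x)"
  using smooth_on_add[of S f "\<lambda>x. - g x"] smooth_on_minus[of S g] by simp

lemma smooth_on_sum:
  "open S \<Longrightarrow> (\<And>i. i \<in> I \<Longrightarrow> smooth_on S (f i)) \<Longrightarrow> smooth_on S (\<lambda>x. \<Sum>i\<in>I. f i x)"
  unfolding smooth_on_def using Ck_on_sum by metis

lemma smooth_on_scaleR: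
  "open S \<Longrightarrow> smooth_on S f \<Longrightarrow> smooth_on S g \<Longrightarrow> smooth_on S (\<lambda>x. f x *\<^sub>R g x)"
  unfolding smooth_on_def using Ck_on_scaleR by metis

lemma smooth_on_mult:
  fixes f g :: "'a::real_normed_vector \<Rightarrow> real"
  shows "open S \<Longrightarrow> smooth_on S f \<Longrightarrow> smooth_on S g \<Longrightarrow> smooth_on S (\<lambda>x. f x * g x)"
  using smooth_on_scaleR[of S f g] by simp

lemma smooth_on_apply:
  fixes A :: "'x::real_normed_vector \<Rightarrow> 'a::real_normed_vector \<Rightarrow> 'b::real_normed_vector"
  assumes "fin_dim TYPE('a)" "open S" "\<And>x. x \<in> S \<Longrightarrow> linear (A x)"
    "\<And>u. smooth_on S (\<lambda>x. A x u)" "smooth_on S f"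
  shows "smooth_on S (\<lambda>x. A x (f x))"
  using assms Ck_on_apply[OF assms(1,2)] unfolding smooth_on_def by blast

lemma smooth_on_compose:
  fixes f :: "'x::real_normed_vector \<Rightarrow> 'a::real_normed_vector" and g :: "'a \<Rightarrow> 'b::real_normed_vector"
  assumes "fin_dim TYPE('a)" "open S" "open T" "f ` S \<subseteq> T" "smooth_on S f" "smooth_on T g"
  shows "smooth_on S (\<lambda>x. g (f x))"
  using assms Ck_on_compose[OF assms(1-4)] unfolding smooth_on_def by blast

lemma smooth_on_dderiv:
  fixes f :: "'a::real_normed_vector \<Rightarrow> 'b::real_normed_vector"
  assumes "fin_dim TYPE('a)" "open S" "smooth_on S f" "smooth_on S h"
  shows "smooth_on S (\<lambda>x. \<D> f x (h x))"
  by (rule smooth_on_apply[OF assms(1,2)]) (use assms smooth_on_deriv smooth_on_linear in blast)+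

lemma has_derivative_apply:
  fixes A :: "'x::real_normed_vector \<Rightarrow> 'a::real_normed_vector \<Rightarrow> 'b::real_normed_vector"
  assumes fd: "fin_dim TYPE('a)" and "open S" "x \<in> S" and lin: "\<And>y. y \<in> S \<Longrightarrow> linear (A y)"
    and diff: "\<And>u. (\<lambda>y. A y u) differentiable (at x)"
    and f: "(f has_derivative f') (at x)" and A: "((\<lambda>y. A y (f x)) has_derivative A') (at x)"
  shows "((\<lambda>y. A y (f y)) has_derivative (\<lambda>u. A' u + A x (f' u))) (at x)"
proof -
  obtain B :: "'a set" and r where B: "finite B" "\<And>b. bounded_linear (r b)" "\<And>x. x = (\<Sum>b\<in>B. r b x *\<^sub>R b)"
    using fin_dim_coords[OF fd] by metis
  define D where "D b = \<D> (\<lambda>y. A y b) x" for b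
  have D: "((\<lambda>y. A y b) has_derivative D b) (at x)" for b
    unfolding D_def using diff frechet_derivative_works by blast
  have "((\<lambda>y. \<Sum>b\<in>B. r b (f x) *\<^sub>R A y b) has_derivative (\<lambda>u. \<Sum>b\<in>B. r b (f x) *\<^sub>R D b u)) (at x)"
    by (intro has_derivative_sum bounded_linear.has_derivative[OF bounded_linear_scaleR_right] D)
  then have "((\<lambda>y. A y (f x)) has_derivative (\<lambda>u. \<Sum>b\<in>B. r b (f x) *\<^sub>R D b u)) (at x)"
    by (rule has_derivative_transform_within_open[OF _ \<open>open S\<close> \<open>x \<in> S\<close>])
      (use linear_coords[OF lin B(3)] in metis)
  then have A': "A' = (\<lambda>u. \<Sum>b\<in>B. r b (f x) *\<^sub>R D b u)" using A has_derivative_unique by blast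
  have "((\<lambda>y. \<Sum>b\<in>B. r b (f y) *\<^sub>R A y b) has_derivative
      (\<lambda>u. \<Sum>b\<in>B. (r b (f x) *\<^sub>R D b u + r b (f' u) *\<^sub>R A x b))) (at x)"
    by (intro has_derivative_sum has_derivative_scaleR D bounded_linear.has_derivative[OF B(2)] f)
  moreover have "(\<Sum>b\<in>B. (r b (f x) *\<^sub>R D b u + r b (f' u) *\<^sub>R A x b)) = A' u + A x (f' u)" for u
    using linear_coords[OF lin[OF \<open>x \<in> S\<close>] B(3)[of "f' u"]] by (simp add: sum.distrib A')
  ultimately have "((\<lambda>y. \<Sum>b\<in>B. r b (f y) *\<^sub>R A y b) has_derivative (\<lambda>u. A' u + A x (f' u))) (at x)"
    by simp
  then show ?thesis
    by (rule has_derivative_transform_within_open[OF _ \<open>open S\<close> \<open>x \<in> S\<close>])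
      (use linear_coords[OF lin B(3)] in metis)
qed

section \<open>Symmetry of second derivatives\<close>

lemma real_mean_value_bound:
  fixes \<phi> :: "real \<Rightarrow> 'b::real_normed_vector"
  assumes "0 \<le> t" "\<And>s. 0 \<le> s \<Longrightarrow> s \<le> t \<Longrightarrow> (\<phi> has_vector_derivative d s) (at s)"
    and "\<And>s. 0 \<le> s \<Longrightarrow> s \<le> t \<Longrightarrow> norm (d s) \<le> B"
  shows "norm (\<phi> t - \<phi> 0) \<le> B * t"
proof -
  have "norm (\<phi> t - \<phi> 0) \<le> B * norm (t - 0)"
  proof (rule differentiable_bound[where S="{0..t}" and f'="\<lambda>s h. h *\<^sub>R d s"])
    show "(\<phi> has_derivative (\<lambda>h. h *\<^sub>R d s)) (at s within {0..t})" if "s \<in> {0..t}" for s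
      using assms(2)[of s] that unfolding has_vector_derivative_def
      by (auto intro: has_derivative_at_withinI)
    show "onorm (\<lambda>h. h *\<^sub>R d s) \<le> B" if "s \<in> {0..t}" for s
    proof (rule onorm_le)
      fix h :: real
      show "norm (h *\<^sub>R d s) \<le> B * norm h"
        using mult_right_mono[OF assms(3)[of s], of "\<bar>h\<bar>"] that by (simp add: mult.commute)
    qed
  qed (use assms in auto)
  then show ?thesis using assms(1) by simp
qed

text \<open>The mean value inequality is used twice: along \<open>v\<close> for the directional
  derivative in direction \<open>u\<close>, then along \<open>u\<close> for the difference of two
  translates of \<open>f\<close>. Each time the linear term predicted by the second derivative at
  \<open>x\<close> is subtracted, so that only its oscillation \<open>e\<close> remains.\<close>

lemma second_difference:
  fixes f :: "'a::real_normed_vector \<Rightarrow> 'b::real_normed_vector"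
  assumes S: "open S" "x \<in> S" "smooth_on S f" and e: "e > 0"
  shows "\<exists>\<delta>>0. \<forall>t. 0 \<le> t \<and> t < \<delta> \<longrightarrow>
    norm (f (x + t *\<^sub>R u + t *\<^sub>R v) - f (x + t *\<^sub>R u) - (f (x + t *\<^sub>R v) - f x)
      - (t * t) *\<^sub>R \<D> (\<lambda>y. \<D> f y u) x v) \<le> e * (t * t)"
proof -
  let ?Du = "\<lambda>y. \<D> f y u"
  let ?D2 = "\<lambda>y. \<D> ?Du y v"
  define c where "c = ?D2 x"
  have "continuous_on S ?D2" by (intro smooth_on_continuous smooth_on_deriv S(3))
  then have "isCont ?D2 x" using S continuous_on_eq_continuous_at by blast
  then have "\<forall>\<^sub>F y in nhds x. dist (?D2 y) c < e"
    using tendstoD[OF _ e] tendsto_at_iff_tendsto_nhds[of ?D2 x] unfolding c_def isCont_def by blast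
  moreover have "\<forall>\<^sub>F y in nhds x. y \<in> S" using S eventually_nhds by blast
  ultimately have "\<forall>\<^sub>F y in nhds x. y \<in> S \<and> dist (?D2 y) c < e" by eventually_elim simp
  then obtain d where d: "d > 0" "\<And>y. dist y x < d \<Longrightarrow> y \<in> S \<and> dist (?D2 y) c < e"
    unfolding eventually_nhds_metric by blast
  \<comment> \<open>Chosen so that the parallelogram at \<open>x\<close> with sides
    \<open>t *\<^sub>R u\<close> and \<open>t *\<^sub>R v\<close> stays within distance
    \<open>d\<close> of \<open>x\<close>; the summand 1 keeps the denominator positive.\<close>
  define \<delta> where "\<delta> = d / (norm u + norm v + 1)"
  have pos: "norm u + norm v + 1 > 0" by (simp add: add_nonneg_pos)
  have near: "y \<in> S \<and> norm (?D2 y - c) \<le> e"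
    if "y = x + s *\<^sub>R u + \<tau> *\<^sub>R v" "0 \<le> s" "s \<le> t" "0 \<le> \<tau>" "\<tau> \<le> t" "t < \<delta>" for y s \<tau> t
  proof -
    have "dist y x \<le> s * norm u + \<tau> * norm v"
      using norm_triangle_ineq[of "s *\<^sub>R u" "\<tau> *\<^sub>R v"] that by (simp add: dist_norm add.assoc)
    also have "\<dots> \<le> t * norm u + t * norm v" using that by (intro add_mono mult_right_mono) auto
    also have "\<dots> \<le> t * (norm u + norm v + 1)" using that by (simp add: algebra_simps)
    also have "\<dots> < d" using that(6) pos unfolding \<delta>_def by (simp add: pos_less_divide_eq)
    finally show ?thesis using d(2)[of y] by (simp add: dist_norm less_imp_le)
  qed
  show ?thesis
  proof (intro exI[of _ \<delta>] conjI allI impI)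
    show "\<delta> > 0" unfolding \<delta>_def using d(1) pos by simp
    fix t assume t: "0 \<le> t \<and> t < \<delta>"
    have 1: "norm (?Du (x + s *\<^sub>R u + t *\<^sub>R v) - ?Du (x + s *\<^sub>R u) - t *\<^sub>R c) \<le> e * t"
      if s: "0 \<le> s" "s \<le> t" for s
    proof -
      let ?\<psi> = "\<lambda>\<tau>. ?Du (x + s *\<^sub>R u + \<tau> *\<^sub>R v) - \<tau> *\<^sub>R c"
      have "norm (?\<psi> t - ?\<psi> 0) \<le> e * t"
      proof (rule real_mean_value_bound[where d="\<lambda>\<tau>. ?D2 (x + s *\<^sub>R u + \<tau> *\<^sub>R v) - c"])
        fix \<tau> assume \<tau>: "0 \<le> \<tau>" "\<tau> \<le> t"
        let ?y = "x + s *\<^sub>R u + \<tau> *\<^sub>R v"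
        have y: "?y \<in> S" "norm (?D2 ?y - c) \<le> e" using near[OF refl s \<tau>] t by auto
        then show "norm (?D2 ?y - c) \<le> e" by simp
        have lin: "linear (\<D> ?Du ?y)"
          using smooth_on_linear[OF smooth_on_deriv[OF S(3)] y(1)] .
        have "((\<lambda>\<tau>. x + s *\<^sub>R u + \<tau> *\<^sub>R v) has_derivative (\<lambda>h. h *\<^sub>R v)) (at \<tau>)"
          by (auto intro!: derivative_eq_intros)
        from has_derivative_compose[OF this smooth_onD[OF smooth_on_deriv[OF S(3), of u] y(1)]]
        have "((\<lambda>\<tau>. ?Du (x + s *\<^sub>R u + \<tau> *\<^sub>R v)) has_vector_derivative ?D2 ?y) (at \<tau>)"
          unfolding has_vector_derivative_def by (simp add: linear_scale[OF lin])
        then show "(?\<psi> has_vector_derivative ?D2 ?y - c) (at \<tau>)"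
          by (auto intro!: derivative_eq_intros)
      qed (use t in auto)
      then show ?thesis by (simp add: algebra_simps)
    qed
    let ?\<phi> = "\<lambda>s. f (x + s *\<^sub>R u + t *\<^sub>R v) - f (x + s *\<^sub>R u) - (s * t) *\<^sub>R c"
    have "norm (?\<phi> t - ?\<phi> 0) \<le> (e * t) * t"
    proof (rule real_mean_value_bound[where
          d="\<lambda>s. ?Du (x + s *\<^sub>R u + t *\<^sub>R v) - ?Du (x + s *\<^sub>R u) - t *\<^sub>R c"])
      fix s assume s: "0 \<le> s" "s \<le> t"
      show "norm (?Du (x + s *\<^sub>R u + t *\<^sub>R v) - ?Du (x + s *\<^sub>R u) - t *\<^sub>R c) \<le> e * t" by (rule 1[OF s])
      have vd: "((\<lambda>s. f (x + s *\<^sub>R u + \<tau> *\<^sub>R v)) has_vector_derivative ?Du (x + s *\<^sub>R u + \<tau> *\<^sub>R v)) (at s)"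
        if \<tau>: "0 \<le> \<tau>" "\<tau> \<le> t" for \<tau>
      proof -
        let ?y = "x + s *\<^sub>R u + \<tau> *\<^sub>R v"
        have y: "?y \<in> S" using near[OF refl s \<tau>] t by auto
        have "((\<lambda>s. x + s *\<^sub>R u + \<tau> *\<^sub>R v) has_derivative (\<lambda>h. h *\<^sub>R u)) (at s)"
          by (auto intro!: derivative_eq_intros)
        from has_derivative_compose[OF this smooth_onD[OF S(3) y]]
        show ?thesis
          unfolding has_vector_derivative_def by (simp add: linear_scale[OF smooth_on_linear[OF S(3) y]])
      qed
      show "(?\<phi> has_vector_derivative ?Du (x + s *\<^sub>R u + t *\<^sub>R v) - ?Du (x + s *\<^sub>R u) - t *\<^sub>R c) (at s)"
        by (intro has_vector_derivative_diff vd[of t] vd[of 0, simplified])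
          (use t in \<open>auto intro!: derivative_eq_intros\<close>)
    qed (use t in auto)
    then show "norm (f (x + t *\<^sub>R u + t *\<^sub>R v) - f (x + t *\<^sub>R u) - (f (x + t *\<^sub>R v) - f x)
      - (t * t) *\<^sub>R ?D2 x) \<le> e * (t * t)"
      by (simp add: c_def algebra_simps)
  qed
qed

text \<open>The second difference does not change when \<open>u\<close> and \<open>v\<close> are
  exchanged, and divided by \<open>t * t\<close> it approximates both mixed derivatives.\<close>

lemma second_derivative_symmetric:
  fixes f :: "'a::real_normed_vector \<Rightarrow> 'b::real_normed_vector"
  assumes S: "open S" "x \<in> S" "smooth_on S f"
  shows "\<D> (\<lambda>y. \<D> f y u) x v
       = \<D> (\<lambda>y. \<D> f y v) x u" (is "?c = ?d")
proof -
  have "norm (?c - ?d) \<le> 2 * e" if e: "e > 0" for e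
  proof -
    obtain \<delta>1 where d1: "\<delta>1 > 0" "\<And>t. 0 \<le> t \<Longrightarrow> t < \<delta>1 \<Longrightarrow>
      norm (f (x + t *\<^sub>R u + t *\<^sub>R v) - f (x + t *\<^sub>R u) - (f (x + t *\<^sub>R v) - f x) - (t * t) *\<^sub>R ?c) \<le> e
          * (t * t)"
      using second_difference[OF S e, of u v] by blast
    obtain \<delta>2 where d2: "\<delta>2 > 0" "\<And>t. 0 \<le> t \<Longrightarrow> t < \<delta>2 \<Longrightarrow>
      norm (f (x + t *\<^sub>R v + t *\<^sub>R u) - f (x + t *\<^sub>R v) - (f (x + t *\<^sub>R u) - f x) - (t * t) *\<^sub>R ?d) \<le> e
          * (t * t)"
      using second_difference[OF S e, of v u] by blast
    define t where "t = min \<delta>1 \<delta>2 / 2"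
    have t: "0 < t" "t < \<delta>1" "t < \<delta>2" using d1(1) d2(1) by (auto simp: t_def)
    let ?\<Delta> = "f (x + t *\<^sub>R u + t *\<^sub>R v) - f (x + t *\<^sub>R u) - (f (x + t *\<^sub>R v) - f x)"
    have "norm (?\<Delta> - (t * t) *\<^sub>R ?c) \<le> e * (t * t)" using d1(2) t by simp
    moreover have "norm (?\<Delta> - (t * t) *\<^sub>R ?d) \<le> e * (t * t)"
      using d2(2)[of t] t by (simp add: algebra_simps)
    ultimately have "norm ((?\<Delta> - (t * t) *\<^sub>R ?d) - (?\<Delta> - (t * t) *\<^sub>R ?c)) \<le> e * (t * t) + e * (t * t)"
      by (intro order_trans[OF norm_triangle_ineq4 add_mono]) auto
    then have "norm ((t * t) *\<^sub>R (?c - ?d)) \<le> 2 * e * (t * t)" by (simp add: algebra_simps)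
    then have "(t * t) * norm (?c - ?d) \<le> (t * t) * (2 * e)" by (simp add: mult.commute)
    then show ?thesis using t(1) by (simp add: mult_le_cancel_left)
  qed
  note bound = this
  have "norm (?c - ?d) \<le> 0 + e" if "e > 0" for e
    using bound[of "e / 2"] that by simp
  then have "norm (?c - ?d) \<le> 0" by (rule field_le_epsilon)
  then show ?thesis by simp
qed

section \<open>Linear equations with varying coefficients\<close>

lemma has_derivative_scaleR_zero:
  fixes c :: "'a::real_normed_vector \<Rightarrow> real" and d :: "'a \<Rightarrow> 'b::real_normed_vector"
  assumes c: "isCont c x" and d: "(d has_derivative d') (at x)" and "d x = 0"
  shows "((\<lambda>y. c y *\<^sub>R d y) has_derivative (\<lambda>u. c x *\<^sub>R d' u)) (at x)"
proof -
  have bl: "bounded_linear d'" using d by (rule has_derivative_bounded_linear)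
  then obtain K where K: "\<And>u. norm (d' u) \<le> norm u * K" using bounded_linear.bounded by blast
  have lim: "((\<lambda>y. (d y - d x - d' (y - x)) /\<^sub>R norm (y - x)) \<longlongrightarrow> 0) (at x)"
    using d unfolding has_derivative_at_within by simp
  have c0: "((\<lambda>y. c y - c x) \<longlongrightarrow> 0) (at x)"
    using c unfolding isCont_def by (rule LIM_zero)
  have 1: "((\<lambda>y. c y *\<^sub>R ((d y - d x - d' (y - x)) /\<^sub>R norm (y - x))) \<longlongrightarrow> c x *\<^sub>R 0) (at x)"
    by (intro tendsto_scaleR lim) (use c in \<open>simp add: isCont_def\<close>)
  \<comment> \<open>The difference quotient splits into \<open>c y\<close> times the remainder of
    \<open>d\<close>, and \<open>c y - c x\<close> times a bounded quotient. For both, continuity of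
    \<open>c\<close> at \<open>x\<close> is enough; later \<open>c\<close> is a coordinate of a
    solution not yet known to be differentiable.\<close>
  have 2: "((\<lambda>y. (c y - c x) *\<^sub>R (d' (y - x) /\<^sub>R norm (y - x))) \<longlongrightarrow> 0) (at x)"
  proof (rule Lim_null_comparison)
    have "norm (d' (y - x) /\<^sub>R norm (y - x)) \<le> \<bar>K\<bar>" for y
    proof (cases "y = x")
      case True then show ?thesis using linear_0[OF bounded_linear.linear[OF bl]] by simp
    next
      case False
      have "norm (d' (y - x)) \<le> norm (y - x) * \<bar>K\<bar>"
        using K[of "y - x"] by (meson abs_ge_self mult_left_mono norm_ge_zero order_trans)
      then show ?thesis using False by (simp add: field_simps)
    qed
    then show "\<forall>\<^sub>F y in at x. norm ((c y - c x) *\<^sub>R (d' (y - x) /\<^sub>R norm (y - x))) \<le> \<bar>c y - c x\<bar> * \<bar>K\<bar>"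
      by (intro always_eventually allI) (metis abs_ge_zero mult_left_mono norm_scaleR)
    show "((\<lambda>y. \<bar>c y - c x\<bar> * \<bar>K\<bar>) \<longlongrightarrow> 0) (at x)"
      using tendsto_mult_right[OF tendsto_rabs[OF c0], of "\<bar>K\<bar>"] by simp
  qed
  have "((\<lambda>y. (c y *\<^sub>R d y - c x *\<^sub>R d x - c x *\<^sub>R d' (y - x)) /\<^sub>R norm (y - x)) \<longlongrightarrow> c x *\<^sub>R 0 + 0) (at x)"
    by (rule Lim_transform_eventually[OF tendsto_add[OF 1 2]])
      (simp add: \<open>d x = 0\<close> algebra_simps)
  then show ?thesis
    unfolding has_derivative_at_within
    by (simp add: bl bounded_linear_const_scaleR bounded_linear.linear)
qed

lemma linear_left_inverse:
  fixes A :: "'a::real_normed_vector \<Rightarrow> 'b::real_normed_vector"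
  assumes "fin_dim TYPE('b)" "linear A" "inj A"
  obtains L where "bounded_linear L" "\<And>u. L (A u) = u"
proof -
  obtain L where "linear L" "L \<circ> A = id" using linear_injective_left_inverse[OF assms(2,3)] by blast
  then show ?thesis using that fin_dim_bounded_linear[OF assms(1)] by (metis comp_apply id_apply)
qed

text \<open>With a left inverse \<open>L\<close> of \<open>A x\<close>, the equation gives
  \<open>f y - L (w y) = - (L (A y (f y)) - f y)\<close>, and \<open>L \<circ> A y\<close> tends to
  the identity. Once it is within 1/2 of the identity, \<open>f y\<close> is bounded by
  \<open>2 * norm (L (w y))\<close>, so the error tends to 0. Only a left inverse is available,
  since the target may be larger than the domain, as for the inclusion of a fiber.\<close>

lemma isCont_solve:
  fixes A :: "'x::real_normed_vector \<Rightarrow> 'a::real_normed_vector \<Rightarrow> 'b::real_normed_vector"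
  assumes fd: "fin_dim TYPE('a)" "fin_dim TYPE('b)" and "open S" "x \<in> S"
    and lin: "\<And>y. y \<in> S \<Longrightarrow> linear (A y)" and inj: "inj (A x)"
    and A: "\<And>u. isCont (\<lambda>y. A y u) x" and w: "isCont w x" and eq: "\<And>y. y \<in> S \<Longrightarrow> A y (f y) = w y"
  shows "isCont f x"
proof -
  obtain B :: "'a set" and r where B: "finite B" "\<And>b. bounded_linear (r b)" "\<And>x. x = (\<Sum>b\<in>B. r b x *\<^sub>R b)"
    using fin_dim_coords[OF fd(1)] by metis
  obtain L where L: "bounded_linear L" "\<And>u. L (A x u) = u"
    using linear_left_inverse[OF fd(2) lin[OF \<open>x \<in> S\<close>] inj] by metis
  \<comment> \<open>An upper bound for the operator norm of \<open>L \<circ> A y - id\<close> made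
    of finitely many continuous functions, vanishing at \<open>x\<close>.\<close>
  define E where "E y = (\<Sum>b\<in>B. onorm (r b) * norm (L (A y b) - b))" for y
  have "isCont E x"
    unfolding E_def by (intro continuous_intros bounded_linear.isCont[OF L(1)] A)
  moreover have "E x = 0" by (simp add: E_def L(2))
  ultimately have E0: "(E \<longlongrightarrow> 0) (at x)" by (metis isCont_def)
  have lin': "linear (\<lambda>u. L (A y u) - u)" if "y \<in> S" for y
    using linear_compose_sub[OF linear_compose[OF lin[OF that] bounded_linear.linear[OF L(1)]] linear_ident]
    by (simp add: o_def)
  have est: "norm (L (A y u) - u) \<le> norm u * E y" if "y \<in> S" for y u
  proof -
    have "norm (L (A y u) - u) \<le> (\<Sum>b\<in>B. norm (r b u *\<^sub>R (L (A y b) - b)))"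
      unfolding linear_coords[OF lin'[OF that] B(3)[of u]] by (rule norm_sum)
    also have "\<dots> \<le> (\<Sum>b\<in>B. (onorm (r b) * norm u) * norm (L (A y b) - b))"
      by (intro sum_mono) (simp add: mult_right_mono onorm[OF B(2), unfolded real_norm_def])
    finally show ?thesis by (simp add: E_def sum_distrib_left mult_ac)
  qed
  have evS: "\<forall>\<^sub>F y in at x. y \<in> S" using \<open>open S\<close> \<open>x \<in> S\<close> eventually_at_topological by blast
  have evE: "\<forall>\<^sub>F y in at x. E y < 1/2" using order_tendstoD(2)[OF E0, of "1/2"] by simp
  have Lw: "((\<lambda>y. L (w y)) \<longlongrightarrow> L (w x)) (at x)"
    using bounded_linear.isCont[OF L(1) w] by (simp add: isCont_def)
  have "((\<lambda>y. f y - L (w y)) \<longlongrightarrow> 0) (at x)"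
  proof (rule Lim_null_comparison)
    show "\<forall>\<^sub>F y in at x. norm (f y - L (w y)) \<le> 2 * norm (L (w y)) * E y"
      using evS evE
    proof eventually_elim
      case (elim y)
      have E: "0 \<le> E y" unfolding E_def by (intro sum_nonneg mult_nonneg_nonneg onorm_pos_le B(2)) auto
      have 1: "norm (L (w y) - f y) \<le> norm (f y) * E y" using est[OF elim(1), of "f y"] eq[OF elim(1)]
          by simp
      have "norm (f y) \<le> norm (L (w y)) + norm (L (w y) - f y)"
        using norm_triangle_ineq4[of "L (w y)" "L (w y) - f y"] by simp
      also have "\<dots> \<le> norm (L (w y)) + norm (f y) * (1/2)"
        using 1 elim(2) by (smt (verit) mult_left_mono norm_ge_zero)
      finally have "norm (f y) \<le> 2 * norm (L (w y))" by simp
      then have "norm (f y) * E y \<le> 2 * norm (L (w y)) * E y" using E by (rule mult_right_mono)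
      then show ?case using 1 by (simp add: norm_minus_commute)
    qed
    show "((\<lambda>y. 2 * norm (L (w y)) * E y) \<longlongrightarrow> 0) (at x)"
      using tendsto_mult[OF tendsto_mult_left[OF tendsto_norm[OF Lw], of 2] E0] by simp
  qed
  from tendsto_add[OF this Lw] have "(f \<longlongrightarrow> L (w x)) (at x)" by simp
  moreover have "L (w x) = f x" using eq[OF \<open>x \<in> S\<close>] L(2) by metis
  ultimately show ?thesis by (simp add: isCont_def)
qed

text \<open>The equation is rewritten as \<open>f y = L (w y) - (\<Sum>b\<in>B. r b (f y) *\<^sub>R
  L (A y b - A x b))\<close>. Each summand is a continuous coefficient times a differentiable
  function vanishing at \<open>x\<close>, so \<open>has_derivative_scaleR_zero\<close> yields
  differentiability of \<open>f\<close> from continuity alone. Differentiating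
  \<open>A y (f y) = w y\<close> then identifies the derivative.\<close>

lemma has_derivative_solve:
  fixes A :: "'x::real_normed_vector \<Rightarrow> 'a::real_normed_vector \<Rightarrow> 'b::real_normed_vector"
  assumes fd: "fin_dim TYPE('a)" "fin_dim TYPE('b)" and "open S" "x \<in> S"
    and lin: "\<And>y. y \<in> S \<Longrightarrow> linear (A y)" and inj: "inj (A x)"
    and A: "\<And>u. (\<lambda>y. A y u) differentiable (at x)" and w: "(w has_derivative w') (at x)"
    and eq: "\<And>y. y \<in> S \<Longrightarrow> A y (f y) = w y"
  obtains f' where "(f has_derivative f') (at x)"
    "\<And>v. A x (f' v) = w' v - \<D> (\<lambda>y. A y (f x)) x v"
proof -
  obtain B :: "'a set" and r where B: "finite B" "\<And>b. bounded_linear (r b)" "\<And>x. x = (\<Sum>b\<in>B. r b x *\<^sub>R b)"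
    using fin_dim_coords[OF fd(1)] by metis
  obtain L where L: "bounded_linear L" "\<And>u. L (A x u) = u"
    using linear_left_inverse[OF fd(2) lin[OF \<open>x \<in> S\<close>] inj] by metis
  have AD: "((\<lambda>y. A y u) has_derivative \<D> (\<lambda>y. A y u) x) (at x)" for u
    using A frechet_derivative_works by blast
  have contf: "isCont f x"
    by (rule isCont_solve[where A=A and w=w and f=f, OF fd \<open>open S\<close> \<open>x \<in> S\<close> lin inj _ _ eq])
      (use has_derivative_continuous AD w in blast)+
  define f' where "f' v = L (w' v) - (\<Sum>b\<in>B. r b (f x) *\<^sub>R L (\<D> (\<lambda>y. A y b) x v))" for v
  have 1: "((\<lambda>y. L (w y) - (\<Sum>b\<in>B. r b (f y) *\<^sub>R L (A y b - A x b))) has_derivative f') (at x)"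
    unfolding f'_def
  proof (intro has_derivative_diff has_derivative_sum has_derivative_scaleR_zero)
    show "((\<lambda>y. L (w y)) has_derivative (\<lambda>v. L (w' v))) (at x)"
      by (rule bounded_linear.has_derivative[OF L(1) w])
    fix b
    show "isCont (\<lambda>y. r b (f y)) x" by (rule bounded_linear.isCont[OF B(2) contf])
    have "((\<lambda>y. A y b - A x b) has_derivative \<D> (\<lambda>y. A y b) x) (at x)"
      using has_derivative_diff[OF AD has_derivative_const] by simp
    then show "((\<lambda>y. L (A y b - A x b)) has_derivative (\<lambda>v. L (\<D> (\<lambda>y. A y b) x v))) (at x)"
      by (rule bounded_linear.has_derivative[OF L(1)])
    show "L (A x b - A x b) = 0" by (simp add: linear_0[OF bounded_linear.linear[OF L(1)]])
  qed
  have f': "(f has_derivative f') (at x)"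
  proof (rule has_derivative_transform_within_open[OF 1 \<open>open S\<close> \<open>x \<in> S\<close>])
    fix y assume y: "y \<in> S"
    note LL = bounded_linear.linear[OF L(1)]
    have "linear (\<lambda>u. L (A y u - A x u))"
      using linear_compose[OF linear_compose_sub[OF lin[OF y] lin[OF \<open>x \<in> S\<close>]] LL] by (simp add: o_def)
    have "(\<Sum>b\<in>B. r b (f y) *\<^sub>R L (A y b - A x b)) = L (A y (f y) - A x (f y))"
      by (rule linear_coords[OF \<open>linear (\<lambda>u. L (A y u - A x u))\<close> B(3)[of "f y"], symmetric])
    then show "L (w y) - (\<Sum>b\<in>B. r b (f y) *\<^sub>R L (A y b - A x b)) = f y"
      using eq[OF y] L(2) by (simp add: linear_diff[OF LL])
  qed
  have "((\<lambda>y. A y (f y)) has_derivative (\<lambda>v. \<D> (\<lambda>y. A y (f x)) x v + A x (f' v))) (at x)"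
    by (rule has_derivative_apply[OF fd(1) \<open>open S\<close> \<open>x \<in> S\<close> lin A f' AD])
  then have "(w has_derivative (\<lambda>v. \<D> (\<lambda>y. A y (f x)) x v + A x (f' v))) (at x)"
    by (rule has_derivative_transform_within_open[OF _ \<open>open S\<close> \<open>x \<in> S\<close>]) (use eq in auto)
  then have "w' = (\<lambda>v. \<D> (\<lambda>y. A y (f x)) x v + A x (f' v))"
    using w has_derivative_unique by blast
  then show ?thesis using that[OF f'] by simp
qed

lemma linear_frechet_derivative_param:
  fixes A :: "'x::real_normed_vector \<Rightarrow> 'a::real_normed_vector \<Rightarrow> 'b::real_normed_vector"
  assumes "open S" "x \<in> S" and lin: "\<And>y. y \<in> S \<Longrightarrow> linear (A y)"
    and diff: "\<And>u. (\<lambda>y. A y u) differentiable (at x)"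
  shows "linear (\<lambda>u. \<D> (\<lambda>y. A y u) x v)"
proof (rule linearI)
  have D: "((\<lambda>y. A y u) has_derivative \<D> (\<lambda>y. A y u) x) (at x)" for u
    using diff frechet_derivative_works by blast
  fix a b and c :: real
  have "((\<lambda>y. A y (a + b)) has_derivative (\<lambda>v. \<D> (\<lambda>y. A y a) x v
      + \<D> (\<lambda>y. A y b) x v)) (at x)"
    by (rule has_derivative_transform_within_open[OF has_derivative_add[OF D D] assms(1,2)])
      (use lin linear_add in metis)
  from frechet_derivative_eq[OF this]
  show "\<D> (\<lambda>y. A y (a + b)) x v
      = \<D> (\<lambda>y. A y a) x v + \<D> (\<lambda>y. A y b) x v" by simp
  have "((\<lambda>y. A y (c *\<^sub>R a)) has_derivative (\<lambda>v. c *\<^sub>R \<D> (\<lambda>y. A y a) x v)) (at x)"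
    by (rule has_derivative_transform_within_open[OF
          bounded_linear.has_derivative[OF bounded_linear_scaleR_right D] assms(1,2)])
      (use lin linear_scale in metis)
  from frechet_derivative_eq[OF this]
  show "\<D> (\<lambda>y. A y (c *\<^sub>R a)) x v = c *\<^sub>R \<D> (\<lambda>y. A y a) x v"
    by simp
qed

text \<open>A bootstrap: every directional derivative of the solution solves a system with the same
  \<open>A\<close> and the right-hand side given by \<open>has_derivative_solve\<close>. The
  induction hypothesis is used twice, first to make \<open>f\<close>, and hence that right-hand
  side, of class \<open>k\<close>, then for the derivative itself.\<close>

lemma Ck_on_solve:
  fixes A :: "'x::real_normed_vector \<Rightarrow> 'a::real_normed_vector \<Rightarrow> 'b::real_normed_vector"
  assumes fd: "fin_dim TYPE('a)" "fin_dim TYPE('b)" and "open S"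
    and lin: "\<And>x. x \<in> S \<Longrightarrow> linear (A x)" and inj: "\<And>x. x \<in> S \<Longrightarrow> inj (A x)"
    and "\<And>u. Ck_on k S (\<lambda>x. A x u)" "Ck_on k S w" "\<And>x. x \<in> S \<Longrightarrow> A x (f x) = w x"
  shows "Ck_on k S f"
  using assms(6-8)
proof (induction k arbitrary: w f)
  case 0
  have "isCont f x" if "x \<in> S" for x
    by (rule isCont_solve[where A=A and w=w and f=f, OF fd \<open>open S\<close> that lin inj[OF that] _ _ 0(3)])
      (use 0(1,2) that \<open>open S\<close> continuous_on_eq_continuous_at in auto)
  then show ?case by (simp add: continuous_at_imp_continuous_on)
next
  case (Suc k)
  have "\<exists>f'. (f has_derivative f') (at x) \<and>
      (\<forall>v. A x (f' v) = \<D> w x v - \<D> (\<lambda>y. A y (f x)) x v)"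
    if x: "x \<in> S" for x
    by (rule has_derivative_solve[OF fd \<open>open S\<close> x lin inj[OF x] _ Ck_on_SucD(1)[OF Suc.prems(2) x]
        Suc.prems(3)])
      (use Suc.prems(1) x in auto)
  then obtain f' where f': "\<And>x. x \<in> S \<Longrightarrow> (f has_derivative f' x) (at x)"
    "\<And>x v. x \<in> S \<Longrightarrow> A x (f' x v) = \<D> w x v - \<D> (\<lambda>y. A y (f x)) x v"
    by metis
  have f: "Ck_on k S f" by (rule Suc.IH[of w]) (use Suc.prems Ck_on_Suc_imp in blast)+
  show ?case
  proof (rule Ck_on_SucI[OF \<open>open S\<close> f'(1)])
    fix v
    let ?DA = "\<lambda>x u. \<D> (\<lambda>y. A y u) x v"
    have linDA: "linear (?DA x)" if "x \<in> S" for x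
      by (rule linear_frechet_derivative_param[OF \<open>open S\<close> that lin]) (use Suc.prems(1) that in auto)
    have DA: "Ck_on k S (\<lambda>x. ?DA x (f x))"
      by (rule Ck_on_apply[OF fd(1) \<open>open S\<close> linDA _ f]) (use Suc.prems(1) in auto)
    have "Ck_on k S (\<lambda>x. \<D> w x v + - ?DA x (f x))"
      by (intro Ck_on_add[OF \<open>open S\<close>] Ck_on_SucD(2)[OF Suc.prems(2)]
          Ck_on_bounded_linear_comp[OF \<open>open S\<close> bounded_linear_minus[OF bounded_linear_ident]] DA)
    then show "Ck_on k S (\<lambda>x. f' x v)"
      by (rule Suc.IH[OF Ck_on_Suc_imp[OF Suc.prems(1)]]) (simp add: f'(2))
  qed
qed

lemma smooth_on_solve:
  fixes A :: "'x::real_normed_vector \<Rightarrow> 'a::real_normed_vector \<Rightarrow> 'b::real_normed_vector"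
  assumes "fin_dim TYPE('a)" "fin_dim TYPE('b)" "open S"
    "\<And>x. x \<in> S \<Longrightarrow> linear (A x)" "\<And>x. x \<in> S \<Longrightarrow> inj (A x)"
    "\<And>u. smooth_on S (\<lambda>x. A x u)" "smooth_on S w" "\<And>x. x \<in> S \<Longrightarrow> A x (f x) = w x"
  shows "smooth_on S f"
  using assms(6,7) Ck_on_solve[where A=A and w=w and f=f and S=S, OF assms(1-5) _ _ assms(8)] unfolding
      smooth_on_def by blast

text \<open>The inverse function theorem gives a differentiable local inverse \<open>h\<close>. Its
  derivative solves \<open>\<D> f (h y) (h' y v) = v\<close>, whose coefficients are as regular as
  \<open>h\<close>, so \<open>Ck_on_solve\<close> raises the order of \<open>h\<close> step by
  step.\<close>

lemma smooth_inverse_function: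
  fixes f :: "'a::euclidean_space \<Rightarrow> 'a"
  assumes "open U" "smooth_on U f" "x0 \<in> U" and inj: "inj (\<D> f x0)"
  obtains U' V h where "open U'" "U' \<subseteq> U" "x0 \<in> U'" "open V" "homeomorphism U' V f h"
    "smooth_on V h" "\<And>x. x \<in> U' \<Longrightarrow> inj (\<D> f x)"
proof -
  define f' where "f' x = Blinfun (\<D> f x)" for x
  have f': "blinfun_apply (f' x) = \<D> f x" if "x \<in> U" for x
    unfolding f'_def using smooth_onD[OF assms(2) that]
    by (simp add: bounded_linear_Blinfun_apply has_derivative_bounded_linear)
  have der: "(f has_derivative blinfun_apply (f' x)) (at x)" if "x \<in> U" for x
    using smooth_onD[OF assms(2) that] f'[OF that] by simp
  have cont: "continuous_on U f'"
  proof (rule continuous_on_blinfun_componentwise)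
    fix i :: 'a
    have "continuous_on U (\<lambda>x. \<D> f x i)"
      by (intro smooth_on_continuous smooth_on_deriv assms)
    then show "continuous_on U (\<lambda>x. blinfun_apply (f' x) i)"
      by (rule continuous_on_eq) (simp add: f')
  qed
  obtain L where L: "bounded_linear L" "\<And>u. L (\<D> f x0 u) = u"
    using linear_left_inverse[OF fin_dim_euclidean smooth_on_linear[OF assms(2,3)] inj] by metis
  have invf: "Blinfun L o\<^sub>L f' x0 = id_blinfun"
    by (rule blinfun_eqI) (simp add: f'[OF assms(3)] bounded_linear_Blinfun_apply[OF L(1)] L(2))
  obtain U' V h h' where uv: "open U'" "U' \<subseteq> U" "x0 \<in> U'" "open V" "homeomorphism U' V f h"
    "\<And>y. y \<in> V \<Longrightarrow> (h has_derivative (h' y)) (at y)"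
    "\<And>y. y \<in> V \<Longrightarrow> h' y = inv (blinfun_apply (f' (h y)))"
    "\<And>y. y \<in> V \<Longrightarrow> bij (blinfun_apply (f' (h y)))"
    using inverse_function_theorem[OF assms(1) der cont assms(3) invf] by metis
  have hU: "h y \<in> U'" "f (h y) = y" if "y \<in> V" for y
    using uv(5) that unfolding homeomorphism_def by auto
  have inj': "inj (\<D> f x)" if "x \<in> U'" for x
  proof -
    have "f x \<in> V" "h (f x) = x" using uv(5) that unfolding homeomorphism_def by auto
    then have "bij (blinfun_apply (f' x))" using uv(8) by metis
    then show ?thesis using f' uv(2) that by (metis bij_is_inj subsetD)
  qed
  have "Ck_on k V h" for k
  proof (induction k)
    case 0
    then show ?case using uv(5) by (simp add: homeomorphism_def)
  next
    case (Suc k)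
    show ?case
    proof (rule Ck_on_SucI[OF uv(4) uv(6)])
      fix v
      show "Ck_on k V (\<lambda>y. h' y v)"
      proof (rule Ck_on_solve[where A="\<lambda>y. \<D> f (h y)" and w="\<lambda>y. v",
            OF fin_dim_euclidean fin_dim_euclidean uv(4)])
        fix y assume y: "y \<in> V"
        show "linear (\<D> f (h y))"
          using smooth_on_linear[OF assms(2)] hU(1)[OF y] uv(2) by blast
        show "inj (\<D> f (h y))" using inj' hU(1)[OF y] by blast
        show "\<D> f (h y) (h' y v) = v"
          using uv(7,8)[OF y] f'[of "h y"] hU(1)[OF y] uv(2) by (metis bij_inv_eq_iff subsetD)
      next
        fix u
        have "Ck_on k U' (\<lambda>x. \<D> f x u)"
          using smooth_on_subset[OF smooth_on_deriv[OF assms(2)] uv(2)] unfolding smooth_on_def by blast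
        then show "Ck_on k V (\<lambda>y. \<D> f (h y) u)"
          by (rule Ck_on_compose[OF fin_dim_euclidean uv(4,1) _ Suc.IH, rotated])
            (use hU in auto)
      qed (rule Ck_on_const[OF uv(4)])
    qed auto
  qed
  then show ?thesis using that uv(1-5) inj' unfolding smooth_on_def by blast
qed

text \<open>The classical flat function is the case \<open>k = 0\<close>. Its derivatives produce
  powers of \<open>inverse x\<close>; carrying the power as a parameter gives a family whose
  derivatives are linear combinations of its members, over which smoothness can be proved by
  induction.\<close>

definition flat_exp :: "nat \<Rightarrow> real \<Rightarrow> real" where
  "flat_exp k x = (if x > 0 then inverse x ^ k / exp (inverse x) else 0)"

lemma flat_exp_tendsto_0: "(flat_exp k \<longlongrightarrow> 0) (at 0)"
proof -
  have "((\<lambda>x. inverse x ^ k / exp (inverse x)) \<longlongrightarrow> (0::real)) (at_right 0)"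
    by (rule filterlim_compose[OF tendsto_power_div_exp_0 filterlim_inverse_at_top_right])
  then have "(flat_exp k \<longlongrightarrow> 0) (at_right 0)"
    by (rule Lim_transform_eventually)
      (auto simp: flat_exp_def eventually_at_right_field intro!: exI[of _ 1])
  moreover have "(flat_exp k \<longlongrightarrow> 0) (at_left 0)"
    by (rule Lim_transform_eventually[OF tendsto_const])
      (auto simp: flat_exp_def eventually_at_left_field intro!: exI[of _ "-1"])
  ultimately show ?thesis by (simp add: filterlim_at_split)
qed

lemma flat_exp_deriv:
  "(flat_exp k has_real_derivative flat_exp (k + 2) x - real k * flat_exp (k + 1) x) (at x)"
proof -
  consider "x < 0" | "x = 0" | "x > 0" by linarith
  then show ?thesis
  proof cases
    case 1
    have "(flat_exp k has_real_derivative 0) (at x)"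
      by (rule has_field_derivative_transform_within_open[of "\<lambda>x. 0" _ _ "{..<0}"])
        (use 1 in \<open>auto simp: flat_exp_def\<close>)
    then show ?thesis using 1 by (simp add: flat_exp_def)
  next
    case 2
    \<comment> \<open>At 0 the difference quotient of \<open>flat_exp k\<close> is
      \<open>flat_exp (Suc k)\<close>, whose limit is already known.\<close>
    have "((\<lambda>h. flat_exp k (0 + h) / h) \<longlongrightarrow> 0) (at 0)"
    proof (rule Lim_transform_eventually[OF flat_exp_tendsto_0[of "Suc k"]])
      show "\<forall>\<^sub>F h in at 0. flat_exp (Suc k) h = flat_exp k (0 + h) / h"
        by (auto simp: flat_exp_def divide_simps intro!: always_eventually)
    qed
    then show ?thesis using 2 by (simp add: has_field_derivative_iff flat_exp_def)
  next
    case 3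
    have "((\<lambda>x. inverse x ^ k * exp (- inverse x)) has_real_derivative
        flat_exp (k + 2) x - real k * flat_exp (k + 1) x) (at x)"
    proof -
      have i: "(inverse has_real_derivative - (inverse x ^ Suc (Suc 0))) (at x)"
        using 3 by (intro DERIV_inverse) simp
      show ?thesis
        by (rule DERIV_cong[OF DERIV_mult[OF DERIV_power[OF i, of k]
            DERIV_chain2[OF DERIV_exp DERIV_minus[OF i]]]])
          (use 3 in \<open>cases k; auto simp: flat_exp_def exp_minus divide_inverse algebra_simps\<close>)
    qed
    then show ?thesis
      by (rule has_field_derivative_transform_within_open[of _ _ _ "{0<..}"])
        (use 3 in \<open>auto simp: flat_exp_def exp_minus divide_inverse\<close>)
  qed
qed

lemma smooth_on_flat_exp: "smooth_on UNIV (flat_exp k)"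
proof -
  have "Ck_on n UNIV (flat_exp k)" for n
  proof (induction n arbitrary: k)
    case 0
    then show ?case
      using flat_exp_deriv by (auto intro!: continuous_at_imp_continuous_on DERIV_isCont)
  next
    case (Suc n)
    show ?case
    proof (rule Ck_on_SucI)
      show "(flat_exp k has_derivative (*) (flat_exp (k + 2) x - real k * flat_exp (k + 1) x)) (at x)" for x
        using flat_exp_deriv by (simp add: has_field_derivative_def)
      show "Ck_on n UNIV (\<lambda>x. (flat_exp (k + 2) x - real k * flat_exp (k + 1) x) * v)" for v
      proof -
        have "Ck_on n UNIV (\<lambda>x. v * flat_exp (k + 2) x + (- v * real k) * flat_exp (k + 1) x)"
          by (intro Ck_on_add Ck_on_bounded_linear_comp[OF _ bounded_linear_mult_right] Suc.IH) auto
        then show ?thesis by (rule Ck_on_cong[rotated 2]) (auto simp: algebra_simps)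
      qed
    qed simp
  qed
  then show ?thesis by (simp add: smooth_on_def)
qed

text \<open>The flat function of \<open>r\<^sup>2\<close> minus the squared distance to
  \<open>a\<close>, normalised to 1 at \<open>a\<close>; squaring the distance makes it smooth at
  \<open>a\<close>.\<close>

lemma smooth_bump:
  fixes a :: "'a::euclidean_space"
  assumes "r > 0"
  obtains \<psi> :: "'a \<Rightarrow> real" where "smooth_on UNIV \<psi>" "\<psi> a = 1" "\<And>x. r \<le> dist x a \<Longrightarrow> \<psi> x = 0"
proof -
  define \<psi> where "\<psi> x = (1 / flat_exp 0 (r\<^sup>2)) * flat_exp 0 (r\<^sup>2 - (x - a) \<bullet> (x - a))" for x
  have pos: "flat_exp 0 (r\<^sup>2) > 0" using assms by (simp add: flat_exp_def)
  have 1: "smooth_on UNIV (\<lambda>x. x - a)"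
    by (intro smooth_on_diff smooth_on_const smooth_on_bounded_linear bounded_linear_ident) auto
  have "smooth_on UNIV (\<lambda>x. (x - a) \<bullet> (x - a))"
    using 1 Ck_on_bilinear[OF open_UNIV bounded_bilinear_inner] unfolding smooth_on_def by blast
  then have 2: "smooth_on UNIV (\<lambda>x. r\<^sup>2 - (x - a) \<bullet> (x - a))"
    by (intro smooth_on_diff smooth_on_const) auto
  have "smooth_on UNIV (\<lambda>x. flat_exp 0 (r\<^sup>2 - (x - a) \<bullet> (x - a)))"
    by (rule smooth_on_compose[OF fin_dim_euclidean open_UNIV open_UNIV _ 2 smooth_on_flat_exp]) simp
  then have "smooth_on UNIV \<psi>"
    unfolding \<psi>_def by (intro smooth_on_mult smooth_on_const) auto
  moreover have "\<psi> a = 1" using pos by (simp add: \<psi>_def)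
  moreover have "\<psi> x = 0" if "r \<le> dist x a" for x
  proof -
    have "r\<^sup>2 \<le> (x - a) \<bullet> (x - a)"
      using that assms by (simp add: dist_norm power2_norm_eq_inner[symmetric] power_mono)
    then show ?thesis by (simp add: \<psi>_def flat_exp_def)
  qed
  ultimately show ?thesis using that by blast
qed

section \<open>Inner products and traces\<close>

text \<open>A bare function instead of the type class: the form varies from point to point, and the
  model space of the base carries no inner product of its own.\<close>

definition inner_form :: "('a::real_vector \<Rightarrow> 'a \<Rightarrow> real) \<Rightarrow> bool" where
  "inner_form G \<longleftrightarrow> (\<forall>u. linear (G u)) \<and> (\<forall>u v. G u v = G v u) \<and> (\<forall>u. u \<noteq> 0 \<longrightarrow> 0 < G u u)"

lemma inner_formD:
  assumes "inner_form G"
  shows "linear (G u)" "linear (\<lambda>u. G u v)" "G u v = G v u" "u \<noteq> 0 \<Longrightarrow> 0 < G u u"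
    "G (u + u') v = G u v + G u' v" "G u (v + v') = G u v + G u v'"
    "G (u - u') v = G u v - G u' v" "G u (v - v') = G u v - G u v'"
    "G (c *\<^sub>R u) v = c * G u v" "G u (c *\<^sub>R v) = c * G u v" "G 0 v = 0" "G u 0 = 0"
    "G (- u) v = - G u v" "G u (- v) = - G u v"
proof -
  have l: "linear (G u)" for u using assms by (simp add: inner_form_def)
  have s: "G u v = G v u" for u v using assms by (simp add: inner_form_def)
  have r: "linear (\<lambda>u. G u v)" for v using l[of v] s[of _ v] by simp
  show "linear (G u)" "linear (\<lambda>u. G u v)" "G u v = G v u" by (fact l r s)+
  show "u \<noteq> 0 \<Longrightarrow> 0 < G u u" using assms by (simp add: inner_form_def)
  show "G (u + u') v = G u v + G u' v" "G u (v + v') = G u v + G u v'"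
    "G (u - u') v = G u v - G u' v" "G u (v - v') = G u v - G u v'"
    "G (c *\<^sub>R u) v = c * G u v" "G u (c *\<^sub>R v) = c * G u v" "G 0 v = 0" "G u 0 = 0"
    "G (- u) v = - G u v" "G u (- v) = - G u v"
    using linear_add[OF l] linear_add[OF r] linear_diff[OF l] linear_diff[OF r] linear_scale[OF l]
      linear_scale[OF r] linear_0[OF l] linear_0[OF r] linear_neg[OF l] linear_neg[OF r] by simp_all
qed

lemma inner_form_sum:
  assumes "inner_form G"
  shows "G (\<Sum>i\<in>I. f i) v = (\<Sum>i\<in>I. G (f i) v)" "G u (\<Sum>i\<in>I. f i) = (\<Sum>i\<in>I. G u (f i))"
  using linear_sum[OF inner_formD(2)[OF assms]] linear_sum[OF inner_formD(1)[OF assms]] by simp_all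

lemma inner_form_nonneg: "inner_form G \<Longrightarrow> 0 \<le> G u u"
  by (cases "u = 0") (auto simp: inner_formD less_imp_le)

lemma inner_form_eqI:
  assumes "inner_form G" "\<And>w. G z w = G z' w"
  shows "z = z'"
proof (rule ccontr)
  assume "z \<noteq> z'"
  then have "0 < G (z - z') (z - z')" by (intro inner_formD(4)[OF assms(1)]) simp
  then show False using assms(2) by (simp add: inner_formD(7)[OF assms(1)])
qed

text \<open>Sets rather than indexed families, so that bases adapted to a subspace arise by
  enlarging a set and traces split over subsets.\<close>

definition orthonormal_set :: "('a::real_vector \<Rightarrow> 'a \<Rightarrow> real) \<Rightarrow> 'a set \<Rightarrow> bool" where
  "orthonormal_set G E \<longleftrightarrow> finite E \<and> (\<forall>e\<in>E. \<forall>e'\<in>E. G e e' = (if e = e' then 1 else 0))"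

definition orthonormal_basis :: "('a::real_vector \<Rightarrow> 'a \<Rightarrow> real) \<Rightarrow> 'a set \<Rightarrow> bool" where
  "orthonormal_basis G E \<longleftrightarrow> orthonormal_set G E \<and> span E = UNIV"

lemma orthonormal_coeff:
  assumes "inner_form G" "orthonormal_set G E" "e \<in> E"
  shows "G (\<Sum>b\<in>E. c b *\<^sub>R b) e = c e"
proof -
  have "G (\<Sum>b\<in>E. c b *\<^sub>R b) e = (\<Sum>b\<in>E. c b * G b e)"
    by (simp add: inner_form_sum[OF assms(1)] inner_formD(9)[OF assms(1)])
  also have "\<dots> = (\<Sum>b\<in>E. if b = e then c b else 0)"
    using assms(2,3) by (intro sum.cong) (auto simp: orthonormal_set_def)
  also have "\<dots> = c e" using assms by (simp add: orthonormal_set_def)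
  finally show ?thesis .
qed

lemma orthonormal_independent:
  assumes "inner_form G" "orthonormal_set G E"
  shows "independent E"
proof (rule independent_if_scalars_zero)
  show "finite E" using assms by (simp add: orthonormal_set_def)
  show "c e = 0" if "(\<Sum>b\<in>E. c b *\<^sub>R b) = 0" "e \<in> E" for c e
    using orthonormal_coeff[OF assms that(2), of c] that(1) inner_formD(11)[OF assms(1)] by simp
qed

lemma orthonormal_expansion:
  assumes "inner_form G" "orthonormal_set G E" "x \<in> span E"
  shows "x = (\<Sum>e\<in>E. G x e *\<^sub>R e)"
proof -
  have fin: "finite E" using assms by (simp add: orthonormal_set_def)
  obtain c where c: "x = (\<Sum>e\<in>E. c e *\<^sub>R e)"
    using assms(3) span_finite[OF fin] by (metis (no_types, lifting) imageE)
  show ?thesis unfolding c using orthonormal_coeff[OF assms(1,2)] by (intro sum.cong) auto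
qed

text \<open>An orthonormal subset of \<open>K\<close> containing \<open>E0\<close> of greatest
  cardinality spans \<open>K\<close>: otherwise the normalised Gram-Schmidt remainder of a missing
  vector could be added. Cardinalities are bounded because orthonormal sets are independent.\<close>

lemma orthonormal_extend_subspace:
  assumes fd: "fin_dim TYPE('a)" and G: "inner_form (G :: 'a::real_normed_vector \<Rightarrow> 'a \<Rightarrow> real)"
    and K: "subspace K" and E0: "orthonormal_set G E0" "E0 \<subseteq> K"
  obtains E where "E0 \<subseteq> E" "orthonormal_set G E" "span E = K"
proof -
  obtain B :: "'a set" where B: "finite B" "span B = UNIV" using fd unfolding fin_dim_def by blast
  define P where "P n \<longleftrightarrow> (\<exists>E. E0 \<subseteq> E \<and> E \<subseteq> K \<and> orthonormal_set G E \<and> card E = n)" for n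
  have bd: "n \<le> card B" if "P n" for n
    using that independent_span_bound[OF B(1)] orthonormal_independent[OF G] B(2)
    unfolding P_def by (metis subset_UNIV)
  have "P (card E0)" using E0 unfolding P_def by blast
  then have "P (GREATEST n. P n)" using bd by (rule GreatestI_nat)
  then obtain E where E: "E0 \<subseteq> E" "E \<subseteq> K" "orthonormal_set G E" "card E = (GREATEST n. P n)"
    unfolding P_def by blast
  have fin: "finite E" using E(3) by (simp add: orthonormal_set_def)
  have sub: "span E \<subseteq> K" by (rule span_minimal[OF E(2) K])
  have "x \<in> span E" if xK: "x \<in> K" for x
  proof (rule ccontr)
    assume x: "x \<notin> span E"
    define y where "y = x - (\<Sum>e\<in>E. G x e *\<^sub>R e)"
    have s: "(\<Sum>e\<in>E. G x e *\<^sub>R e) \<in> span E" by (simp add: span_base span_scale span_sum)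
    then have y: "y \<noteq> 0" using x by (auto simp: y_def)
    have yK: "y \<in> K" unfolding y_def using subspace_diff[OF K xK] s sub by blast
    have orth: "G y e = 0" if "e \<in> E" for e
      unfolding y_def inner_formD(7)[OF G] using orthonormal_coeff[OF G E(3) that] by simp
    define z where "z = (1 / sqrt (G y y)) *\<^sub>R y"
    have pos: "G y y > 0" using y by (rule inner_formD(4)[OF G])
    then have zz: "G z z = 1" by (simp add: z_def inner_formD[OF G] field_simps)
    have ze: "G z e = 0" "G e z = 0" if "e \<in> E" for e
      using orth[OF that] inner_formD(3)[OF G] by (simp_all add: z_def inner_formD[OF G])
    have "z \<notin> E" using ze zz by force
    moreover have "orthonormal_set G (insert z E)"
      using E(3) ze zz \<open>z \<notin> E\<close> unfolding orthonormal_set_def by auto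
    moreover have "z \<in> K" unfolding z_def by (rule subspace_scale[OF K yK])
    ultimately have "P (Suc (card E))" unfolding P_def using E(1,2) fin
      by (intro exI[of _ "insert z E"]) auto
    then have "Suc (card E) \<le> (GREATEST n. P n)" using bd by (rule Greatest_le_nat)
    then show False using E(4) by simp
  qed
  then show ?thesis using that[OF E(1,3)] sub by blast
qed

lemma orthonormal_extend:
  assumes "fin_dim TYPE('a)" and "inner_form (G :: 'a::real_normed_vector \<Rightarrow> 'a \<Rightarrow> real)"
    and "orthonormal_set G E0"
  obtains E where "E0 \<subseteq> E" "orthonormal_basis G E"
  using orthonormal_extend_subspace[OF assms(1,2) subspace_UNIV assms(3)]
  unfolding orthonormal_basis_def by (metis subset_UNIV)

lemma orthonormal_basis_ex:
  assumes "fin_dim TYPE('a)" and "inner_form (G :: 'a::real_normed_vector \<Rightarrow> 'a \<Rightarrow> real)"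
  obtains E where "orthonormal_basis G E"
  using orthonormal_extend[OF assms, of "{}"] by (auto simp: orthonormal_set_def)

lemma orthogonal_decomposition:
  assumes fd: "fin_dim TYPE('a)" and G: "inner_form (G :: 'a::real_normed_vector \<Rightarrow> 'a \<Rightarrow> real)"
    and K: "subspace K"
  obtains k b where "w = k + b" "k \<in> K" "\<And>k'. k' \<in> K \<Longrightarrow> G b k' = 0" "\<And>k'. k' \<in> K \<Longrightarrow> G k' b = 0"
proof -
  obtain E where E: "orthonormal_set G E" "span E = K"
    using orthonormal_extend_subspace[OF fd G K, of "{}"] by (auto simp: orthonormal_set_def)
  define k where "k = (\<Sum>e\<in>E. G w e *\<^sub>R e)"
  have orth: "G (w - k) e = 0" if "e \<in> E" for e
    unfolding k_def inner_formD(7)[OF G] using orthonormal_coeff[OF G E(1) that] by simp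
  have b: "G (w - k) k' = 0" if "k' \<in> K" for k'
  proof -
    have "k' = (\<Sum>e\<in>E. G k' e *\<^sub>R e)" using orthonormal_expansion[OF G E(1)] that E(2) by blast
    then have "G (w - k) k' = (\<Sum>e\<in>E. G k' e *\<^sub>R G (w - k) e)"
      by (rule linear_coords[OF inner_formD(1)[OF G]])
    then show ?thesis using orth by simp
  qed
  have kK: "k \<in> K" unfolding k_def E(2)[symmetric] by (simp add: span_base span_scale span_sum)
  have b': "G k' (w - k) = 0" if "k' \<in> K" for k'
    using b[OF that] inner_formD(3)[OF G, of k'] by simp
  show ?thesis by (rule that[of k "w - k"]) (use kK b b' in auto)
qed

text \<open>Expanding one argument in \<open>E'\<close> and then the other in \<open>E\<close>
  writes both traces as the same double sum weighted by \<open>G e e'\<close>.\<close>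

lemma trace_orthonormal:
  fixes T :: "'a::real_vector \<Rightarrow> 'a \<Rightarrow> real"
  assumes G: "inner_form G" and E: "orthonormal_basis G E" "orthonormal_basis G E'"
    and T: "\<And>u. linear (T u)" "\<And>v. linear (\<lambda>u. T u v)"
  shows "(\<Sum>e\<in>E. T e e) = (\<Sum>e\<in>E'. T e e)"
proof -
  have ex: "x = (\<Sum>e\<in>E. G x e *\<^sub>R e)" "x = (\<Sum>e\<in>E'. G x e *\<^sub>R e)" for x
    using orthonormal_expansion[OF G] E unfolding orthonormal_basis_def by blast+
  have "(\<Sum>e\<in>E. T e e) = (\<Sum>e\<in>E. \<Sum>e'\<in>E'. G e e' * T e' e)"
  proof (rule sum.cong[OF refl])
    fix e
    show "T e e = (\<Sum>e'\<in>E'. G e e' * T e' e)"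
      using arg_cong[OF ex(2)[of e], of "\<lambda>u. T u e"]
      by (simp only: linear_sum[OF T(2)] linear_scale[OF T(2)] real_scaleR_def)
  qed
  also have "\<dots> = (\<Sum>e'\<in>E'. \<Sum>e\<in>E. G e e' * T e' e)" by (rule sum.swap)
  also have "\<dots> = (\<Sum>e'\<in>E'. T e' e')"
  proof (rule sum.cong[OF refl])
    fix e'
    have "T e' e' = (\<Sum>e\<in>E. G e' e * T e' e)"
      using arg_cong[OF ex(1)[of e'], of "T e'"]
      by (simp only: linear_sum[OF T(1)] linear_scale[OF T(1)] real_scaleR_def)
    then show "(\<Sum>e\<in>E. G e e' * T e' e) = T e' e'"
      by (simp add: inner_formD(3)[OF G, of e'])
  qed
  finally show ?thesis .
qed

lemma double_trace_orthonormal: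
  fixes R :: "'a::real_vector \<Rightarrow> 'a \<Rightarrow> 'a \<Rightarrow> 'a"
  assumes G: "inner_form G" and E: "orthonormal_basis G E" "orthonormal_basis G E'"
    and R: "\<And>v w. linear (\<lambda>u. R u v w)" "\<And>u w. linear (\<lambda>v. R u v w)" "\<And>u v. linear (\<lambda>w. R u v w)"
  shows "(\<Sum>e\<in>E. \<Sum>e'\<in>E. G (R e' e e) e') = (\<Sum>e\<in>E'. \<Sum>e'\<in>E'. G (R e' e e) e')"
proof -
  note G2 = inner_formD(2)[OF G]
  have "(\<Sum>e\<in>E. \<Sum>e'\<in>E. G (R e' e e) e') = (\<Sum>e\<in>E. \<Sum>e'\<in>E'. G (R e' e e) e')"
  proof (rule sum.cong[OF refl])
    fix e
    show "(\<Sum>e'\<in>E. G (R e' e e) e') = (\<Sum>e'\<in>E'. G (R e' e e) e')"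
      by (rule trace_orthonormal[where T="\<lambda>u v. G (R u e e) v", OF G E inner_formD(1)[OF G]
            linear_compose[OF R(1) G2, unfolded o_def]])
  qed
  also have "\<dots> = (\<Sum>e\<in>E'. \<Sum>e'\<in>E'. G (R e' e e) e')"
    by (rule trace_orthonormal[where T="\<lambda>u v. \<Sum>e'\<in>E'. G (R e' u v) e'", OF G E])
      (intro linear_compose_sum ballI linear_compose[OF R(3) G2, unfolded o_def]
        linear_compose[OF R(2) G2, unfolded o_def])+
  finally show ?thesis .
qed

text \<open>The representing vector is the combination of an orthonormal basis with coefficients
  \<open>L e\<close>; uniqueness is definiteness of \<open>G\<close>.\<close>

lemma inner_form_riesz:
  assumes fd: "fin_dim TYPE('a)" and G: "inner_form (G :: 'a::real_normed_vector \<Rightarrow> 'a \<Rightarrow> real)"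
    and L: "linear L"
  shows "\<exists>!z. \<forall>w. G z w = L w"
proof -
  obtain E where E: "orthonormal_basis G E" using orthonormal_basis_ex[OF fd G] .
  have ex: "x = (\<Sum>e\<in>E. G x e *\<^sub>R e)" for x
    using orthonormal_expansion[OF G] E unfolding orthonormal_basis_def by blast
  have "G (\<Sum>e\<in>E. L e *\<^sub>R e) w = L w" for w
    using linear_coords[OF L ex[of w]]
    by (subst inner_formD(3)[OF G]) (simp add: inner_form_sum[OF G] inner_formD(10)[OF G] mult.commute)
  then show ?thesis using inner_form_eqI[OF G] by metis
qed

section \<open>Local Riemannian geometry\<close>

definition second_derivative ::
  "('a::real_normed_vector \<Rightarrow> 'b::real_normed_vector) \<Rightarrow> 'a \<Rightarrow> 'a \<Rightarrow> 'a \<Rightarrow> 'b" where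
  "second_derivative f x u v = \<D> (\<lambda>y. \<D> f y v) x u"

definition metric_derivative ::
  "('a::real_normed_vector \<Rightarrow> 'a \<Rightarrow> 'a \<Rightarrow> real) \<Rightarrow> 'a \<Rightarrow> 'a \<Rightarrow> 'a \<Rightarrow> 'a \<Rightarrow> real" where
  "metric_derivative G x u v w = \<D> (\<lambda>y. G y v w) x u"

text \<open>Koszul's formula for constant vector fields, whose brackets vanish. The symbol is
  characterised by its products with all \<open>w\<close>, which avoids indices and the inverse
  matrix of the metric; the Riesz lemma makes \<open>THE\<close> well defined.\<close>

definition christoffel ::
  "('a::real_normed_vector \<Rightarrow> 'a \<Rightarrow> 'a \<Rightarrow> real) \<Rightarrow> 'a \<Rightarrow> 'a \<Rightarrow> 'a \<Rightarrow> 'a" where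
  "christoffel G x u v = (THE z. \<forall>w. 2 * G x z w =
     metric_derivative G x u v w + metric_derivative G x v u w - metric_derivative G x w u v)"

locale local_metric =
  fixes U :: "'a::real_normed_vector set" and G :: "'a \<Rightarrow> 'a \<Rightarrow> 'a \<Rightarrow> real"
  assumes fd: "fin_dim TYPE('a)" and open_U: "open U"
    and form: "x \<in> U \<Longrightarrow> inner_form (G x)"
    and smooth: "smooth_on U (\<lambda>x. G x u v)"
begin

lemma G_diff: "x \<in> U \<Longrightarrow> (\<lambda>y. G y u v) differentiable (at x)"
  using smooth smooth_on_differentiable by blast

lemma metric_derivative_linear:
  assumes "x \<in> U"
  shows "linear (\<lambda>u. metric_derivative G x u v w)" "linear (\<lambda>v. metric_derivative G x u v w)"
    "linear (\<lambda>w. metric_derivative G x u v w)"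
  unfolding metric_derivative_def
  by (rule smooth_on_linear[OF smooth assms],
      rule linear_frechet_derivative_param[where A="\<lambda>y v. G y v w",
        OF open_U assms inner_formD(2)[OF form] G_diff[OF assms]],
      assumption,
      rule linear_frechet_derivative_param[where A="\<lambda>y. G y v",
        OF open_U assms inner_formD(1)[OF form] G_diff[OF assms]])

lemma metric_derivative_sym:
  "x \<in> U \<Longrightarrow> metric_derivative G x u v w = metric_derivative G x u w v"
  unfolding metric_derivative_def
  using frechet_derivative_cong_open[OF open_U, of x "\<lambda>y. G y v w" "\<lambda>y. G y w v"]
    inner_formD(3)[OF form] by simp

lemma christoffel_ex1:
  assumes "x \<in> U"
  shows "\<exists>!z. \<forall>w. 2 * G x z w =
     metric_derivative G x u v w + metric_derivative G x v u w - metric_derivative G x w u v"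
proof -
  note l = metric_derivative_linear[OF assms]
  define L where "L w = (1/2) *\<^sub>R (metric_derivative G x u v w + metric_derivative G x v u w
      - metric_derivative G x w u v)" for w
  have "linear L"
    unfolding L_def by (intro linear_compose_scale_right linear_compose_add linear_compose_sub l)
  then have "\<exists>!z. \<forall>w. G x z w = L w" by (rule inner_form_riesz[OF fd form[OF assms]])
  moreover have "(G x z w = L w) \<longleftrightarrow> (2 * G x z w =
     metric_derivative G x u v w + metric_derivative G x v u w - metric_derivative G x w u v)" for z w
    by (auto simp: L_def)
  ultimately show ?thesis by simp
qed

lemma koszul:
  assumes "x \<in> U"
  shows "2 * G x (christoffel G x u v) w =
     metric_derivative G x u v w + metric_derivative G x v u w - metric_derivative G x w u v"
  using theI'[OF christoffel_ex1[OF assms, of u v]] unfolding christoffel_def by blast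

lemma christoffel_eqI:
  assumes "x \<in> U" "\<And>w. 2 * G x z w =
     metric_derivative G x u v w + metric_derivative G x v u w - metric_derivative G x w u v"
  shows "christoffel G x u v = z"
  using christoffel_ex1[OF assms(1), of u v] koszul[OF assms(1), of u v] assms(2) by blast

lemma christoffel_sym: "x \<in> U \<Longrightarrow> christoffel G x u v = christoffel G x v u"
  by (rule christoffel_eqI) (auto simp: koszul metric_derivative_sym[of x _ u v])

lemma christoffel_linear:
  assumes "x \<in> U"
  shows "linear (christoffel G x u)" "linear (\<lambda>u. christoffel G x u v)"
proof -
  note f = inner_formD[OF form[OF assms]]
  note l = metric_derivative_linear[OF assms]
  have 1: "linear (\<lambda>u. christoffel G x u v)" for v
  proof (rule linearI)
    show "christoffel G x (a + b) v = christoffel G x a v + christoffel G x b v" for a b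
      by (rule christoffel_eqI[OF assms])
        (simp add: f(5) distrib_left koszul[OF assms] linear_add[OF l(1)] linear_add[OF l(2)]
            linear_add[OF l(3)])
    show "christoffel G x (c *\<^sub>R a) v = c *\<^sub>R christoffel G x a v" for c a
    proof (rule christoffel_eqI[OF assms])
      fix w
      have "2 * G x (c *\<^sub>R christoffel G x a v) w = c * (2 * G x (christoffel G x a v) w)" by (simp add: f)
      also have "\<dots> = metric_derivative G x (c *\<^sub>R a) v w + metric_derivative G x v (c *\<^sub>R a) w
          - metric_derivative G x w (c *\<^sub>R a) v"
        by (simp add: koszul[OF assms] linear_scale[OF l(1)] linear_scale[OF l(2)] linear_scale[OF l(3)]
            algebra_simps)
      finally show "2 * G x (c *\<^sub>R christoffel G x a v) w = metric_derivative G x (c *\<^sub>R a) v w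
          + metric_derivative G x v (c *\<^sub>R a) w - metric_derivative G x w (c *\<^sub>R a) v" .
    qed
  qed
  then show "linear (\<lambda>u. christoffel G x u v)" .
  show "linear (christoffel G x u)" using 1[of u] christoffel_sym[OF assms, of _ u] by simp
qed

lemma metric_compatible:
  assumes "x \<in> U"
  shows "metric_derivative G x u v w = G x (christoffel G x u v) w + G x v (christoffel G x u w)"
  using koszul[OF assms, of u v w] koszul[OF assms, of u w v]
    inner_formD(3)[OF form[OF assms], of v] metric_derivative_sym[OF assms, of _ w]
    metric_derivative_sym[OF assms, of w v u] by simp

lemma smooth_metric_derivative: "smooth_on U (\<lambda>x. metric_derivative G x u v w)"
  unfolding metric_derivative_def by (intro smooth_on_deriv smooth)

text \<open>Koszul's formula, read against the vectors of a basis \<open>B\<close>, is a linear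
  system for the symbol. Its coefficient map \<open>A x\<close> collects the products with the basis
  vectors; it is injective by independence of \<open>B\<close> and definiteness of the metric, so
  \<open>smooth_on_solve\<close> applies.\<close>

lemma smooth_christoffel: "smooth_on U (\<lambda>x. christoffel G x u v)"
proof -
  obtain B :: "'a set" and r where B: "finite B" "independent B" "span B = UNIV"
    "\<And>b. bounded_linear (r b)" "\<And>x. x = (\<Sum>b\<in>B. r b x *\<^sub>R b)"
    using fin_dim_coords[OF fd] by metis
  define A where "A x z = (\<Sum>b\<in>B. G x z b *\<^sub>R b)" for x z
  show ?thesis
  proof (rule smooth_on_solve[where A=A and w="\<lambda>x. \<Sum>b\<in>B. ((1/2) * (metric_derivative G x u v b
      + metric_derivative G x v u b - metric_derivative G x b u v)) *\<^sub>R b", OF fd fd open_U])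
    fix x assume x: "x \<in> U"
    note f = inner_formD[OF form[OF x]]
    show lin: "linear (A x)"
      unfolding A_def by (rule linearI) (simp_all add: f scaleR_left_distrib sum.distrib scaleR_sum_right)
    have "z = 0" if "A x z = 0" for z
    proof -
      have "G x z b = 0" if "b \<in> B" for b
        using independentD[OF B(2) B(1) subset_refl] \<open>A x z = 0\<close> that unfolding A_def by blast
      moreover have "G x z z = (\<Sum>b\<in>B. r b z *\<^sub>R G x z b)"
        by (rule linear_coords[OF f(1) B(5)])
      ultimately have "G x z z = 0" by simp
      then show ?thesis using f(4) by fastforce
    qed
    then show "inj (A x)" using linear_injective_0[OF lin] by blast
    show "A x (christoffel G x u v) = (\<Sum>b\<in>B. ((1/2) * (metric_derivative G x u v b
      + metric_derivative G x v u b - metric_derivative G x b u v)) *\<^sub>R b)"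
      unfolding A_def koszul[OF x, symmetric] by simp
  next
    show "smooth_on U (\<lambda>x. A x z)" for z
      unfolding A_def by (intro smooth_on_sum smooth_on_scaleR smooth smooth_on_const open_U)
    show "smooth_on U (\<lambda>x. \<Sum>b\<in>B. ((1/2) * (metric_derivative G x u v b
      + metric_derivative G x v u b - metric_derivative G x b u v)) *\<^sub>R b)"
      by (intro smooth_on_sum smooth_on_scaleR smooth_on_mult smooth_on_add smooth_on_diff
          smooth_metric_derivative smooth_on_const open_U)
  qed
qed

end

section \<open>Connections, curvature and affine maps in coordinates\<close>

lemma second_derivative_sym:
  "open S \<Longrightarrow> x \<in> S \<Longrightarrow> smooth_on S f \<Longrightarrow> second_derivative f x u v = second_derivative f x v u"
  unfolding second_derivative_def by (rule second_derivative_symmetric)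

lemma second_derivative_linear:
  assumes "open S" "x \<in> S" "smooth_on S f"
  shows "linear (second_derivative f x u)" "linear (\<lambda>u. second_derivative f x u v)"
proof -
  have l: "linear (\<lambda>u. second_derivative f x u v)" for v
    unfolding second_derivative_def by (rule smooth_on_linear[OF smooth_on_deriv[OF assms(3)] assms(2)])
  then show "linear (\<lambda>u. second_derivative f x u v)" .
  show "linear (second_derivative f x u)"
    using l[of u] second_derivative_sym[OF assms, of u] by presburger
qed

lemma smooth_second_derivative: "smooth_on S f \<Longrightarrow> smooth_on S (\<lambda>x. second_derivative f x u v)"
  unfolding second_derivative_def by (intro smooth_on_deriv)

lemma has_derivative_frechet_apply:
  fixes f :: "'a::real_normed_vector \<Rightarrow> 'b::real_normed_vector"
  assumes "fin_dim TYPE('a)" "open S" "x \<in> S" "smooth_on S f" and h: "(h has_derivative h') (at x)"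
  shows "((\<lambda>y. \<D> f y (h y)) has_derivative
    (\<lambda>u. second_derivative f x u (h x) + \<D> f x (h' u))) (at x)"
  unfolding second_derivative_def
  by (rule has_derivative_apply[OF assms(1-3) smooth_on_linear[OF assms(4)] _ h
      smooth_onD[OF smooth_on_deriv[OF assms(4)] assms(3)]])
    (use smooth_on_differentiable[OF smooth_on_deriv[OF assms(4)] assms(3)] in auto)

lemma has_derivative_bilinear_apply:
  fixes B :: "'x::real_normed_vector \<Rightarrow> 'a::real_normed_vector \<Rightarrow> 'a \<Rightarrow> 'b::real_normed_vector"
  assumes fd: "fin_dim TYPE('a)" and S: "open S" "x \<in> S"
    and lin: "\<And>y u. y \<in> S \<Longrightarrow> linear (B y u)" "\<And>y v. y \<in> S \<Longrightarrow> linear (\<lambda>u. B y u v)"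
    and B: "\<And>u v. ((\<lambda>y. B y u v) has_derivative B' u v) (at x)"
    and f: "(f has_derivative f') (at x)" and g: "(g has_derivative g') (at x)"
  shows "((\<lambda>y. B y (f y) (g y)) has_derivative
    (\<lambda>h. B' (f x) (g x) h + B x (f' h) (g x) + B x (f x) (g' h))) (at x)"
proof -
  have 1: "((\<lambda>y. B y (f y) v) has_derivative (\<lambda>h. B' (f x) v h + B x (f' h) v)) (at x)" for v
    by (rule has_derivative_apply[where A="\<lambda>y u. B y u v", OF fd S lin(2) _ f B])
      (use B in \<open>auto simp: differentiable_def\<close>)
  show ?thesis
    by (rule has_derivative_apply[where A="\<lambda>y. B y (f y)", OF fd S lin(1) _ g 1])
      (use 1 in \<open>auto simp: differentiable_def\<close>)
qed

lemma has_derivative_unique_open: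
  assumes "open S" "x \<in> S" "(f has_derivative f') (at x)" "(g has_derivative g') (at x)"
    "\<And>y. y \<in> S \<Longrightarrow> f y = g y"
  shows "f' u = g' u"
  using has_derivative_unique[OF has_derivative_transform_within_open[OF assms(3,1,2,5)] assms(4)] by simp

text \<open>The curvature R(u, v)w of the connection with symbols \<Gamma>, evaluated on constant
  fields; their brackets vanish, so the third term of the general formula does not show.\<close>

definition coord_curvature ::
  "('a::real_normed_vector \<Rightarrow> 'a \<Rightarrow> 'a \<Rightarrow> 'a) \<Rightarrow> 'a \<Rightarrow> 'a \<Rightarrow> 'a \<Rightarrow> 'a \<Rightarrow> 'a" where
  "coord_curvature \<Gamma> x u v w =
     \<D> (\<lambda>y. \<Gamma> y v w) x u - \<D> (\<lambda>y. \<Gamma> y u w) x v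
     + \<Gamma> x u (\<Gamma> x v w) - \<Gamma> x v (\<Gamma> x u w)"

text \<open>Linearity and smoothness of the symbols are all that the behaviour of curvature under
  affine maps depends on; the metric is left out, so the domain can be shrunk freely.\<close>

locale local_connection =
  fixes U :: "'a::real_normed_vector set" and \<Gamma> :: "'a \<Rightarrow> 'a \<Rightarrow> 'a \<Rightarrow> 'a"
  assumes fd: "fin_dim TYPE('a)" and open_U: "open U"
    and lin: "x \<in> U \<Longrightarrow> linear (\<Gamma> x u)" "x \<in> U \<Longrightarrow> linear (\<lambda>u. \<Gamma> x u v)"
    and smooth: "smooth_on U (\<lambda>x. \<Gamma> x u v)"
begin

lemma der: "x \<in> U \<Longrightarrow> ((\<lambda>y. \<Gamma> y u v) has_derivative \<D> (\<lambda>y. \<Gamma> y u v) x) (at x)"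
  by (rule smooth_onD[OF smooth])

lemma diff: "x \<in> U \<Longrightarrow> (\<lambda>y. \<Gamma> y u v) differentiable (at x)"
  by (rule smooth_on_differentiable[OF smooth])

lemma curvature_linear:
  assumes "x \<in> U"
  shows "linear (\<lambda>u. coord_curvature \<Gamma> x u v w)" "linear (\<lambda>v. coord_curvature \<Gamma> x u v w)"
    "linear (\<lambda>w. coord_curvature \<Gamma> x u v w)"
proof -
  have 1: "linear (\<D> (\<lambda>y. \<Gamma> y v w) x)" for v w
    by (rule smooth_on_linear[OF smooth assms])
  have 2: "linear (\<lambda>v. \<D> (\<lambda>y. \<Gamma> y v w) x u)" for u w
    by (rule linear_frechet_derivative_param[where A="\<lambda>y v. \<Gamma> y v w", OF open_U assms lin(2)
        diff[OF assms]])
  have 3: "linear (\<lambda>w. \<D> (\<lambda>y. \<Gamma> y v w) x u)" for u v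
    by (rule linear_frechet_derivative_param[where A="\<lambda>y. \<Gamma> y v", OF open_U assms lin(1) diff[OF assms]])
  note l = lin[OF assms]
  have c1: "linear (\<lambda>w. \<Gamma> x u (\<Gamma> x v w))" for u v
    using linear_compose[OF l(1)[of v] l(1)[of u]] by (simp add: o_def)
  have c2: "linear (\<lambda>v. \<Gamma> x u (\<Gamma> x v w))" for u w
    using linear_compose[OF l(2)[of w] l(1)[of u]] by (simp add: o_def)
  show "linear (\<lambda>u. coord_curvature \<Gamma> x u v w)" "linear (\<lambda>v. coord_curvature \<Gamma> x u v w)"
    "linear (\<lambda>w. coord_curvature \<Gamma> x u v w)"
    unfolding coord_curvature_def
    by (intro linear_compose_add linear_compose_sub 1 2 3 l c1 c2)+
qed

end

sublocale local_metric \<subseteq> local_connection U "christoffel G"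
  by (rule local_connection.intro; (rule fd open_U christoffel_linear smooth_christoffel)?; assumption?)

text \<open>The second derivatives of \<open>G y w z\<close> along \<open>u\<close> and
  \<open>v\<close> commute. Expanding both orders by metric compatibility, the products of two
  first-order symbols cancel and the rest is the skew-symmetry of the curvature.\<close>

lemma (in local_metric) curvature_skew:
  assumes x: "x \<in> U"
  shows "G x (coord_curvature (christoffel G) x u v w) z = - G x w
      (coord_curvature (christoffel G) x u v z)"
proof -
  let ?\<Gamma> = "christoffel G"
  let ?D = "\<lambda>u v w. \<D> (\<lambda>y. ?\<Gamma> y v w) x u"
  note f = inner_formD[OF form[OF x]]
  have Gder: "((\<lambda>y. G y a b) has_derivative (\<lambda>u. metric_derivative G x u a b)) (at x)" for a b
    unfolding metric_derivative_def by (rule smooth_onD[OF local_metric.smooth[OF local_metric_axioms] x])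
  have *: "\<D> (\<lambda>y. metric_derivative G y u w z) x v =
      (G x (?\<Gamma> x v (?\<Gamma> x u w)) z + G x (?\<Gamma> x u w) (?\<Gamma> x v z) + G x (?D v u w) z)
    + (G x (?\<Gamma> x v w) (?\<Gamma> x u z) + G x w (?\<Gamma> x v (?\<Gamma> x u z)) + G x w (?D v u z))" for u v
  proof -
    have 1: "((\<lambda>y. metric_derivative G y u w z) has_derivative
        \<D> (\<lambda>y. metric_derivative G y u w z) x) (at x)"
      by (rule smooth_onD[OF smooth_metric_derivative x])
    have 2: "((\<lambda>y. G y (?\<Gamma> y u w) z + G y w (?\<Gamma> y u z)) has_derivative (\<lambda>v.
       (metric_derivative G x v (?\<Gamma> x u w) z + G x (?D v u w) z + G x (?\<Gamma> x u w) 0)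
       + (metric_derivative G x v w (?\<Gamma> x u z) + G x 0 (?\<Gamma> x u z) + G x w (?D v u z)))) (at x)"
      by (intro has_derivative_add
          has_derivative_bilinear_apply[where B=G, OF fd open_U x inner_formD(1)[OF form]
              inner_formD(2)[OF form] Gder]
          der[OF x] has_derivative_const)
    have "\<D> (\<lambda>y. metric_derivative G y u w z) x v =
       (metric_derivative G x v (?\<Gamma> x u w) z + G x (?D v u w) z + G x (?\<Gamma> x u w) 0)
       + (metric_derivative G x v w (?\<Gamma> x u z) + G x 0 (?\<Gamma> x u z) + G x w (?D v u z))"
      by (rule has_derivative_unique_open[OF open_U x 1 2]) (rule metric_compatible)
    then show ?thesis by (simp add: metric_compatible[OF x] f(11,12))
  qed
  have "\<D> (\<lambda>y. metric_derivative G y u w z) x v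
      = \<D> (\<lambda>y. metric_derivative G y v w z) x u"
    unfolding metric_derivative_def
    by (rule second_derivative_symmetric[OF open_U x local_metric.smooth[OF local_metric_axioms]])
  from this[unfolded *] show ?thesis
    unfolding coord_curvature_def f(5-8) using f(3)[of "?\<Gamma> x u w"] f(3)[of "?\<Gamma> x v w"] by linarith
qed

text \<open>The affine relation for \<open>v\<close>, \<open>w\<close> is differentiated along
  \<open>u\<close> and antisymmetrised in \<open>u\<close>, \<open>v\<close>. The third derivative
  of \<phi> drops out by symmetry, and the second derivatives cancel against those in the affine
  relation applied to nested symbols.\<close>

lemma affine_curvature:
  fixes \<phi> :: "'a::real_normed_vector \<Rightarrow> 'b::real_normed_vector"
  assumes "local_connection U \<Gamma>" "local_connection W \<Gamma>'"
    and \<phi>: "smooth_on U \<phi>" "\<phi> ` U \<subseteq> W"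
    and affine: "\<And>x u v. x \<in> U \<Longrightarrow> \<D> \<phi> x (\<Gamma> x u v) =
      \<Gamma>' (\<phi> x) (\<D> \<phi> x u) (\<D> \<phi> x v) + second_derivative \<phi> x u v"
    and x: "x \<in> U"
  shows "\<D> \<phi> x (coord_curvature \<Gamma> x u v w) = coord_curvature \<Gamma>' (\<phi> x)
    (\<D> \<phi> x u) (\<D> \<phi> x v) (\<D> \<phi> x w)"
proof -
  interpret A: local_connection U \<Gamma> by fact
  interpret B: local_connection W \<Gamma>' by fact
  let ?d = "\<lambda>y. \<D> \<phi> y"
  let ?D = "\<lambda>u v w. \<D> (\<lambda>y. \<Gamma> y v w) x u"
  let ?D' = "\<lambda>u v w. \<D> (\<lambda>y. \<Gamma>' y v w) (\<phi> x) u"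
  let ?s = "second_derivative \<phi> x"
  have W: "\<phi> y \<in> W" if "y \<in> U" for y using \<phi>(2) that by blast
  have \<phi>d: "(\<phi> has_derivative ?d x) (at x)" by (rule smooth_onD[OF \<phi>(1) x])
  have dd: "((\<lambda>y. ?d y v) has_derivative (\<lambda>u. ?s u v)) (at x)" for v
    unfolding second_derivative_def by (rule smooth_onD[OF smooth_on_deriv[OF \<phi>(1)] x])
  have main: "?s u (\<Gamma> x v w) + ?d x (?D u v w) =
     ?D' (?d x u) (?d x v) (?d x w) + \<Gamma>' (\<phi> x) (?s u v) (?d x w) + \<Gamma>' (\<phi> x) (?d x v) (?s u w)
      + \<D> (\<lambda>y. second_derivative \<phi> y v w) x u" for u v w
  proof -
    have 1: "((\<lambda>y. ?d y (\<Gamma> y v w)) has_derivative (\<lambda>u. ?s u (\<Gamma> x v w) + ?d x (?D u v w))) (at x)"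
      by (rule has_derivative_frechet_apply[OF A.fd A.open_U x \<phi>(1) A.der[OF x]])
    have c: "((\<lambda>y. \<Gamma>' (\<phi> y) a b) has_derivative (\<lambda>u. ?D' (?d x u) a b)) (at x)" for a b
      by (rule has_derivative_compose[OF \<phi>d B.der[OF W[OF x]]])
    have 2: "((\<lambda>y. \<Gamma>' (\<phi> y) (?d y v) (?d y w)) has_derivative (\<lambda>u. ?D' (?d x u) (?d x v) (?d x w)
        + \<Gamma>' (\<phi> x) (?s u v) (?d x w) + \<Gamma>' (\<phi> x) (?d x v) (?s u w))) (at x)"
      by (rule has_derivative_bilinear_apply[where B="\<lambda>y. \<Gamma>' (\<phi> y)", OF B.fd A.open_U x B.lin(1)[OF W]
          B.lin(2)[OF W] c dd dd])
    have 3: "((\<lambda>y. second_derivative \<phi> y v w) has_derivative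
        \<D> (\<lambda>y. second_derivative \<phi> y v w) x) (at x)"
      by (rule smooth_onD[OF smooth_second_derivative[OF \<phi>(1)] x])
    show ?thesis
      by (rule has_derivative_unique_open[OF A.open_U x 1 has_derivative_add[OF 2 3]]) (rule affine)
  qed
  \<comment> \<open>Symmetry of the second derivative of the function
    \<open>\<lambda>y. \<D> \<phi> y w\<close>; this is the part of the third derivative that
    antisymmetrisation in \<open>u\<close>, \<open>v\<close> needs.\<close>
  have sym3: "\<D> (\<lambda>y. second_derivative \<phi> y v w) x u
      = \<D> (\<lambda>y. second_derivative \<phi> y u w) x v"
    unfolding second_derivative_def
    by (rule second_derivative_symmetric[OF A.open_U x smooth_on_deriv[OF \<phi>(1)]])
  have l: "linear (?d x)" by (rule smooth_on_linear[OF \<phi>(1) x])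
  have aff2: "?d x (\<Gamma> x u (\<Gamma> x v w)) = \<Gamma>' (\<phi> x) (?d x u) (\<Gamma>' (\<phi> x) (?d x v) (?d x w))
      + \<Gamma>' (\<phi> x) (?d x u) (?s v w) + ?s u (\<Gamma> x v w)" for u v
    by (simp add: affine[OF x] linear_add[OF B.lin(1)[OF W[OF x]]])
  have "?d x (coord_curvature \<Gamma> x u v w) = ?d x (?D u v w) - ?d x (?D v u w)
     + ?d x (\<Gamma> x u (\<Gamma> x v w)) - ?d x (\<Gamma> x v (\<Gamma> x u w))"
    by (simp add: coord_curvature_def linear_add[OF l] linear_diff[OF l])
  also have "\<dots> = (?s u (\<Gamma> x v w) + ?d x (?D u v w)) - (?s v (\<Gamma> x u w) + ?d x (?D v u w))
     + (?d x (\<Gamma> x u (\<Gamma> x v w)) - ?s u (\<Gamma> x v w)) - (?d x (\<Gamma> x v (\<Gamma> x u w)) - ?s v (\<Gamma> x u w))"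
    by (simp add: algebra_simps)
  also have "\<dots> = coord_curvature \<Gamma>' (\<phi> x) (?d x u) (?d x v) (?d x w)"
    unfolding main aff2 coord_curvature_def
    by (simp add: sym3 second_derivative_sym[OF A.open_U x \<phi>(1), of v u] algebra_simps)
  finally show ?thesis .
qed

text \<open>With \<open>P\<close> always true this applies to isometric immersions, with \<open>P\<close> the horizontal vectors to
  Riemannian submersions.\<close>

lemma koszul_pullback:
  fixes \<phi> :: "'a::real_normed_vector \<Rightarrow> 'b::real_normed_vector"
  assumes "local_metric U G" "local_metric W H" "x \<in> U" "\<phi> x \<in> W"
    and \<phi>: "open S" "x \<in> S" "smooth_on S \<phi>"
    and P: "P u" "P v" "P w" and pull: "\<And>a b c. P a \<Longrightarrow> P b \<Longrightarrow> P c \<Longrightarrow> metric_derivative G x a b c =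
      metric_derivative H (\<phi> x) (\<D> \<phi> x a) (\<D> \<phi> x b) (\<D> \<phi> x c)
      + H (\<phi> x) (second_derivative \<phi> x a b) (\<D> \<phi> x c)
      + H (\<phi> x) (\<D> \<phi> x b) (second_derivative \<phi> x a c)"
  shows "G x (christoffel G x u v) w = H (\<phi> x) (christoffel H (\<phi> x) (\<D> \<phi> x u)
    (\<D> \<phi> x v) + second_derivative \<phi> x u v) (\<D> \<phi> x w)"
proof -
  interpret A: local_metric U G by fact
  interpret B: local_metric W H by fact
  let ?d = "\<D> \<phi> x"
  note f = inner_formD[OF B.form[OF assms(4)]]
  note s = second_derivative_sym[OF \<phi>]
  \<comment> \<open>In the Koszul combination the second derivative of \<phi> enters six times: four
    contributions cancel in pairs by its symmetry, and the remaining two coincide.\<close>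
  have "2 * G x (christoffel G x u v) w =
     2 * H (\<phi> x) (christoffel H (\<phi> x) (?d u) (?d v)) (?d w) + 2 * H (\<phi> x) (second_derivative \<phi> x u v)
         (?d w)"
    unfolding A.koszul[OF assms(3)] B.koszul[OF assms(4)] pull[OF P(1-3)] pull[OF P(2,1,3)]
        pull[OF P(3,1,2)]
    using s[of v u] s[of w u] s[of w v] f(3)[of "?d u"] f(3)[of "?d v"] by simp
  then show ?thesis by (simp add: f(5))
qed

section \<open>Charts and tangent vectors\<close>

lemma topological_chartD:
  assumes "topological_chart X c"
  shows "openin X (cdom c)" "cdom c \<subseteq> topspace X" "open (cmap c ` cdom c)" "inj_on (cmap c) (cdom c)"
    and cinv_cmap: "p \<in> cdom c \<Longrightarrow> cinv c (cmap c p) = p"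
    and cmap_cinv: "x \<in> cmap c ` cdom c \<Longrightarrow> cmap c (cinv c x) = x"
    and cinv_in: "x \<in> cmap c ` cdom c \<Longrightarrow> cinv c x \<in> cdom c"
proof -
  have h: "openin X (cdom c)" "open (cmap c ` cdom c)"
    "homeomorphic_map (subtopology X (cdom c)) (top_of_set (cmap c ` cdom c)) (cmap c)"
    using assms by (auto simp: topological_chart_def)
  show "openin X (cdom c)" "open (cmap c ` cdom c)" by fact+
  show sub: "cdom c \<subseteq> topspace X" using h(1) by (rule openin_subset)
  then show inj: "inj_on (cmap c) (cdom c)"
    using homeomorphic_imp_injective_map[OF h(3)] by (simp add: Int_absorb1)
  then show "p \<in> cdom c \<Longrightarrow> cinv c (cmap c p) = p" by simp
  show "x \<in> cmap c ` cdom c \<Longrightarrow> cmap c (cinv c x) = x" by (rule f_inv_into_f)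
  show "x \<in> cmap c ` cdom c \<Longrightarrow> cinv c x \<in> cdom c" by (rule inv_into_into)
qed

lemma topological_chart_open_image:
  assumes "topological_chart X c" "openin X A" "A \<subseteq> cdom c"
  shows "open (cmap c ` A)"
proof -
  have h: "open (cmap c ` cdom c)"
    "homeomorphic_map (subtopology X (cdom c)) (top_of_set (cmap c ` cdom c)) (cmap c)"
    using assms by (auto simp: topological_chart_def)
  have "openin (subtopology X (cdom c)) A"
    using assms(2,3) by (auto simp: openin_subtopology)
  then have "openin (top_of_set (cmap c ` cdom c)) (cmap c ` A)"
    using homeomorphic_imp_open_map[OF h(2)] unfolding open_map_def by blast
  then show ?thesis using h(1) openin_open_trans by blast
qed

lemma topological_chart_continuous:
  assumes "topological_chart X c"
  shows "continuous_map (subtopology X (cdom c)) euclidean (cmap c)"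
    and "continuous_map (top_of_set (cmap c ` cdom c)) X (cinv c)"
proof -
  have h: "homeomorphic_map (subtopology X (cdom c)) (top_of_set (cmap c ` cdom c)) (cmap c)"
    using assms by (auto simp: topological_chart_def)
  show "continuous_map (subtopology X (cdom c)) euclidean (cmap c)"
    using homeomorphic_imp_continuous_map[OF h] by (simp add: continuous_map_in_subtopology)
  obtain k where k: "homeomorphic_maps (subtopology X (cdom c)) (top_of_set (cmap c ` cdom c)) (cmap c) k"
    using h homeomorphic_map_maps by blast
  have "continuous_map (top_of_set (cmap c ` cdom c)) X k"
    using k by (simp add: homeomorphic_maps_def continuous_map_in_subtopology)
  moreover have "k x = cinv c x" if "x \<in> cmap c ` cdom c" for x
  proof -
    have "k (cmap c p) = p" if "p \<in> cdom c" for p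
      using k that topological_chartD(2)[OF assms] by (auto simp: homeomorphic_maps_def)
    then show ?thesis using that topological_chartD(5)[OF assms] by auto
  qed
  ultimately show "continuous_map (top_of_set (cmap c ` cdom c)) X (cinv c)"
    by (rule continuous_map_eq) simp
qed

lemma topological_chart_open_preimage:
  assumes "topological_chart X c" "open T"
  shows "openin X {p \<in> cdom c. cmap c p \<in> T}"
proof -
  have "openin (subtopology X (cdom c)) {p \<in> topspace (subtopology X (cdom c)). cmap c p \<in> T}"
    using openin_continuous_map_preimage[OF topological_chart_continuous(1)[OF assms(1)]] assms(2) by simp
  then have "openin X {p \<in> topspace (subtopology X (cdom c)). cmap c p \<in> T}"
    using openin_trans_full topological_chartD(1)[OF assms(1)] by blast
  moreover have "topspace (subtopology X (cdom c)) = cdom c"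
    using topological_chartD(2)[OF assms(1)] by auto
  ultimately show ?thesis by (simp only:)
qed

locale manifold_ctxt =
  fixes M :: "('p, 'e::real_normed_vector) manifold"
  assumes manifold: "smooth_manifold M"
begin

lemma fd: "fin_dim TYPE('e)"
  using manifold by (simp add: smooth_manifold_def fin_dim_def)

lemma chart: "c \<in> atlas M \<Longrightarrow> topological_chart (mtop M) c"
  using manifold by (simp add: smooth_manifold_def)

lemma charts_at_iff: "c \<in> charts_at M p \<longleftrightarrow> c \<in> atlas M \<and> p \<in> cdom c"
  by (simp add: charts_at_def)

lemma charts_at_ex: "p \<in> points M \<Longrightarrow> \<exists>c. c \<in> charts_at M p"
  using manifold unfolding smooth_manifold_def charts_at_def by blast

lemma charts_at_chart: "c \<in> charts_at M p \<Longrightarrow> topological_chart (mtop M) c"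
  by (simp add: charts_at_iff chart)

lemma charts_at_points: "c \<in> charts_at M p \<Longrightarrow> p \<in> points M"
  using topological_chartD(2)[OF charts_at_chart] unfolding charts_at_iff by blast

lemma charts_at_empty: "p \<notin> points M \<Longrightarrow> charts_at M p = {}"
  using charts_at_points by blast

lemma cinv_cmap_at: "c \<in> charts_at M p \<Longrightarrow> cinv c (cmap c p) = p"
  using topological_chartD(5)[OF charts_at_chart] unfolding charts_at_iff by blast

lemma cmap_in: "c \<in> charts_at M p \<Longrightarrow> cmap c p \<in> cmap c ` cdom c"
  by (simp add: charts_at_iff)

lemma image_open: "c \<in> atlas M \<Longrightarrow> open (cmap c ` cdom c)"
  by (rule topological_chartD(3)[OF chart])

lemma cinv_chart:
  assumes "c \<in> atlas M" "x \<in> cmap c ` cdom c"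
  shows "c \<in> charts_at M (cinv c x)" "cmap c (cinv c x) = x"
  using topological_chartD(6,7)[OF chart[OF assms(1)] assms(2)] assms(1) by (auto simp: charts_at_iff)

lemma smooth_map_id: "smooth_map M M id"
  using manifold by (simp add: smooth_map_def smooth_manifold_def)

end

lemma coord_rep_cmap:
  assumes "topological_chart X c" "p \<in> cdom c"
  shows "coord_rep f c d (cmap c p) = cmap d (f p)"
  using topological_chartD(5)[OF assms] by (simp add: coord_rep_def)

locale smooth_map_ctxt = M: manifold_ctxt M + N: manifold_ctxt N
  for M :: "('p, 'e::real_normed_vector) manifold" and N :: "('q, 'f::real_normed_vector) manifold" +
  fixes f :: "'p \<Rightarrow> 'q"
  assumes smooth_map: "smooth_map M N f"
begin

abbreviation coord_domain :: "('p, 'e) chart \<Rightarrow> ('q, 'f) chart \<Rightarrow> 'e set" where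
  "coord_domain c d \<equiv> cmap c ` (cdom c \<inter> f -` cdom d)"

lemma cmap_in_domain:
  "c \<in> charts_at M p \<Longrightarrow> d \<in> charts_at N (f p) \<Longrightarrow> cmap c p \<in> coord_domain c d"
  by (auto simp: M.charts_at_iff N.charts_at_iff)

lemma maps_points: "p \<in> points M \<Longrightarrow> f p \<in> points N"
  using smooth_map by (auto simp: smooth_map_def continuous_map_def)

lemma openin_preimage:
  assumes "openin (mtop M) A" "openin (mtop N) B"
  shows "openin (mtop M) (A \<inter> f -` B)"
proof -
  have "openin (mtop M) {p \<in> points M. f p \<in> B}"
    using smooth_map assms(2) openin_continuous_map_preimage unfolding smooth_map_def by blast
  then have "openin (mtop M) (A \<inter> {p \<in> points M. f p \<in> B})" using assms(1) by blast
  moreover have "A \<inter> {p \<in> points M. f p \<in> B} = A \<inter> f -` B" using openin_subset[OF assms(1)] by blast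
  ultimately show ?thesis by simp
qed

lemma domain_open:
  assumes "c \<in> atlas M" "d \<in> atlas N"
  shows "open (coord_domain c d)"
  by (rule topological_chart_open_image[OF M.chart[OF assms(1)]
        openin_preimage[OF topological_chartD(1)[OF M.chart[OF assms(1)]]
            topological_chartD(1)[OF N.chart[OF assms(2)]]]])
    simp

lemma coord_smooth: "c \<in> atlas M \<Longrightarrow> d \<in> atlas N \<Longrightarrow> smooth_on (coord_domain c d) (coord_rep f c d)"
  using smooth_map by (simp add: smooth_map_def)

lemma coord_rep_maps: "c \<in> atlas M \<Longrightarrow> coord_rep f c d ` coord_domain c d \<subseteq> cmap d ` cdom d"
  by (auto simp: coord_rep_cmap[OF M.chart])

lemma coord_deriv:
  assumes "c \<in> charts_at M p" "d \<in> charts_at N (f p)"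
  shows "(coord_rep f c d has_derivative coord_deriv f c d p) (at (cmap c p))"
  unfolding coord_deriv_def
  by (rule smooth_onD[OF coord_smooth cmap_in_domain]) (use assms M.charts_at_iff N.charts_at_iff in auto)

lemma coord_deriv_linear:
  assumes "c \<in> charts_at M p" "d \<in> charts_at N (f p)"
  shows "linear (coord_deriv f c d p)"
  using coord_deriv[OF assms] has_derivative_linear by blast

end

lemma (in manifold_ctxt) smooth_map_ctxt_id: "smooth_map_ctxt M M id"
  by unfold_locales (rule smooth_map_id)

text \<open>Transition maps become the coordinate representations of the smooth map
  \<open>id\<close>, so changes of charts are covered by the facts about general smooth
  maps.\<close>

sublocale manifold_ctxt \<subseteq> Id: smooth_map_ctxt M M id
  by (rule smooth_map_ctxt_id)

lemma coord_deriv_compose: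
  assumes "smooth_map_ctxt M N f" "smooth_map_ctxt N Q h"
    and c: "c \<in> charts_at M p" and d: "d \<in> charts_at N (f p)" and e: "e \<in> charts_at Q (h (f p))"
  shows "coord_deriv (h \<circ> f) c e p u = coord_deriv h d e (f p) (coord_deriv f c d p u)"
proof -
  interpret f: smooth_map_ctxt M N f by fact
  interpret h: smooth_map_ctxt N Q h by fact
  have cA: "c \<in> atlas M" "p \<in> cdom c" and dA: "d \<in> atlas N" "f p \<in> cdom d"
    and eA: "e \<in> atlas Q" "h (f p) \<in> cdom e"
    using c d e by (auto simp: charts_at_def)
  have "openin (mtop M) (cdom c \<inter> f -` (cdom d \<inter> h -` cdom e))"
    by (intro f.openin_preimage h.openin_preimage topological_chartD(1))
      (use f.M.chart cA f.N.chart dA h.N.chart eA in auto)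
  then have o: "open (cmap c ` (cdom c \<inter> f -` (cdom d \<inter> h -` cdom e)))"
    by (rule topological_chart_open_image[OF f.M.chart[OF cA(1)]]) auto
  have "coord_rep f c d (cmap c p) = cmap d (f p)" by (rule coord_rep_cmap[OF f.M.chart[OF cA(1)] cA(2)])
  then have "((\<lambda>x. coord_rep h d e (coord_rep f c d x)) has_derivative
      (\<lambda>u. coord_deriv h d e (f p) (coord_deriv f c d p u))) (at (cmap c p))"
    using has_derivative_compose[OF f.coord_deriv[OF c d], of "coord_rep h d e"] h.coord_deriv[OF d e]
    by simp
  then have "(coord_rep (h \<circ> f) c e has_derivative
      (\<lambda>u. coord_deriv h d e (f p) (coord_deriv f c d p u))) (at (cmap c p))"
  proof (rule has_derivative_transform_within_open[OF _ o])
    show "cmap c p \<in> cmap c ` (cdom c \<inter> f -` (cdom d \<inter> h -` cdom e))"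
      using cA dA eA by auto
    show "coord_rep h d e (coord_rep f c d x) = coord_rep (h \<circ> f) c e x"
      if "x \<in> cmap c ` (cdom c \<inter> f -` (cdom d \<inter> h -` cdom e))" for x
      using that by (auto simp: coord_rep_cmap[OF f.M.chart[OF cA(1)]]
          coord_rep_cmap[OF f.N.chart[OF dA(1)]])
  qed
  then show ?thesis unfolding coord_deriv_def[of "h \<circ> f"] by (simp add: frechet_derivative_eq)
qed

context manifold_ctxt
begin

lemma coord_deriv_id_self:
  assumes "c \<in> charts_at M p"
  shows "coord_deriv id c c p u = u"
proof -
  have cA: "c \<in> atlas M" "p \<in> cdom c" using assms by (auto simp: charts_at_iff)
  have "((\<lambda>x. x) has_derivative (\<lambda>x. x)) (at (cmap c p))" by (rule has_derivative_ident)
  then have "(coord_rep id c c has_derivative (\<lambda>x. x)) (at (cmap c p))"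
    by (rule has_derivative_transform_within_open[OF _ image_open[OF cA(1)] cmap_in[OF assms]])
      (simp add: coord_rep_def cinv_chart(2)[OF cA(1)])
  then show ?thesis unfolding coord_deriv_def by (simp add: frechet_derivative_eq)
qed

lemma coord_deriv_id_compose:
  assumes "c \<in> charts_at M p" "d \<in> charts_at M p" "e \<in> charts_at M p"
  shows "coord_deriv id d e p (coord_deriv id c d p u) = coord_deriv id c e p u"
  using coord_deriv_compose[OF smooth_map_ctxt_id smooth_map_ctxt_id, of c p d e u] assms by simp

lemma coord_deriv_id_inverse:
  assumes "c \<in> charts_at M p" "d \<in> charts_at M p"
  shows "coord_deriv id d c p (coord_deriv id c d p u) = u"
  using coord_deriv_id_compose[OF assms assms(1)] coord_deriv_id_self[OF assms(1)] by simp

lemma coord_deriv_id_linear: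
  "c \<in> charts_at M p \<Longrightarrow> d \<in> charts_at M p \<Longrightarrow> linear (coord_deriv id c d p)"
  by (rule Id.coord_deriv_linear) auto

lemma tangentD:
  assumes "v \<in> tangent_space M p" "c \<in> charts_at M p" "d \<in> charts_at M p"
  shows "v d = coord_deriv id c d p (v c)"
  using assms unfolding tangent_space_def by blast

lemma tangentD0: "v \<in> tangent_space M p \<Longrightarrow> c \<notin> charts_at M p \<Longrightarrow> v c = 0"
  unfolding tangent_space_def by blast

lemma tangentI:
  assumes "\<And>c. c \<notin> charts_at M p \<Longrightarrow> v c = 0"
    "\<And>c d. c \<in> charts_at M p \<Longrightarrow> d \<in> charts_at M p \<Longrightarrow> v d = coord_deriv id c d p (v c)"
  shows "v \<in> tangent_space M p"
  using assms unfolding tangent_space_def by blast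

lemma tangent_eqI:
  assumes "v \<in> tangent_space M p" "w \<in> tangent_space M p" "c \<in> charts_at M p" "v c = w c"
  shows "v = w"
proof
  fix d
  show "v d = w d"
    using tangentD[OF assms(1,3)] tangentD[OF assms(2,3)] tangentD0[OF assms(1)] tangentD0[OF assms(2)]
        assms(4)
    by (cases "d \<in> charts_at M p") simp_all
qed

lemma tangent_outside: "v \<in> tangent_space M p \<Longrightarrow> p \<notin> points M \<Longrightarrow> v = 0"
  using charts_at_empty tangentD0 by (fastforce simp: fun_eq_iff)

lemma coord_vector_self: "c \<in> charts_at M p \<Longrightarrow> coord_vector M c p u c = u"
  by (simp add: coord_vector_def coord_deriv_id_self)

lemma coord_vector_tangent: "c \<in> charts_at M p \<Longrightarrow> coord_vector M c p u \<in> tangent_space M p"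
  by (rule tangentI) (auto simp: coord_vector_def coord_deriv_id_compose)

lemma coord_vector_eq: "v \<in> tangent_space M p \<Longrightarrow> c \<in> charts_at M p \<Longrightarrow> coord_vector M c p (v c) = v"
  by (rule tangent_eqI[OF coord_vector_tangent]) (auto simp: coord_vector_self)

lemma tangent_add: "v \<in> tangent_space M p \<Longrightarrow> w \<in> tangent_space M p \<Longrightarrow> v + w \<in> tangent_space M p"
  by (rule tangentI) (simp_all add: tangentD0 linear_add[OF coord_deriv_id_linear] tangentD[symmetric])

lemma tangent_diff: "v \<in> tangent_space M p \<Longrightarrow> w \<in> tangent_space M p \<Longrightarrow> v - w \<in> tangent_space M p"
  by (rule tangentI) (simp_all add: tangentD0 linear_diff[OF coord_deriv_id_linear] tangentD[symmetric])

lemma tangent_scale: "v \<in> tangent_space M p \<Longrightarrow> tangent_scale a v \<in> tangent_space M p"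
  by (rule tangentI)
    (simp_all add: tangent_scale_def tangentD0 linear_scale[OF coord_deriv_id_linear] tangentD[symmetric])

lemma tangent_zero: "0 \<in> tangent_space M p"
  by (rule tangentI) (simp_all add: linear_0[OF coord_deriv_id_linear])

end

context smooth_map_ctxt
begin

text \<open>The chain rule for the two factorisations \<open>f \<circ> id\<close> and
  \<open>id \<circ> f\<close> of the same map.\<close>

lemma coord_deriv_change:
  assumes "c \<in> charts_at M p" "c' \<in> charts_at M p" "d \<in> charts_at N (f p)" "d' \<in> charts_at N (f p)"
  shows "coord_deriv f c' d' p (coord_deriv id c c' p u) = coord_deriv id d d' (f p)
      (coord_deriv f c d p u)"
proof -
  have "coord_deriv (f \<circ> id) c d' p u = coord_deriv f c' d' p (coord_deriv id c c' p u)"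
    using coord_deriv_compose[OF M.smooth_map_ctxt_id smooth_map_ctxt_axioms, of c p c' d' u] assms by simp
  moreover have "coord_deriv (id \<circ> f) c d' p u = coord_deriv id d d' (f p) (coord_deriv f c d p u)"
    using coord_deriv_compose[OF smooth_map_ctxt_axioms N.smooth_map_ctxt_id, of c p d d' u] assms by simp
  ultimately show ?thesis by simp
qed

text \<open>\<open>differential\<close> reads the vector in a chart picked by \<open>SOME\<close>;
  the change-of-chart rule replaces it by any chart at hand.\<close>

lemma differential_coord:
  assumes "v \<in> tangent_space M p" "c \<in> charts_at M p" "d \<in> charts_at N (f p)"
  shows "differential M N f p v d = coord_deriv f c d p (v c)"
proof -
  define c' where "c' = (SOME c. c \<in> charts_at M p)"
  have c': "c' \<in> charts_at M p" unfolding c'_def using assms(2) by (rule someI)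
  have "coord_deriv f c' d p (v c') = coord_deriv id d d (f p) (coord_deriv f c d p (v c))"
    using coord_deriv_change[OF assms(2) c' assms(3,3), of "v c"] M.tangentD[OF assms(1,2) c'] by simp
  then show ?thesis
    using assms(3) by (simp add: differential_def c'_def[symmetric] N.coord_deriv_id_self)
qed

lemma differential_tangent:
  assumes "v \<in> tangent_space M p" "p \<in> points M"
  shows "differential M N f p v \<in> tangent_space N (f p)"
proof -
  obtain c where c: "c \<in> charts_at M p" using M.charts_at_ex[OF assms(2)] by blast
  have *: "coord_deriv f c d' p (v c) = coord_deriv id d d' (f p) (coord_deriv f c d p (v c))"
    if "d \<in> charts_at N (f p)" "d' \<in> charts_at N (f p)" for d d'
    using coord_deriv_change[OF c c that, of "v c"] by (simp add: M.coord_deriv_id_self[OF c])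
  show ?thesis
  proof (rule N.tangentI)
    show "differential M N f p v d = 0" if "d \<notin> charts_at N (f p)" for d
      using that by (simp add: differential_def Let_def)
    show "differential M N f p v d' = coord_deriv id d d' (f p) (differential M N f p v d)"
      if "d \<in> charts_at N (f p)" "d' \<in> charts_at N (f p)" for d d'
      unfolding differential_coord[OF assms(1) c that(1)] differential_coord[OF assms(1) c that(2)]
      by (rule *[OF that])
  qed
qed

end

lemma has_derivative_compose_bilinear:
  fixes \<phi> :: "'a::real_normed_vector \<Rightarrow> 'b::real_normed_vector"
  assumes fd: "fin_dim TYPE('a)" and H: "local_metric W H" and S: "open S" "\<phi> ` S \<subseteq> W" "smooth_on S \<phi>"
      and x: "x \<in> S"
  shows "((\<lambda>y. H (\<phi> y) (\<D> \<phi> y b) (\<D> \<phi> y c)) has_derivative (\<lambda>a.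
      metric_derivative H (\<phi> x) (\<D> \<phi> x a) (\<D> \<phi> x b) (\<D> \<phi> x c)
      + H (\<phi> x) (second_derivative \<phi> x a b) (\<D> \<phi> x c)
      + H (\<phi> x) (\<D> \<phi> x b) (second_derivative \<phi> x a c))) (at x)"
proof -
  interpret B: local_metric W H by fact
  have W: "\<phi> y \<in> W" if "y \<in> S" for y using S(2) that by blast
  have dd: "((\<lambda>y. \<D> \<phi> y v) has_derivative (\<lambda>u. second_derivative \<phi> x u v)) (at x)" for v
    unfolding second_derivative_def by (rule smooth_onD[OF smooth_on_deriv[OF S(3)] x])
  have c: "((\<lambda>y. H (\<phi> y) v w) has_derivative (\<lambda>a. metric_derivative H (\<phi> x) (\<D> \<phi> x a) v w)) (at x)" for v w
    unfolding metric_derivative_def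
    by (rule has_derivative_compose[OF smooth_onD[OF S(3) x]
        smooth_onD[OF local_metric.smooth[OF H] W[OF x]]])
  show ?thesis
    by (rule has_derivative_bilinear_apply[where B="\<lambda>y. H (\<phi> y)", OF B.fd S(1) x
        inner_formD(1)[OF B.form[OF W]]
          inner_formD(2)[OF B.form[OF W]] c dd dd])
qed

text \<open>The derivative of the isometry equation, in the form of the premise of
  \<open>koszul_pullback\<close>. It serves transition maps as well as inclusions of fibers.\<close>

lemma isometry_metric_derivative:
  fixes \<phi> :: "'a::real_normed_vector \<Rightarrow> 'b::real_normed_vector"
  assumes "local_metric U G" "local_metric W H" and S: "open S" "S \<subseteq> U" "\<phi> ` S \<subseteq> W" "smooth_on S \<phi>"
    and iso: "\<And>y b c. y \<in> S \<Longrightarrow> G y b c = H (\<phi> y) (\<D> \<phi> y b) (\<D> \<phi> y c)"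
    and x: "x \<in> S"
  shows "metric_derivative G x a b c =
      metric_derivative H (\<phi> x) (\<D> \<phi> x a) (\<D> \<phi> x b) (\<D> \<phi> x c)
      + H (\<phi> x) (second_derivative \<phi> x a b) (\<D> \<phi> x c)
      + H (\<phi> x) (\<D> \<phi> x b) (second_derivative \<phi> x a c)"
proof -
  interpret A: local_metric U G by fact
  interpret B: local_metric W H by fact
  have 1: "((\<lambda>y. G y b c) has_derivative (\<lambda>a. metric_derivative G x a b c)) (at x)"
    unfolding metric_derivative_def by (rule smooth_onD[OF local_metric.smooth[OF assms(1)]])
        (use S(2) x in blast)
  show ?thesis
    by (rule has_derivative_unique_open[OF S(1) x 1
        has_derivative_compose_bilinear[OF A.fd assms(2) S(1,3,4) x]]) (rule iso)
qed

section \<open>The Levi-Civita connection and the curvature in coordinates\<close>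

definition field_rep :: "('p, 'e) vfield \<Rightarrow> ('p, 'e) chart \<Rightarrow> 'e \<Rightarrow> 'e" where
  "field_rep X c x = X (cinv c x) c"

definition metric_rep :: "('p, 'e::real_normed_vector) manifold \<Rightarrow> ('p, 'e) metric_field \<Rightarrow>
    ('p, 'e) chart \<Rightarrow> 'e \<Rightarrow> 'e \<Rightarrow> 'e \<Rightarrow> real" where
  "metric_rep M g c x u w = g (cinv c x) (coord_vector M c (cinv c x) u) (coord_vector M c (cinv c x) w)"

text \<open>The classical expression for the covariant derivative, chart by chart. The value 0 in
  charts away from the point is what \<open>tangent_space\<close> prescribes.\<close>

definition coord_connection :: "('p, 'e::real_normed_vector) manifold \<Rightarrow> ('p, 'e) metric_field \<Rightarrow>
    ('p, 'e) vfield \<Rightarrow> ('p, 'e) vfield \<Rightarrow> ('p, 'e) vfield" where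
  "coord_connection M g X Y p c = (if c \<in> charts_at M p
     then \<D> (field_rep Y c) (cmap c p) (X p c)
        + christoffel (metric_rep M g c) (cmap c p) (X p c) (Y p c)
     else 0)"

context manifold_ctxt
begin

lemma transition_image: "c \<in> charts_at M p \<Longrightarrow> d \<in> charts_at M p \<Longrightarrow> cmap c p \<in> Id.coord_domain c d"
  by (rule Id.cmap_in_domain) auto

lemma in_coord_domain:
  assumes "c \<in> atlas M" "d \<in> atlas M" "x \<in> Id.coord_domain c d"
  shows "c \<in> charts_at M (cinv c x)" "d \<in> charts_at M (cinv c x)" "cmap c (cinv c x) = x"
    "coord_rep id c d x = cmap d (cinv c x)" "cinv d (coord_rep id c d x) = cinv c x"
    "x \<in> cmap c ` cdom c" "coord_rep id c d x \<in> cmap d ` cdom d"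
    "coord_deriv id c d (cinv c x) = \<D> (coord_rep id c d) x"
proof -
  obtain p where p: "x = cmap c p" "p \<in> cdom c" "p \<in> cdom d" using assms(3) by auto
  then have pc: "c \<in> charts_at M p" "d \<in> charts_at M p" using assms by (auto simp: charts_at_iff)
  have cx: "cinv c x = p" unfolding p(1) by (rule cinv_cmap_at[OF pc(1)])
  show "c \<in> charts_at M (cinv c x)" "d \<in> charts_at M (cinv c x)" "cmap c (cinv c x) = x"
    unfolding cx using pc p by auto
  show 1: "coord_rep id c d x = cmap d (cinv c x)" by (simp add: coord_rep_def)
  show "cinv d (coord_rep id c d x) = cinv c x" unfolding 1 cx by (rule cinv_cmap_at[OF pc(2)])
  show "x \<in> cmap c ` cdom c" "coord_rep id c d x \<in> cmap d ` cdom d" unfolding 1 cx using p by auto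
  show "coord_deriv id c d (cinv c x) = \<D> (coord_rep id c d) x"
    unfolding coord_deriv_def cx using p(1) by simp
qed

lemma vector_fieldD:
  assumes "vector_field M X"
  shows "X p \<in> tangent_space M p" "c \<in> atlas M \<Longrightarrow> smooth_on (cmap c ` cdom c) (field_rep X c)"
  using assms by (auto simp: vector_field_def field_rep_def[abs_def])

lemma vector_fieldI:
  assumes "\<And>p. X p \<in> tangent_space M p" "\<And>c. c \<in> atlas M \<Longrightarrow> smooth_on (cmap c ` cdom c) (field_rep X c)"
  shows "vector_field M X"
  using assms by (simp add: vector_field_def field_rep_def[abs_def])

lemma field_rep_cmap: "c \<in> charts_at M p \<Longrightarrow> field_rep X c (cmap c p) = X p c"
  by (simp add: field_rep_def cinv_cmap_at)

lemma field_rep_deriv: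
  assumes "vector_field M X" "c \<in> charts_at M p"
  shows "(field_rep X c has_derivative \<D> (field_rep X c) (cmap c p)) (at (cmap c p))"
  by (rule smooth_onD[OF vector_fieldD(2)[OF assms(1)] cmap_in[OF assms(2)]])
    (use assms(2) charts_at_iff in blast)

lemma vector_field_diff:
  assumes "vector_field M X" "vector_field M Y"
  shows "vector_field M (X - Y)"
proof (rule vector_fieldI)
  show "(X - Y) p \<in> tangent_space M p" for p
    using tangent_diff[OF vector_fieldD(1)[OF assms(1)] vector_fieldD(1)[OF assms(2)]] by simp
  show "smooth_on (cmap c ` cdom c) (field_rep (X - Y) c)" if "c \<in> atlas M" for c
    using smooth_on_diff[OF image_open[OF that] vector_fieldD(2)[OF assms(1) that]
        vector_fieldD(2)[OF assms(2) that]]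
    by (simp add: field_rep_def[abs_def])
qed

lemma coord_vector_add:
  assumes "c \<in> charts_at M p"
  shows "coord_vector M c p (u + v) = coord_vector M c p u + coord_vector M c p v"
  by (rule tangent_eqI[OF coord_vector_tangent[OF assms]
      tangent_add[OF coord_vector_tangent[OF assms] coord_vector_tangent[OF assms]] assms])
    (simp add: coord_vector_self[OF assms])

lemma coord_vector_scale:
  assumes "c \<in> charts_at M p"
  shows "coord_vector M c p (a *\<^sub>R u) = tangent_scale a (coord_vector M c p u)"
  by (rule tangent_eqI[OF coord_vector_tangent[OF assms]
      tangent_scale[OF coord_vector_tangent[OF assms]] assms])
    (simp add: coord_vector_self[OF assms] tangent_scale_def)

lemma coord_vector_zero:
  assumes "c \<in> charts_at M p"
  shows "coord_vector M c p 0 = 0"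
  by (rule tangent_eqI[OF coord_vector_tangent[OF assms] tangent_zero assms])
      (simp add: coord_vector_self[OF assms])

text \<open>Differentiability is assumed in every chart around the point because the chart used by
  \<open>along\<close> is an unknown choice.\<close>

lemma along_coord:
  assumes X: "X p \<in> tangent_space M p" and c: "c \<in> charts_at M p"
    and f: "\<And>d. d \<in> charts_at M p \<Longrightarrow> (f \<circ> cinv d) differentiable (at (cmap d p))"
  shows "along M X f p = \<D> (f \<circ> cinv c) (cmap c p) (X p c)"
proof -
  define d where "d = (SOME c. c \<in> charts_at M p)"
  have d: "d \<in> charts_at M p" unfolding d_def using c by (rule someI)
  have cd: "c \<in> atlas M" "d \<in> atlas M" using c d by (auto simp: charts_at_iff)
  have "(f \<circ> cinv d has_derivative \<D> (f \<circ> cinv d) (cmap d p)) (at (cmap d p))"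
    using f[OF d] frechet_derivative_works by blast
  moreover have "coord_rep id c d (cmap c p) = cmap d p"
    using coord_rep_cmap[OF charts_at_chart[OF c], of p id d] c by (simp add: charts_at_iff)
  ultimately have "((\<lambda>x. (f \<circ> cinv d) (coord_rep id c d x)) has_derivative
      (\<lambda>u. \<D> (f \<circ> cinv d) (cmap d p) (coord_deriv id c d p u))) (at (cmap c p))"
    using has_derivative_compose[OF Id.coord_deriv[OF c], of d "f \<circ> cinv d"] d by simp
  then have "(f \<circ> cinv c has_derivative
      (\<lambda>u. \<D> (f \<circ> cinv d) (cmap d p) (coord_deriv id c d p u))) (at (cmap c p))"
    by (rule has_derivative_transform_within_open[OF _ Id.domain_open[OF cd] transition_image[OF c d]])
      (simp only: o_apply in_coord_domain(5)[OF cd])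
  then show ?thesis
    unfolding along_def Let_def d_def[symmetric]
    by (simp add: frechet_derivative_eq tangentD[OF X c d])
qed

end

locale riemannian_ctxt = manifold_ctxt M for M :: "('p, 'e::real_normed_vector) manifold" +
  fixes g :: "('p, 'e) metric_field"
  assumes metric: "riemannian_metric M g"
begin

lemmas metric_axioms =
  bspec[OF bspec[OF bspec[OF conjunct1[OF metric[unfolded riemannian_metric_def]]]]]

lemma metric_add:
  assumes "p \<in> points M" "u \<in> tangent_space M p" "v \<in> tangent_space M p" "w \<in> tangent_space M p"
  shows "g p (u + v) w = g p u w + g p v w"
  by (rule bspec[OF conjunct1[OF metric_axioms[OF assms(1-3)]] assms(4)])

lemma metric_scale:
  assumes "p \<in> points M" "u \<in> tangent_space M p" "v \<in> tangent_space M p"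
  shows "g p (tangent_scale a u) v = a * g p u v"
  by (rule spec[OF conjunct1[OF conjunct2[OF metric_axioms[OF assms]]]])

lemma metric_sym:
  assumes "p \<in> points M" "u \<in> tangent_space M p" "v \<in> tangent_space M p"
  shows "g p u v = g p v u"
  by (rule conjunct2[OF conjunct2[OF metric_axioms[OF assms]]])

lemma metric_pos: "p \<in> points M \<Longrightarrow> v \<in> tangent_space M p \<Longrightarrow> v \<noteq> 0 \<Longrightarrow> 0 < g p v v"
  using metric unfolding riemannian_metric_def by blast

lemma metric_coord:
  assumes "c \<in> charts_at M p" "u \<in> tangent_space M p" "v \<in> tangent_space M p"
  shows "g p u v = metric_rep M g c (cmap c p) (u c) (v c)"
  using assms by (simp add: metric_rep_def cinv_cmap_at coord_vector_eq)

lemma metric_rep_form: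
  assumes "c \<in> charts_at M p"
  shows "inner_form (metric_rep M g c (cmap c p))"
proof -
  have p: "p \<in> points M" using assms by (rule charts_at_points)
  note t = coord_vector_tangent[OF assms]
  let ?G = "\<lambda>u w. g p (coord_vector M c p u) (coord_vector M c p w)"
  have sym: "?G u w = ?G w u" for u w by (rule metric_sym[OF p t t])
  have add: "?G (u + v) w = ?G u w + ?G v w" for u v w
    unfolding coord_vector_add[OF assms] by (rule metric_add[OF p t t t])
  have scale: "?G (a *\<^sub>R u) w = a * ?G u w" for a u w
    unfolding coord_vector_scale[OF assms] by (rule metric_scale[OF p t t])
  have "linear (?G u)" for u
  proof (rule linearI)
    show "?G u (v + w) = ?G u v + ?G u w" for v w
      using add[of v w u] by (simp only: sym[of u])
    show "?G u (a *\<^sub>R v) = a *\<^sub>R ?G u v" for a v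
      using scale[of a v u] by (simp only: sym[of u] real_scaleR_def)
  qed
  moreover have "0 < ?G u u" if "u \<noteq> 0" for u
  proof (rule metric_pos[OF p t])
    show "coord_vector M c p u \<noteq> 0"
      using coord_vector_self[OF assms, of u] that by auto
  qed
  moreover have "metric_rep M g c (cmap c p) = ?G"
    by (simp add: metric_rep_def[abs_def] cinv_cmap_at[OF assms])
  ultimately show ?thesis using sym unfolding inner_form_def by simp
qed

lemma local_metric_rep:
  assumes "c \<in> atlas M"
  shows "local_metric (cmap c ` cdom c) (metric_rep M g c)"
proof
  show "fin_dim TYPE('e)" by (rule fd)
  show "open (cmap c ` cdom c)" by (rule image_open[OF assms])
  show "inner_form (metric_rep M g c x)" if "x \<in> cmap c ` cdom c" for x
    using metric_rep_form[OF cinv_chart(1)[OF assms that]] cinv_chart(2)[OF assms that] by simp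
  show "smooth_on (cmap c ` cdom c) (\<lambda>x. metric_rep M g c x u v)" for u v
    unfolding metric_rep_def
    by (rule spec[OF spec[OF bspec[OF conjunct2[OF conjunct2[OF metric[unfolded riemannian_metric_def]]]
        assms]]])
qed

lemma local_metric_at: "c \<in> charts_at M p \<Longrightarrow> local_metric (cmap c ` cdom c) (metric_rep M g c)"
  by (rule local_metric_rep) (simp add: charts_at_iff)

lemma metric_rep_transition:
  assumes "c \<in> atlas M" "d \<in> atlas M" "x \<in> Id.coord_domain c d"
  shows "metric_rep M g c x u v = metric_rep M g d (coord_rep id c d x)
    (\<D> (coord_rep id c d) x u) (\<D> (coord_rep id c d) x v)"
proof -
  note i = in_coord_domain[OF assms]
  have "metric_rep M g c x u v = metric_rep M g d (cmap d (cinv c x))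
      (coord_vector M c (cinv c x) u d) (coord_vector M c (cinv c x) v d)"
    unfolding metric_rep_def[of M g c] by (intro metric_coord i coord_vector_tangent)
  then show ?thesis by (simp add: coord_vector_def i)
qed

text \<open>The inhomogeneous transformation law of the Christoffel symbols: a transition map is an
  isometry of the coordinate metrics, and being invertible its derivative reaches all test vectors,
  so \<open>koszul_pullback\<close> determines the whole vector.\<close>

lemma christoffel_transition:
  assumes c: "c \<in> charts_at M p" and d: "d \<in> charts_at M p"
  shows "coord_deriv id c d p (christoffel (metric_rep M g c) (cmap c p) u v) =
    christoffel (metric_rep M g d) (cmap d p) (coord_deriv id c d p u) (coord_deriv id c d p v)
      + second_derivative (coord_rep id c d) (cmap c p) u v"
proof -
  have cd: "c \<in> atlas M" "d \<in> atlas M" using c d by (auto simp: charts_at_iff)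
  let ?\<phi> = "coord_rep id c d" and ?x = "cmap c p" and ?S = "Id.coord_domain c d"
  let ?G = "metric_rep M g c" and ?H = "metric_rep M g d" and ?D = "coord_deriv id c d p"
  have x: "?x \<in> ?S" by (rule transition_image[OF c d])
  have \<phi>x: "?\<phi> ?x = cmap d p" using in_coord_domain(4)[OF cd x] cinv_cmap_at[OF c] by simp
  have D: "\<D> ?\<phi> ?x = ?D" by (simp add: coord_deriv_def)
  have S: "open ?S" "?S \<subseteq> cmap c ` cdom c" "?\<phi> ` ?S \<subseteq> cmap d ` cdom d" "smooth_on ?S ?\<phi>"
    using Id.domain_open[OF cd] Id.coord_smooth[OF cd] Id.coord_rep_maps[OF cd(1)] by auto
  have W: "?\<phi> ?x \<in> cmap d ` cdom d" unfolding \<phi>x by (rule cmap_in[OF d])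
  have pull: "?G ?x (christoffel ?G ?x u v) w = ?H (?\<phi> ?x) (christoffel ?H (?\<phi> ?x)
      (\<D> ?\<phi> ?x u) (\<D> ?\<phi> ?x v) + second_derivative ?\<phi> ?x u v)
      (\<D> ?\<phi> ?x w)" for w
    by (rule koszul_pullback[where P="\<lambda>_. True", OF local_metric_rep[OF cd(1)] local_metric_rep[OF cd(2)]
          cmap_in[OF c] W S(1) x S(4) TrueI TrueI TrueI
          isometry_metric_derivative[OF local_metric_rep[OF cd(1)] local_metric_rep[OF cd(2)] S
              metric_rep_transition[OF cd] x]])
  have "?H (cmap d p) (?D (christoffel ?G ?x u v)) z = ?H (cmap d p)
      (christoffel ?H (cmap d p) (?D u) (?D v) + second_derivative ?\<phi> ?x u v) z" for z
  proof -
    have z: "?D (coord_deriv id d c p z) = z" by (rule coord_deriv_id_inverse[OF d c])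
    show ?thesis
      using pull[of "coord_deriv id d c p z"] metric_rep_transition[OF cd x]
      by (simp add: \<phi>x D z)
  qed
  then show ?thesis by (rule inner_form_eqI[OF metric_rep_form[OF d]])
qed

lemma field_transition_deriv:
  assumes Y: "vector_field M Y" and c: "c \<in> charts_at M p" and d: "d \<in> charts_at M p"
  shows "\<D> (field_rep Y d) (cmap d p) (coord_deriv id c d p u) =
    second_derivative (coord_rep id c d) (cmap c p) u (Y p c)
     + coord_deriv id c d p (\<D> (field_rep Y c) (cmap c p) u)"
proof -
  have cd: "c \<in> atlas M" "d \<in> atlas M" using c d by (auto simp: charts_at_iff)
  have x: "cmap c p \<in> Id.coord_domain c d" by (rule transition_image[OF c d])
  have \<phi>x: "coord_rep id c d (cmap c p) = cmap d p" using in_coord_domain(4)[OF cd x] cinv_cmap_at[OF c]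
      by simp
  have 1: "((\<lambda>x. field_rep Y d (coord_rep id c d x)) has_derivative
      (\<lambda>u. \<D> (field_rep Y d) (cmap d p) (coord_deriv id c d p u))) (at (cmap c p))"
    using has_derivative_compose[OF Id.coord_deriv[OF c], of d "field_rep Y d"] field_rep_deriv[OF Y d] d \<phi>x
    by simp
  have 2: "((\<lambda>x. \<D> (coord_rep id c d) x (field_rep Y c x)) has_derivative
      (\<lambda>u. second_derivative (coord_rep id c d) (cmap c p) u (field_rep Y c (cmap c p))
        + \<D> (coord_rep id c d) (cmap c p) (\<D> (field_rep Y c) (cmap c p) u)))
      (at (cmap c p))"
    by (rule has_derivative_frechet_apply[OF fd Id.domain_open[OF cd] x Id.coord_smooth[OF cd]
        field_rep_deriv[OF Y c]])
  have "\<D> (field_rep Y d) (cmap d p) (coord_deriv id c d p u)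
     = second_derivative (coord_rep id c d) (cmap c p) u (field_rep Y c (cmap c p))
        + \<D> (coord_rep id c d) (cmap c p) (\<D> (field_rep Y c) (cmap c p) u)"
  proof (rule has_derivative_unique_open[OF Id.domain_open[OF cd] x 1 2])
    fix y assume y: "y \<in> Id.coord_domain c d"
    note i = in_coord_domain[OF cd y]
    show "field_rep Y d (coord_rep id c d y) = \<D> (coord_rep id c d) y (field_rep Y c y)"
      using tangentD[OF vector_fieldD(1)[OF Y] i(1,2)] by (simp only: field_rep_def i(5,8))
  qed
  then show ?thesis by (simp add: field_rep_cmap[OF c] coord_deriv_def)
qed

lemma coord_connection_rep:
  assumes "c \<in> atlas M" "x \<in> cmap c ` cdom c"
  shows "field_rep (coord_connection M g X Y) c x = \<D> (field_rep Y c) x (field_rep X c x)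
      + christoffel (metric_rep M g c) x (field_rep X c x) (field_rep Y c x)"
  using cinv_chart[OF assms] by (simp add: field_rep_def coord_connection_def)

text \<open>The chart expressions fit together because the second derivative of the transition map
  enters the law for the derivative of \<open>Y\<close> and the law for the Christoffel symbols with
  opposite signs.\<close>

lemma vector_field_coord_connection:
  assumes X: "vector_field M X" and Y: "vector_field M Y"
  shows "vector_field M (coord_connection M g X Y)"
proof (rule vector_fieldI)
  fix p
  show "coord_connection M g X Y p \<in> tangent_space M p"
  proof (rule tangentI)
    fix c d assume c: "c \<in> charts_at M p" and d: "d \<in> charts_at M p"
    show "coord_connection M g X Y p d = coord_deriv id c d p (coord_connection M g X Y p c)"
      using field_transition_deriv[OF Y c d, of "X p c"] christoffel_transition[OF c d, of "X p c" "Y p c"]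
        tangentD[OF vector_fieldD(1)[OF X] c d] tangentD[OF vector_fieldD(1)[OF Y] c d] c d
      by (simp add: coord_connection_def linear_add[OF coord_deriv_id_linear[OF c d]])
  qed (simp add: coord_connection_def)
next
  fix c assume c: "c \<in> atlas M"
  interpret L: local_metric "cmap c ` cdom c" "metric_rep M g c" by (rule local_metric_rep[OF c])
  note XY = vector_fieldD(2)[OF X c] vector_fieldD(2)[OF Y c]
  have 1: "smooth_on (cmap c ` cdom c) (\<lambda>x. christoffel (metric_rep M g c) x u (field_rep Y c x))" for u
    by (rule smooth_on_apply[OF fd image_open[OF c] L.lin(1) L.smooth_christoffel XY(2)])
  have 2: "smooth_on (cmap c ` cdom c) (\<lambda>x. christoffel (metric_rep M g c) x (field_rep X c x)
      (field_rep Y c x))"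
    by (rule smooth_on_apply[where A="\<lambda>x u. christoffel (metric_rep M g c) x u (field_rep Y c x)",
          OF fd image_open[OF c] L.lin(2) 1 XY(1)])
  show "smooth_on (cmap c ` cdom c) (field_rep (coord_connection M g X Y) c)"
    by (rule smooth_on_cong[OF image_open[OF c] smooth_on_add[OF image_open[OF c]
            smooth_on_dderiv[OF fd image_open[OF c] XY(2,1)] 2] coord_connection_rep[OF c, symmetric]])
qed

end

context manifold_ctxt
begin

lemma lie_bracket_coord:
  "c \<in> charts_at M p \<Longrightarrow> lie_bracket M X Y p c =
    \<D> (field_rep Y c) (cmap c p) (X p c)
    - \<D> (field_rep X c) (cmap c p) (Y p c)"
  by (simp add: lie_bracket_def field_rep_def[abs_def])

lemma vector_field_eqI:
  assumes "\<And>p c. c \<in> charts_at M p \<Longrightarrow> X p c = Y p c" "\<And>p c. c \<notin> charts_at M p \<Longrightarrow> X p c = Y p c"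
  shows "X = Y"
  using assms by blast

lemma field_scale_rep: "field_rep (field_scale f X) c = (\<lambda>x. (f \<circ> cinv c) x *\<^sub>R field_rep X c x)"
  by (simp add: field_rep_def field_scale_def tangent_scale_def fun_eq_iff)

end

section \<open>Existence and uniqueness of the Levi-Civita connection\<close>

context riemannian_ctxt
begin

lemma metric_field_rep:
  assumes "vector_field M Y" "vector_field M Z" "c \<in> atlas M" "x \<in> cmap c ` cdom c"
  shows "((\<lambda>q. g q (Y q) (Z q)) \<circ> cinv c) x = metric_rep M g c x (field_rep Y c x) (field_rep Z c x)"
  using metric_coord[OF cinv_chart(1)[OF assms(3,4)] vector_fieldD(1)[OF assms(1)]
      vector_fieldD(1)[OF assms(2)]]
  by (simp add: field_rep_def cinv_chart(2)[OF assms(3,4)])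

lemma metric_field_deriv:
  assumes Y: "vector_field M Y" and Z: "vector_field M Z" and c: "c \<in> charts_at M p"
  shows "((\<lambda>q. g q (Y q) (Z q)) \<circ> cinv c has_derivative (\<lambda>u.
      metric_derivative (metric_rep M g c) (cmap c p) u (Y p c) (Z p c)
      + metric_rep M g c (cmap c p) (\<D> (field_rep Y c) (cmap c p) u) (Z p c)
      + metric_rep M g c (cmap c p) (Y p c) (\<D> (field_rep Z c) (cmap c p) u))) (at (cmap c p))"
proof -
  have cA: "c \<in> atlas M" using c by (simp add: charts_at_iff)
  interpret L: local_metric "cmap c ` cdom c" "metric_rep M g c" by (rule local_metric_rep[OF cA])
  note x = cmap_in[OF c]
  have G: "((\<lambda>y. metric_rep M g c y u v) has_derivative
      (\<lambda>w. metric_derivative (metric_rep M g c) (cmap c p) w u v)) (at (cmap c p))" for u v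
    unfolding metric_derivative_def by (rule smooth_onD[OF
        local_metric.smooth[OF local_metric_rep[OF cA]] x])
  from has_derivative_bilinear_apply[where B="metric_rep M g c", OF fd L.open_U x
      inner_formD(1)[OF L.form] inner_formD(2)[OF L.form] G field_rep_deriv[OF Y c] field_rep_deriv[OF Z c]]
  have "((\<lambda>y. metric_rep M g c y (field_rep Y c y) (field_rep Z c y)) has_derivative (\<lambda>u.
      metric_derivative (metric_rep M g c) (cmap c p) u (Y p c) (Z p c)
      + metric_rep M g c (cmap c p) (\<D> (field_rep Y c) (cmap c p) u) (Z p c)
      + metric_rep M g c (cmap c p) (Y p c) (\<D> (field_rep Z c) (cmap c p) u))) (at (cmap c p))"
    by (simp add: field_rep_cmap[OF c])
  then show ?thesis
    by (rule has_derivative_transform_within_open[OF _ L.open_U x])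
        (rule metric_field_rep[OF Y Z cA, symmetric])
qed

lemma along_metric:
  assumes X: "vector_field M X" and Y: "vector_field M Y" and Z: "vector_field M Z" and c:
      "c \<in> charts_at M p"
  shows "along M X (\<lambda>q. g q (Y q) (Z q)) p =
      metric_derivative (metric_rep M g c) (cmap c p) (X p c) (Y p c) (Z p c)
      + metric_rep M g c (cmap c p) (\<D> (field_rep Y c) (cmap c p) (X p c)) (Z p c)
      + metric_rep M g c (cmap c p) (Y p c) (\<D> (field_rep Z c) (cmap c p) (X p c))"
proof -
  have "along M X (\<lambda>q. g q (Y q) (Z q)) p
      = \<D> ((\<lambda>q. g q (Y q) (Z q)) \<circ> cinv c) (cmap c p) (X p c)"
    by (rule along_coord[where X=X and p=p and c=c, OF vector_fieldD(1)[OF X] c])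
        (use metric_field_deriv[OF Y Z] differentiable_def in blast)
  then show ?thesis by (simp add: frechet_derivative_eq[OF metric_field_deriv[OF Y Z c]])
qed

text \<open>The derivatives of \<open>X\<close> and \<open>Y\<close> cancel between the derivative
  of the product and the brackets. What remains depends on \<open>X\<close> and \<open>Y\<close>
  only through their values at the point, but on the first derivative of \<open>V\<close>.\<close>

lemma lie_metric_coord:
  assumes V: "vector_field M V" and X: "vector_field M X" and Y: "vector_field M Y" and c:
      "c \<in> charts_at M p"
    and b: "vector_field M (lie_bracket M V X)" "vector_field M (lie_bracket M V Y)"
  shows "lie_metric M g V X Y p =
      metric_derivative (metric_rep M g c) (cmap c p) (V p c) (X p c) (Y p c)
      + metric_rep M g c (cmap c p) (\<D> (field_rep V c) (cmap c p) (X p c)) (Y p c)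
      + metric_rep M g c (cmap c p) (X p c) (\<D> (field_rep V c) (cmap c p) (Y p c))"
  unfolding lie_metric_def along_metric[OF V X Y c]
    metric_coord[OF c vector_fieldD(1)[OF b(1)] vector_fieldD(1)[OF Y]]
    metric_coord[OF c vector_fieldD(1)[OF X] vector_fieldD(1)[OF b(2)]]
  by (simp add: lie_bracket_coord[OF c] inner_formD(7,8)[OF metric_rep_form[OF c]])

lemma coord_connection_torsion_free:
  "coord_connection M g X Y - coord_connection M g Y X = lie_bracket M X Y"
proof (rule vector_field_eqI)
  fix p c assume c: "c \<in> charts_at M p"
  interpret L: local_metric "cmap c ` cdom c" "metric_rep M g c" by (rule local_metric_at[OF c])
  show "(coord_connection M g X Y - coord_connection M g Y X) p c = lie_bracket M X Y p c"
    using L.christoffel_sym[OF cmap_in[OF c], of "X p c" "Y p c"] c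
    by (simp add: coord_connection_def lie_bracket_coord[OF c])
qed (simp add: coord_connection_def lie_bracket_def)

text \<open>By vanishing torsion the bracket is a difference of two covariant derivatives, from
  which it inherits smoothness and the transformation law.\<close>

lemma vector_field_lie_bracket:
  "vector_field M X \<Longrightarrow> vector_field M Y \<Longrightarrow> vector_field M (lie_bracket M X Y)"
  unfolding coord_connection_torsion_free[symmetric]
  by (intro vector_field_diff vector_field_coord_connection)

lemma affine_coord_connection: "affine_connection M (coord_connection M g)"
  unfolding affine_connection_def
proof (intro allI impI conjI)
  fix X Y assume X: "vector_field M X" and Y: "vector_field M Y"
  show "vector_field M (coord_connection M g X Y)" by (rule vector_field_coord_connection[OF X Y])
  note out = coord_connection_def field_scale_def tangent_scale_def
  {
    fix X' assume X': "vector_field M X'"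
    show "coord_connection M g (X + X') Y = coord_connection M g X Y + coord_connection M g X' Y"
    proof (rule vector_field_eqI)
      fix p c assume c: "c \<in> charts_at M p"
      interpret L: local_metric "cmap c ` cdom c" "metric_rep M g c" by (rule local_metric_at[OF c])
      show "coord_connection M g (X + X') Y p c = (coord_connection M g X Y + coord_connection M g X' Y)
          p c"
        using c by (simp add: coord_connection_def linear_add[OF L.lin(2)[OF cmap_in[OF c]]]
            linear_add[OF has_derivative_linear[OF field_rep_deriv[OF Y c]]])
    qed (simp add: out)
  next
    fix Y' assume Y': "vector_field M Y'"
    show "coord_connection M g X (Y + Y') = coord_connection M g X Y + coord_connection M g X Y'"
    proof (rule vector_field_eqI)
      fix p c assume c: "c \<in> charts_at M p"
      interpret L: local_metric "cmap c ` cdom c" "metric_rep M g c" by (rule local_metric_at[OF c])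
      have "field_rep (Y + Y') c = (\<lambda>x. field_rep Y c x + field_rep Y' c x)"
        by (simp add: field_rep_def fun_eq_iff)
      then have "\<D> (field_rep (Y + Y') c) (cmap c p) =
         (\<lambda>u. \<D> (field_rep Y c) (cmap c p) u + \<D> (field_rep Y' c) (cmap c p) u)"
        using frechet_derivative_eq[OF has_derivative_add[OF field_rep_deriv[OF Y c]
            field_rep_deriv[OF Y' c]]] by simp
      then show "coord_connection M g X (Y + Y') p c =
          (coord_connection M g X Y + coord_connection M g X Y') p c"
        using c by (simp add: coord_connection_def linear_add[OF L.lin(1)[OF cmap_in[OF c]]])
    qed (simp add: out)
  next
    fix f assume f: "smooth_fun M f"
    show "coord_connection M g (field_scale f X) Y = field_scale f (coord_connection M g X Y)"
    proof (rule vector_field_eqI)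
      fix p c assume c: "c \<in> charts_at M p"
      interpret L: local_metric "cmap c ` cdom c" "metric_rep M g c" by (rule local_metric_at[OF c])
      show "coord_connection M g (field_scale f X) Y p c = field_scale f (coord_connection M g X Y) p c"
        using c by (simp add: out linear_scale[OF L.lin(2)[OF cmap_in[OF c]]] scaleR_right_distrib
            linear_scale[OF has_derivative_linear[OF field_rep_deriv[OF Y c]]])
    qed (simp add: out)
    show "coord_connection M g X (field_scale f Y)
        = field_scale (along M X f) Y + field_scale f (coord_connection M g X Y)"
    proof (rule vector_field_eqI)
      fix p c assume c: "c \<in> charts_at M p"
      interpret L: local_metric "cmap c ` cdom c" "metric_rep M g c" by (rule local_metric_at[OF c])
      have fd: "(f \<circ> cinv d) differentiable (at (cmap d p))" if "d \<in> charts_at M p" for d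
        using f that cmap_in[OF that] unfolding smooth_fun_def charts_at_iff
        by (blast intro: smooth_on_differentiable)
      then have fc: "(f \<circ> cinv c has_derivative \<D> (f \<circ> cinv c) (cmap c p)) (at (cmap c p))"
        using c frechet_derivative_works by blast
      have "\<D> (field_rep (field_scale f Y) c) (cmap c p) = (\<lambda>u.
          (f \<circ> cinv c) (cmap c p) *\<^sub>R \<D> (field_rep Y c) (cmap c p) u
          + \<D> (f \<circ> cinv c) (cmap c p) u *\<^sub>R field_rep Y c (cmap c p))"
        unfolding field_scale_rep
        by (rule frechet_derivative_eq[OF has_derivative_scaleR[OF fc field_rep_deriv[OF Y c]]])
      moreover have "along M X f p = \<D> (f \<circ> cinv c) (cmap c p) (X p c)"
        by (rule along_coord[where X=X and p=p and c=c and f=f, OF vector_fieldD(1)[OF X] c fd])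
      ultimately show "coord_connection M g X (field_scale f Y) p c
          = (field_scale (along M X f) Y + field_scale f (coord_connection M g X Y)) p c"
        using c by (simp add: out linear_scale[OF L.lin(1)[OF cmap_in[OF c]]] scaleR_right_distrib
            cinv_cmap_at[OF c] field_rep_cmap[OF c])
    next
      fix p c assume c: "c \<notin> charts_at M p"
      then show "coord_connection M g X (field_scale f Y) p c
          = (field_scale (along M X f) Y + field_scale f (coord_connection M g X Y)) p c"
        using tangentD0[OF vector_fieldD(1)[OF Y] c] by (simp add: out)
    qed
  }
qed

lemma levi_civita_coord_connection: "levi_civita_connection M g (coord_connection M g)"
  unfolding levi_civita_connection_def
proof (intro conjI allI impI ballI affine_coord_connection coord_connection_torsion_free)
  fix X Y Z p assume X: "vector_field M X" and Y: "vector_field M Y" and Z: "vector_field M Z" and p: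
      "p \<in> points M"
  obtain c where c: "c \<in> charts_at M p" using charts_at_ex[OF p] by blast
  interpret L: local_metric "cmap c ` cdom c" "metric_rep M g c" by (rule local_metric_at[OF c])
  note t = vector_fieldD(1)[OF vector_field_coord_connection[OF X Y]] vector_fieldD(1)[OF Z]
    vector_fieldD(1)[OF Y] vector_fieldD(1)[OF vector_field_coord_connection[OF X Z]]
  show "along M X (\<lambda>q. g q (Y q) (Z q)) p
      = g p (coord_connection M g X Y p) (Z p) + g p (Y p) (coord_connection M g X Z p)"
    unfolding along_metric[OF X Y Z c] metric_coord[OF c t(1,2)] metric_coord[OF c t(3,4)]
    using c by (simp add: coord_connection_def inner_formD(5,6)[OF metric_rep_form[OF c]]
        L.metric_compatible[OF cmap_in[OF c]])
qed

lemma metric_diff: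
  assumes "p \<in> points M" "u \<in> tangent_space M p" "v \<in> tangent_space M p" "w \<in> tangent_space M p"
  shows "g p (u - v) w = g p u w - g p v w"
  using metric_add[OF assms(1) tangent_diff[OF assms(2,3)] assms(3,4)] by simp

text \<open>The right-hand side does not mention \<open>D\<close>, so any two Levi-Civita
  connections have the same products with smooth fields.\<close>

lemma levi_civita_koszul:
  assumes D: "levi_civita_connection M g D"
    and X: "vector_field M X" and Y: "vector_field M Y" and Z: "vector_field M Z" and p: "p \<in> points M"
  shows "2 * g p (D X Y p) (Z p) =
    along M X (\<lambda>q. g q (Y q) (Z q)) p + along M Y (\<lambda>q. g q (X q) (Z q)) p - along M Z
        (\<lambda>q. g q (X q) (Y q)) p
    + g p (lie_bracket M X Y p) (Z p) - g p (lie_bracket M X Z p) (Y p) - g p (lie_bracket M Y Z p) (X p)"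
proof -
  have vf: "vector_field M (D A B)" if "vector_field M A" "vector_field M B" for A B
    using D that unfolding levi_civita_connection_def affine_connection_def by blast
  have comp: "along M A (\<lambda>q. g q (B q) (C q)) p = g p (D A B p) (C p) + g p (B p) (D A C p)"
    if "vector_field M A" "vector_field M B" "vector_field M C" for A B C
    using D that p unfolding levi_civita_connection_def by blast
  have tors: "lie_bracket M A B p = D A B p - D B A p" if "vector_field M A" "vector_field M B" for A B
  proof -
    have "D A B - D B A = lie_bracket M A B"
      using D that unfolding levi_civita_connection_def by blast
    then show ?thesis by (metis minus_apply)
  qed
  note t = vector_fieldD(1)
  have br: "g p (lie_bracket M A B p) (C p) = g p (D A B p) (C p) - g p (D B A p) (C p)"
    if "vector_field M A" "vector_field M B" "vector_field M C" for A B C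
    unfolding tors[OF that(1,2)] by (rule metric_diff[OF p t[OF vf] t[OF vf] t]) (use that in auto)
  have s: "g p (B p) (D A C p) = g p (D A C p) (B p)"
    if "vector_field M A" "vector_field M B" "vector_field M C" for A B C
    by (rule metric_sym[OF p t t[OF vf]]) (use that in auto)
  show ?thesis
    unfolding comp[OF X Y Z] comp[OF Y X Z] comp[OF Z X Y] br[OF X Y Z] br[OF X Z Y] br[OF Y Z X]
      s[OF X Y Z] s[OF Y X Z] s[OF Z X Y] by simp
qed

lemma levi_civita_unique:
  assumes D: "levi_civita_connection M g D" and D': "levi_civita_connection M g D'"
    and X: "vector_field M X" and Y: "vector_field M Y"
  shows "D X Y = D' X Y"
proof
  fix p
  have vf: "vector_field M (D X Y)" "vector_field M (D' X Y)"
    using D D' X Y by (simp_all add: levi_civita_connection_def affine_connection_def)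
  \<comment> \<open>The difference is itself a smooth field and serves as its own test
    field.\<close>
  let ?Z = "D X Y - D' X Y"
  have Z: "vector_field M ?Z" by (rule vector_field_diff[OF vf])
  show "D X Y p = D' X Y p"
  proof (cases "p \<in> points M")
    case True
    have "g p (D X Y p) (?Z p) = g p (D' X Y p) (?Z p)"
      using levi_civita_koszul[OF D X Y Z True] levi_civita_koszul[OF D' X Y Z True] by simp
    then have "g p (?Z p) (?Z p) = 0"
      using metric_diff[OF True vector_fieldD(1)[OF vf(1)] vector_fieldD(1)[OF vf(2)]
          vector_fieldD(1)[OF Z]]
      by simp
    then have "?Z p = 0" using metric_pos[OF True vector_fieldD(1)[OF Z]] by fastforce
    then show ?thesis by simp
  next
    case False
    then show ?thesis using tangent_outside vector_fieldD(1)[OF vf(1)] vector_fieldD(1)[OF vf(2)] by metis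
  qed
qed

text \<open>This removes the choice in \<open>levi_civita\<close>: existence makes the chosen object
  a Levi-Civita connection, uniqueness fixes its values, but only on smooth vector fields.\<close>

lemma levi_civita_eq:
  assumes "vector_field M X" "vector_field M Y"
  shows "levi_civita M g X Y = coord_connection M g X Y"
proof -
  have "levi_civita_connection M g (levi_civita M g)"
    unfolding levi_civita_def by (rule someI[of "levi_civita_connection M g", OF
        levi_civita_coord_connection])
  then show ?thesis by (rule levi_civita_unique[OF _ levi_civita_coord_connection assms])
qed

section \<open>Curvature in a chart\<close>

lemma iterated_connection_coord:
  assumes X: "vector_field M X" and Y: "vector_field M Y" and Z: "vector_field M Z" and c:
      "c \<in> charts_at M p"
  shows "coord_connection M g X (coord_connection M g Y Z) p c =
     second_derivative (field_rep Z c) (cmap c p) (X p c) (Y p c)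
   + \<D> (field_rep Z c) (cmap c p) (\<D> (field_rep Y c) (cmap c p) (X p c))
   + (\<D> (\<lambda>y. christoffel (metric_rep M g c) y (Y p c) (Z p c)) (cmap c p) (X p c)
     + christoffel (metric_rep M g c) (cmap c p) (\<D> (field_rep Y c) (cmap c p) (X p c)) (Z p c)
     + christoffel (metric_rep M g c) (cmap c p) (Y p c) (\<D> (field_rep Z c) (cmap c p) (X p c)))
   + (christoffel (metric_rep M g c) (cmap c p) (X p c) (\<D> (field_rep Z c) (cmap c p) (Y p c))
     + christoffel (metric_rep M g c) (cmap c p) (X p c)
         (christoffel (metric_rep M g c) (cmap c p) (Y p c) (Z p c)))"
proof -
  have cA: "c \<in> atlas M" using c by (simp add: charts_at_iff)
  interpret L: local_metric "cmap c ` cdom c" "metric_rep M g c" by (rule local_metric_rep[OF cA])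
  note x = cmap_in[OF c]
  have 1: "((\<lambda>y. \<D> (field_rep Z c) y (field_rep Y c y)
      + christoffel (metric_rep M g c) y (field_rep Y c y) (field_rep Z c y)) has_derivative (\<lambda>u.
     (second_derivative (field_rep Z c) (cmap c p) u (field_rep Y c (cmap c p))
      + \<D> (field_rep Z c) (cmap c p) (\<D> (field_rep Y c) (cmap c p) u))
   + (\<D> (\<lambda>y. christoffel (metric_rep M g c) y (field_rep Y c (cmap c p)) (field_rep Z c (cmap c p)))
       (cmap c p) u
     + christoffel (metric_rep M g c) (cmap c p) (\<D> (field_rep Y c) (cmap c p) u) (field_rep Z c (cmap c p))
     + christoffel (metric_rep M g c) (cmap c p) (field_rep Y c (cmap c p))
         (\<D> (field_rep Z c) (cmap c p) u))))
     (at (cmap c p))"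
    by (intro has_derivative_add
        has_derivative_frechet_apply[OF fd L.open_U x vector_fieldD(2)[OF Z cA] field_rep_deriv[OF Y c]]
        has_derivative_bilinear_apply[OF fd L.open_U x L.lin(1) L.lin(2) L.der[OF x]
            field_rep_deriv[OF Y c] field_rep_deriv[OF Z c]])
  have "(field_rep (coord_connection M g Y Z) c has_derivative (\<lambda>u.
     (second_derivative (field_rep Z c) (cmap c p) u (field_rep Y c (cmap c p))
      + \<D> (field_rep Z c) (cmap c p) (\<D> (field_rep Y c) (cmap c p) u))
   + (\<D> (\<lambda>y. christoffel (metric_rep M g c) y (field_rep Y c (cmap c p)) (field_rep Z c (cmap c p)))
       (cmap c p) u
     + christoffel (metric_rep M g c) (cmap c p) (\<D> (field_rep Y c) (cmap c p) u) (field_rep Z c (cmap c p))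
     + christoffel (metric_rep M g c) (cmap c p) (field_rep Y c (cmap c p))
         (\<D> (field_rep Z c) (cmap c p) u))))
     (at (cmap c p))"
    by (rule has_derivative_transform_within_open[OF 1 L.open_U x])
        (rule coord_connection_rep[OF cA, symmetric])
  from frechet_derivative_eq[OF this] show ?thesis
    using c by (simp add: coord_connection_def[of M g X] field_rep_cmap[OF c])
      (simp add: coord_connection_def linear_add[OF L.lin(1)[OF x]])
qed

text \<open>Tensoriality. After antisymmetrisation the second derivative of \<open>Z\<close> cancels
  by symmetry, the terms pairing a symbol with a derivative of \<open>Z\<close> cancel in pairs, and
  all derivatives of \<open>X\<close> and \<open>Y\<close> are absorbed by the bracket term. The
  values at the point remain.\<close>

lemma curvature_coord:
  assumes X: "vector_field M X" and Y: "vector_field M Y" and Z: "vector_field M Z" and c: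
      "c \<in> charts_at M p"
  shows "curvature M g X Y Z p c
    = coord_curvature (christoffel (metric_rep M g c)) (cmap c p) (X p c) (Y p c) (Z p c)"
proof -
  have cA: "c \<in> atlas M" using c by (simp add: charts_at_iff)
  interpret L: local_metric "cmap c ` cdom c" "metric_rep M g c" by (rule local_metric_rep[OF cA])
  note x = cmap_in[OF c]
  note vf = vector_field_coord_connection
  have "curvature M g X Y Z = coord_connection M g X (coord_connection M g Y Z)
      - coord_connection M g Y (coord_connection M g X Z) - coord_connection M g (lie_bracket M X Y) Z"
    unfolding curvature_def Let_def
    by (simp add: levi_civita_eq X Y Z vf vector_field_lie_bracket)
  moreover have "coord_connection M g (lie_bracket M X Y) Z p c =
     \<D> (field_rep Z c) (cmap c p) (\<D> (field_rep Y c) (cmap c p) (X p c))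
     - \<D> (field_rep Z c) (cmap c p) (\<D> (field_rep X c) (cmap c p) (Y p c))
     + (christoffel (metric_rep M g c) (cmap c p) (\<D> (field_rep Y c) (cmap c p) (X p c)) (Z p c)
     - christoffel (metric_rep M g c) (cmap c p) (\<D> (field_rep X c) (cmap c p) (Y p c)) (Z p c))"
    using c by (simp add: coord_connection_def lie_bracket_coord[OF c] linear_diff[OF L.lin(2)[OF x]]
        linear_diff[OF has_derivative_linear[OF field_rep_deriv[OF Z c]]])
  ultimately show ?thesis
    using second_derivative_sym[OF L.open_U x vector_fieldD(2)[OF Z cA], of "X p c" "Y p c"]
    by (simp add: iterated_connection_coord[OF X Y Z c] iterated_connection_coord[OF Y X Z c]
        coord_curvature_def)
qed

lemma vector_field_curvature:
  assumes "vector_field M X" "vector_field M Y" "vector_field M Z"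
  shows "vector_field M (curvature M g X Y Z)"
  unfolding curvature_def Let_def
  by (simp add: levi_civita_eq assms vector_field_coord_connection vector_field_lie_bracket
      vector_field_diff)

end

text \<open>Cutting off by a bump function extends local fields to all of \<open>M\<close>; the Hausdorff property
  makes the extension by zero smooth.\<close>

lemma extend_local_field:
  fixes M :: "('p, 'e::euclidean_space) manifold"
  assumes M: "smooth_manifold M" and c: "c \<in> charts_at M p"
    and W: "open W" "cmap c p \<in> W" "W \<subseteq> cmap c ` cdom c" and Y: "smooth_on W Y"
  obtains X where "vector_field M X" "X p c = Y (cmap c p)"
    "\<And>q. X q \<noteq> 0 \<Longrightarrow> q \<in> cdom c \<and> cmap c q \<in> W \<and> (\<exists>a. X q = coord_vector M c q (a *\<^sub>R Y (cmap c q)))"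
proof -
  interpret manifold_ctxt M by unfold_locales (rule M)
  have cA: "c \<in> atlas M" using c by (simp add: charts_at_iff)
  note ch = chart[OF cA]
  obtain r where r: "r > 0" "cball (cmap c p) r \<subseteq> W" using W(1,2) open_contains_cball by blast
  obtain \<psi> :: "'e \<Rightarrow> real" where \<psi>: "smooth_on UNIV \<psi>" "\<psi> (cmap c p) = 1"
      "\<And>x. r \<le> dist x (cmap c p) \<Longrightarrow> \<psi> x = 0"
    using smooth_bump[OF r(1), of "cmap c p"] by blast
  define A where "A = {q \<in> cdom c. cmap c q \<in> W}"
  define K where "K = cinv c ` cball (cmap c p) r"
  define Z where "Z x = \<psi> x *\<^sub>R Y x" for x
  define X where "X q = (if q \<in> A then coord_vector M c q (Z (cmap c q)) else 0)" for q
  have AM: "openin (mtop M) A" unfolding A_def by (rule topological_chart_open_preimage[OF ch W(1)])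
  have "compactin (top_of_set (cmap c ` cdom c)) (cball (cmap c p) r)"
    using r(2) W(3) by (auto simp: compactin_subtopology)
  then have "compactin (mtop M) K"
    unfolding K_def by (rule image_compactin[OF _ topological_chart_continuous(2)[OF ch]])
  then have KM: "closedin (mtop M) K"
    using M by (intro compactin_imp_closedin) (simp add: smooth_manifold_def)
  have KA: "K \<subseteq> A"
  proof
    fix q assume "q \<in> K"
    then obtain x where x: "q = cinv c x" "x \<in> W" using r(2) unfolding K_def by blast
    then show "q \<in> A" using cinv_chart[OF cA, of x] W(3) unfolding A_def by (auto simp: charts_at_iff)
  qed
  have X0: "X q = 0" if "q \<notin> K" for q
  proof (cases "q \<in> A")
    case True
    then have q: "c \<in> charts_at M q" using cA by (simp add: A_def charts_at_iff)
    have "cmap c q \<notin> cball (cmap c p) r"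
      using that cinv_cmap_at[OF q] unfolding K_def by (metis imageI)
    then have "Z (cmap c q) = 0" using \<psi>(3)[of "cmap c q"] by (simp add: Z_def dist_commute)
    then show ?thesis using coord_vector_zero[OF q] by (simp add: X_def True)
  qed (simp add: X_def)
  have "vector_field M X"
  proof (rule vector_fieldI)
    show "X q \<in> tangent_space M q" for q
      using cA by (auto simp: X_def A_def charts_at_iff tangent_zero intro!: coord_vector_tangent)
    fix d assume d: "d \<in> atlas M"
    show "smooth_on (cmap d ` cdom d) (field_rep X d)"
    proof (rule smooth_on_local[OF image_open[OF d]])
      fix x assume x: "x \<in> cmap d ` cdom d"
      let ?q = "cinv d x"
      note q = cinv_chart[OF d x]
      have qd: "?q \<in> cdom d" using q(1) by (simp add: charts_at_iff)
      \<comment> \<open>Since \<open>K \<subseteq> A\<close>, the open set \<open>A\<close> and the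
        complement of the closed set \<open>K\<close> cover the manifold. On \<open>A\<close> the
        field is the cut-off field carried over to the chart \<open>d\<close>, off \<open>K\<close>
        it is zero.\<close>
      show "\<exists>U. open U \<and> x \<in> U \<and> smooth_on U (field_rep X d)"
      proof (cases "?q \<in> A")
        case True
        let ?T = "cmap d ` (cdom d \<inter> A)"
        let ?\<phi> = "coord_rep id c d" and ?\<chi> = "coord_rep id d c"
        have T: "open ?T"
          by (rule topological_chart_open_image[OF chart[OF d]])
            (use topological_chartD(1)[OF chart[OF d]] AM in auto)
        have TD: "?T \<subseteq> Id.coord_domain d c" by (auto simp: A_def)
        have o: "open (Id.coord_domain c d \<inter> W)" by (intro open_Int Id.domain_open cA d W(1))
        have sZ: "smooth_on (Id.coord_domain c d \<inter> W) Z"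
          unfolding Z_def by (intro smooth_on_scaleR o smooth_on_subset[OF \<psi>(1)] smooth_on_subset[OF Y])
              auto
        have h: "smooth_on (Id.coord_domain c d \<inter> W) (\<lambda>z. \<D> ?\<phi> z (Z z))"
          by (rule smooth_on_dderiv[OF fd o smooth_on_subset[OF Id.coord_smooth[OF cA d]] sZ]) auto
        have mp: "?\<chi> ` ?T \<subseteq> Id.coord_domain c d \<inter> W"
          using coord_rep_cmap[OF chart[OF d], of _ id c] by (auto simp: A_def)
        have "smooth_on ?T (\<lambda>y. \<D> ?\<phi> (?\<chi> y) (Z (?\<chi> y)))"
          by (rule smooth_on_compose[OF fd T o mp smooth_on_subset[OF Id.coord_smooth[OF d cA] TD] h])
        then have "smooth_on ?T (field_rep X d)"
        proof (rule smooth_on_cong[OF T])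
          fix y assume "y \<in> ?T"
          then obtain q where q: "y = cmap d q" "q \<in> cdom d" "q \<in> A" by blast
          then have qc: "c \<in> charts_at M q" "d \<in> charts_at M q" using cA d by
              (auto simp: A_def charts_at_iff)
          have "?\<chi> y = cmap c q" unfolding q(1) using coord_rep_cmap[OF chart[OF d] q(2), of id c] by simp
          then show "\<D> ?\<phi> (?\<chi> y) (Z (?\<chi> y)) = field_rep X d y"
            unfolding q(1) field_rep_cmap[OF qc(2)] by
                (simp add: X_def q(3) coord_vector_def qc coord_deriv_def)
        qed
        moreover have "x \<in> ?T" using True qd q(2) by (metis IntI imageI)
        ultimately show ?thesis using T by blast
      next
        case False
        let ?T = "cmap d ` (cdom d \<inter> (points M - K))"
        have T: "open ?T"
          by (rule topological_chart_open_image[OF chart[OF d]])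
            (use topological_chartD(1)[OF chart[OF d]] KM in \<open>auto simp: closedin_def\<close>)
        have "smooth_on ?T (field_rep X d)"
        proof (rule smooth_on_cong[OF T smooth_on_const[OF T]])
          fix y assume "y \<in> ?T"
          then obtain q where q: "y = cmap d q" "q \<in> cdom d" "q \<notin> K" by blast
          then have "d \<in> charts_at M q" using d by (simp add: charts_at_iff)
          then show "0 = field_rep X d y" by (simp add: q(1) field_rep_cmap X0[OF q(3)])
        qed
        moreover have "?q \<in> points M - K" using False KA charts_at_points[OF q(1)] by blast
        then have "x \<in> ?T" using qd q(2) by (metis IntI imageI)
        ultimately show ?thesis using T by blast
      qed
    qed
  qed
  moreover have "X p c = Y (cmap c p)"
    using c W(2) by (simp add: X_def A_def Z_def \<psi>(2) coord_vector_self charts_at_iff)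
  \<comment> \<open>Cutting off only rescales the local field, so a pointwise linear condition on
    it, such as being vertical, survives the extension.\<close>
  moreover have "q \<in> cdom c \<and> cmap c q \<in> W \<and> (\<exists>a. X q = coord_vector M c q (a *\<^sub>R Y (cmap c q)))"
    if "X q \<noteq> 0" for q
    using that unfolding X_def Z_def A_def by (auto split: if_splits)
  ultimately show ?thesis using that by blast
qed

lemma extend_tangent:
  fixes M :: "('p, 'e::euclidean_space) manifold"
  assumes M: "smooth_manifold M" and v: "v \<in> tangent_space M p" and p: "p \<in> points M"
  obtains X where "vector_field M X" "X p = v"
proof -
  interpret manifold_ctxt M by unfold_locales (rule M)
  obtain c where c: "c \<in> charts_at M p" using charts_at_ex[OF p] by blast
  then have o: "open (cmap c ` cdom c)" using image_open by (simp add: charts_at_iff)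
  obtain X where X: "vector_field M X" "X p c = v c"
    using extend_local_field[OF M c o cmap_in[OF c] subset_refl smooth_on_const[OF o], of "v c"] by metis
  show ?thesis by (rule that[OF X(1) tangent_eqI[OF vector_fieldD(1)[OF X(1)] v c X(2)]])
qed

section \<open>Ricci and scalar curvature as traces over coordinate bases\<close>

lemma orthonormal_basis_card:
  fixes G :: "'a::euclidean_space \<Rightarrow> 'a \<Rightarrow> real"
  assumes "inner_form G" "orthonormal_basis G E"
  shows "card E = DIM('a)"
  using orthonormal_independent[OF assms(1)] assms(2) unfolding orthonormal_basis_def
  by (metis dim_UNIV dim_span_eq_card_independent)

lemma orthonormal_basisI:
  fixes G :: "'a::euclidean_space \<Rightarrow> 'a \<Rightarrow> real"
  assumes "inner_form G" "orthonormal_set G E" "card E = DIM('a)"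
  shows "orthonormal_basis G E"
  using card_ge_dim_independent[OF subset_UNIV orthonormal_independent[OF assms(1,2)]] assms(2,3)
  by (auto simp: orthonormal_basis_def)

abbreviation ricci_trace :: "('a::real_normed_vector \<Rightarrow> 'a \<Rightarrow> 'a \<Rightarrow> real) \<Rightarrow> 'a \<Rightarrow> 'a set \<Rightarrow> 'a \<Rightarrow> 'a \<Rightarrow> real" where
  "ricci_trace G x E u v \<equiv> \<Sum>e\<in>E. G x (coord_curvature (christoffel G) x e u v) e"

abbreviation scalar_trace :: "('a::real_normed_vector \<Rightarrow> 'a \<Rightarrow> 'a \<Rightarrow> real) \<Rightarrow> 'a \<Rightarrow> 'a set \<Rightarrow> real" where
  "scalar_trace G x E \<equiv> \<Sum>e\<in>E. ricci_trace G x E e e"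

locale riemannian_euclidean = riemannian_ctxt M g
  for M :: "('p, 'e::euclidean_space) manifold" and g
begin

text \<open>A witness for the choice in \<open>frame_at\<close>: an orthonormal basis at the point
  has as many elements as \<open>Basis\<close>, can be indexed by it, and each of its vectors
  extends to a global field.\<close>

lemma frame_at_orthonormal:
  assumes p: "p \<in> points M"
  shows "orthonormal_at M g p (frame_at M g p)"
proof -
  obtain c where c: "c \<in> charts_at M p" using charts_at_ex[OF p] by blast
  note form = metric_rep_form[OF c]
  obtain B where B: "orthonormal_basis (metric_rep M g c (cmap c p)) B"
    using orthonormal_basis_ex[OF fd form] .
  have "finite B" using B by (simp add: orthonormal_basis_def orthonormal_set_def)
  then obtain h where h: "bij_betw h (Basis :: 'e set) B"
    using finite_same_card_bij[OF finite_Basis] orthonormal_basis_card[OF form B] by metis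
  have "\<exists>X. vector_field M X \<and> X p = coord_vector M c p (h i)" for i
    using extend_tangent[OF manifold coord_vector_tangent[OF c] p] by metis
  then obtain E where E: "\<And>i. vector_field M (E i)" "\<And>i. E i p = coord_vector M c p (h i)" by metis
  have "orthonormal_at M g p E"
    unfolding orthonormal_at_def
  proof (intro conjI ballI E(1))
    fix i j :: 'e assume ij: "i \<in> Basis" "j \<in> Basis"
    then have "(i = j) = (h i = h j)" "h i \<in> B" "h j \<in> B"
      using h by (auto simp: bij_betw_def inj_on_def)
    then show "g p (E i p) (E j p) = (if i = j then 1 else 0)"
      using B metric_coord[OF c vector_fieldD(1)[OF E(1)] vector_fieldD(1)[OF E(1)], of i j]
      by (simp add: E(2) coord_vector_self[OF c] orthonormal_basis_def orthonormal_set_def)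
  qed
  then show ?thesis unfolding frame_at_def by (rule someI[of "orthonormal_at M g p"])
qed

lemma frame_at_coord:
  assumes c: "c \<in> charts_at M p"
  shows "i \<in> Basis \<Longrightarrow> vector_field M (frame_at M g p i)"
    and "inj_on (\<lambda>i. frame_at M g p i p c) Basis"
    and "orthonormal_basis (metric_rep M g c (cmap c p)) ((\<lambda>i. frame_at M g p i p c) ` Basis)"
proof -
  let ?e = "\<lambda>i. frame_at M g p i p c"
  let ?G = "metric_rep M g c (cmap c p)"
  note o = frame_at_orthonormal[OF charts_at_points[OF c], unfolded orthonormal_at_def]
  have vf: "vector_field M (frame_at M g p i)" if "i \<in> Basis" for i using o that by blast
  then show "i \<in> Basis \<Longrightarrow> vector_field M (frame_at M g p i)" .
  have G: "?G (?e i) (?e j) = (if i = j then 1 else 0)" if "i \<in> Basis" "j \<in> Basis" for i j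
    using o that metric_coord[OF c vector_fieldD(1)[OF vf] vector_fieldD(1)[OF vf], of i j] by simp
  show inj: "inj_on ?e Basis"
  proof (rule inj_onI)
    fix i j :: 'e assume ij: "i \<in> Basis" "j \<in> Basis" "?e i = ?e j"
    show "i = j" using G[OF ij(1,2)] G[OF ij(2,2)] ij(3) by (metis zero_neq_one)
  qed
  have "orthonormal_set ?G (?e ` Basis)"
    unfolding orthonormal_set_def using G inj by (auto simp: inj_on_def)
  then show "orthonormal_basis ?G (?e ` Basis)"
    by (rule orthonormal_basisI[OF metric_rep_form[OF c]]) (simp add: card_image[OF inj])
qed

text \<open>Frees the trace from the chosen frame: any orthonormal basis of the coordinate metric
  may be used, in particular one adapted to the vertical distribution.\<close>

lemma ricci_coord:
  assumes X: "vector_field M X" and Y: "vector_field M Y" and c: "c \<in> charts_at M p"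
    and B: "orthonormal_basis (metric_rep M g c (cmap c p)) B"
  shows "ricci M g X Y p = ricci_trace (metric_rep M g c) (cmap c p) B (X p c) (Y p c)"
proof -
  interpret L: local_metric "cmap c ` cdom c" "metric_rep M g c" by (rule local_metric_at[OF c])
  note x = cmap_in[OF c]
  let ?G = "metric_rep M g c (cmap c p)" and ?e = "\<lambda>i. frame_at M g p i p c"
  let ?R = "coord_curvature (christoffel (metric_rep M g c)) (cmap c p)"
  note fr = frame_at_coord[OF c]
  note f = metric_rep_form[OF c]
  have "ricci M g X Y p = (\<Sum>i\<in>Basis. ?G (?R (?e i) (X p c) (Y p c)) (?e i))"
    unfolding ricci_def Let_def
  proof (rule sum.cong[OF refl])
    fix i :: 'e assume i: "i \<in> Basis"
    show "g p (curvature M g (frame_at M g p i) X Y p) (frame_at M g p i p) = ?G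
        (?R (?e i) (X p c) (Y p c)) (?e i)"
      unfolding metric_coord[OF c vector_fieldD(1)[OF vector_field_curvature[OF fr(1)[OF i] X Y]]
          vector_fieldD(1)[OF fr(1)[OF i]]]
        curvature_coord[OF fr(1)[OF i] X Y c] by (rule refl)
  qed
  also have "\<dots> = (\<Sum>e\<in>?e ` Basis. ?G (?R e (X p c) (Y p c)) e)"
    by (simp add: sum.reindex[OF fr(2)])
  also have "\<dots> = (\<Sum>e\<in>B. ?G (?R e (X p c) (Y p c)) e)"
    by (rule trace_orthonormal[OF f fr(3) B inner_formD(1)[OF f]
          linear_compose[OF L.curvature_linear(1)[OF x] inner_formD(2)[OF f], unfolded o_def]])
  finally show ?thesis .
qed

lemma scalar_curvature_coord:
  assumes c: "c \<in> charts_at M p" and B: "orthonormal_basis (metric_rep M g c (cmap c p)) B"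
  shows "scalar_curvature M g p = scalar_trace (metric_rep M g c) (cmap c p) B"
proof -
  interpret L: local_metric "cmap c ` cdom c" "metric_rep M g c" by (rule local_metric_at[OF c])
  note x = cmap_in[OF c]
  let ?G = "metric_rep M g c (cmap c p)" and ?e = "\<lambda>i. frame_at M g p i p c"
  let ?R = "coord_curvature (christoffel (metric_rep M g c)) (cmap c p)"
  note fr = frame_at_coord[OF c]
  note f = metric_rep_form[OF c]
  let ?F = "?e ` Basis"
  have "scalar_curvature M g p = (\<Sum>i\<in>Basis. \<Sum>e'\<in>?F. ?G (?R e' (?e i) (?e i)) e')"
    unfolding scalar_curvature_def Let_def
    by (rule sum.cong[OF refl]) (rule ricci_coord[OF fr(1) fr(1) c fr(3)])
  also have "\<dots> = (\<Sum>e\<in>?F. \<Sum>e'\<in>?F. ?G (?R e' e e) e')"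
    by (simp add: sum.reindex[OF fr(2)])
  also have "\<dots> = (\<Sum>e\<in>B. \<Sum>e'\<in>B. ?G (?R e' e e) e')"
    by (rule double_trace_orthonormal[OF f fr(3) B L.curvature_linear[OF x]])
  finally show ?thesis .
qed

end

section \<open>Traces of the curvature along a submersion\<close>

text \<open>The mixed terms of the double trace vanish: \<open>R(a, b)a\<close> is vertical, hence
  \<open>G (R(a, b)b, a) = - G (b, R(a, b)a) = 0\<close> for vertical \<open>a\<close> and horizontal \<open>b\<close>.\<close>

lemma curvature_traces_submersion:
  fixes G :: "'m::real_normed_vector \<Rightarrow> 'm \<Rightarrow> real" and G' :: "'k::real_normed_vector \<Rightarrow> 'k \<Rightarrow> real"
    and H :: "'n::real_normed_vector \<Rightarrow> 'n \<Rightarrow> real"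
  assumes fd: "fin_dim TYPE('m)" and G: "inner_form G" and G': "inner_form G'" and H: "inner_form H"
    and i: "linear i" and T: "linear T" and ker: "range i = {v. T v = 0}" and surj: "surj T"
    and iso: "\<And>u v. G' u v = G (i u) (i v)"
    and hor: "\<And>b w. (\<And>k. T k = 0 \<Longrightarrow> G b k = 0) \<Longrightarrow> H (T w) (T b) = G w b"
    and Ri: "\<And>u v w. R (i u) (i v) (i w) = i (R' u v w)"
    and RT: "\<And>u v w. T (R u v w) = RN (T u) (T v) (T w)"
    and RN: "\<And>v w. linear (\<lambda>u. RN u v w)" "\<And>u w. linear (\<lambda>v. RN u v w)" "\<And>u v. linear (\<lambda>w. RN u v w)"
    and skew: "\<And>u v w z. G (R u v w) z = - G w (R u v z)"
    and E': "orthonormal_basis G' E'" and B: "orthonormal_basis H B"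
  obtains E where "orthonormal_basis G E"
    "\<And>u v. (\<Sum>e\<in>E. G (R e (i u) (i v)) e) = (\<Sum>e\<in>E'. G' (R' e u v) e)"
    "(\<Sum>e\<in>E. \<Sum>e'\<in>E. G (R e' e e) e')
      = (\<Sum>e\<in>E'. \<Sum>e'\<in>E'. G' (R' e' e e) e') + (\<Sum>e\<in>B. \<Sum>e'\<in>B. H (RN e' e e) e')"
proof -
  have oE': "orthonormal_set G' E'" "finite E'" "span E' = UNIV"
    using E' by (auto simp: orthonormal_basis_def orthonormal_set_def)
  have Ti: "T (i u) = 0" for u using ker by blast
  have inj: "inj i"
  proof (subst linear_injective_0[OF i], intro allI impI)
    fix u assume "i u = 0"
    then have "G' u u = 0" using iso[of u u] inner_formD(11)[OF G] by simp
    then show "u = 0" using inner_formD(4)[OF G', of u] by force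
  qed
  have inje: "i e = i e' \<longleftrightarrow> e = e'" for e e' using inj by (auto dest: injD)
  have "orthonormal_set G (i ` E')"
    using oE' unfolding orthonormal_set_def by (auto simp: iso[symmetric] inje)
  then obtain E where E: "i ` E' \<subseteq> E" "orthonormal_basis G E" using orthonormal_extend[OF fd G] by metis
  have oE: "orthonormal_set G E" "finite E" "span E = UNIV"
    using E(2) by (auto simp: orthonormal_basis_def orthonormal_set_def)
  define F where "F = E - i ` E'"
  have hF: "G b k = 0" if "b \<in> F" "T k = 0" for b k
  proof -
    have "k \<in> range i" using ker that(2) by simp
    then obtain u where u: "k = i u" by blast
    have "u = (\<Sum>e\<in>E'. G' u e *\<^sub>R e)" by (rule orthonormal_expansion[OF G' oE'(1)]) (simp add: oE'(3))
    then have "G b (i u) = (\<Sum>e\<in>E'. G' u e *\<^sub>R G b (i e))"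
      by (rule linear_coords[OF linear_compose[OF i inner_formD(1)[OF G], unfolded o_def]])
    moreover have "G b (i e) = 0" if "e \<in> E'" for e
    proof -
      have "i e \<in> E" "b \<in> E" "b \<noteq> i e" using E(1) \<open>b \<in> F\<close> that by (auto simp: F_def)
      then show ?thesis using oE(1) unfolding orthonormal_set_def by simp
    qed
    ultimately show ?thesis using u by simp
  qed
  have HF: "H (T w) (T b) = G w b" if "b \<in> F" for w b by (rule hor) (rule hF[OF that])
  have GF: "G b b' = (if b = b' then 1 else 0)" if "b \<in> F" "b' \<in> F" for b b'
    using oE(1) that unfolding orthonormal_set_def F_def by blast
  have injT: "inj_on T F"
  proof (rule inj_onI)
    fix b b' assume b: "b \<in> F" "b' \<in> F" "T b = T b'"
    have "G b b' = G b' b'" using HF[OF b(2), of b] HF[OF b(2), of b'] b(3) by simp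
    then show "b = b'" using GF[OF b(1,2)] GF[OF b(2,2)] by (auto split: if_splits)
  qed
  \<comment> \<open>\<open>T\<close> is isometric on \<open>F\<close> and kills the vertical half of
    \<open>E\<close>, so by surjectivity the image of \<open>F\<close> spans.\<close>
  have TF: "orthonormal_basis H (T ` F)"
    unfolding orthonormal_basis_def
  proof
    show "orthonormal_set H (T ` F)"
      unfolding orthonormal_set_def using HF GF injT oE(2) by (auto simp: F_def inj_on_def)
    have "T w \<in> span (T ` F)" for w
    proof -
      have "w = (\<Sum>e\<in>E. G w e *\<^sub>R e)" by (rule orthonormal_expansion[OF G oE(1)]) (simp add: oE(3))
      then have "T w = (\<Sum>e\<in>E. G w e *\<^sub>R T e)" by (rule linear_coords[OF T])
      moreover have "T e \<in> span (T ` F)" if "e \<in> E" for e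
        using that Ti unfolding F_def by (cases "e \<in> i ` E'") (auto simp: span_zero intro: span_base)
      ultimately show ?thesis by (simp add: span_scale span_sum)
    qed
    then have "range T \<subseteq> span (T ` F)" by blast
    then show "span (T ` F) = UNIV" using surj by (simp add: top.extremum_unique)
  qed
  have split: "(\<Sum>e\<in>E. q e) = (\<Sum>e\<in>E'. q (i e)) + (\<Sum>e\<in>F. q e)" for q :: "'m \<Rightarrow> real"
  proof -
    have "(\<Sum>e\<in>E. q e) = (\<Sum>e\<in>i ` E'. q e) + (\<Sum>e\<in>F. q e)"
      unfolding F_def using sum.subset_diff[OF E(1) oE(2), of q] by simp
    then show ?thesis using inj by (simp add: sum.reindex inj_on_subset)
  qed
  have RN0: "RN u 0 w = 0" "RN 0 v w = 0" for u v w
    using linear_0[OF RN(2)] linear_0[OF RN(1)] by auto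
  \<comment> \<open>Horizontal \<open>b\<close> contribute nothing: \<open>T\<close> maps the
    curvature vector to \<open>RN\<close> with two zero arguments, so the vector is vertical, hence
    orthogonal to \<open>b\<close>.\<close>
  have ric: "(\<Sum>e\<in>E. G (R e (i u) (i v)) e) = (\<Sum>e\<in>E'. G' (R' e u v) e)" for u v
  proof -
    have "G (R b (i u) (i v)) b = 0" if "b \<in> F" for b
      using HF[OF that, of "R b (i u) (i v)"] by (simp add: RT Ti RN0 inner_formD(11)[OF H])
    then show ?thesis unfolding split by (simp add: Ri iso)
  qed
  have mixed: "G (R (i e) b b) (i e) = 0" if "b \<in> F" for b e
  proof -
    have "G b (R (i e) b (i e)) = 0" by (rule hF[OF that]) (simp add: RT Ti RN0)
    then show ?thesis by (simp add: skew)
  qed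
  have "(\<Sum>e\<in>E. \<Sum>e'\<in>E. G (R e' e e) e')
    = (\<Sum>e\<in>E'. \<Sum>e'\<in>E'. G' (R' e' e e) e') + (\<Sum>e\<in>F. \<Sum>e'\<in>F. G (R e' e e) e')"
    unfolding split[of "\<lambda>e. \<Sum>e'\<in>E. G (R e' e e) e'"] ric
    by (simp add: split mixed)
  also have "(\<Sum>e\<in>F. \<Sum>e'\<in>F. G (R e' e e) e') = (\<Sum>e\<in>T ` F. \<Sum>e'\<in>T ` F. H (RN e' e e) e')"
    by (simp add: sum.reindex[OF injT] RT[symmetric] HF cong: sum.cong)
  also have "\<dots> = (\<Sum>e\<in>B. \<Sum>e'\<in>B. H (RN e' e e) e')"
    by (rule double_trace_orthonormal[OF H TF B RN])
  finally show ?thesis using that E(2) ric by blast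
qed

text \<open>Both facts come from splitting \<open>w\<close> into a kernel part and a horizontal
  part: \<open>T\<close> kills the first and preserves products of horizontal vectors, by
  polarisation of the assumed equality of lengths. The inequality says that pulling back
  \<open>H\<close> gives at most \<open>G\<close>.\<close>

lemma horizontal_isometry:
  assumes fd: "fin_dim TYPE('a)" and G: "inner_form (G :: 'a::real_normed_vector \<Rightarrow> 'a \<Rightarrow> real)" and H:
      "inner_form H"
    and T: "linear T" and iso: "\<And>b. (\<And>k. T k = 0 \<Longrightarrow> G b k = 0) \<Longrightarrow> H (T b) (T b) = G b b"
    and b: "\<And>k. T k = 0 \<Longrightarrow> G b k = 0"
  shows "H (T w) (T b) = G w b" "H (T w) (T w) \<le> G w w"
proof -
  have K: "subspace {k. T k = 0}" 
    by (auto simp: subspace_def linear_add[OF T] linear_scale[OF T] linear_0[OF T])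
  have pol: "H (T a) (T b) = G a b" if "\<And>k. T k = 0 \<Longrightarrow> G a k = 0" "\<And>k. T k = 0 \<Longrightarrow> G b k = 0" for a b
  proof -
    have "H (T (a + b)) (T (a + b)) = G (a + b) (a + b)"
      by (rule iso) (simp add: inner_formD(5)[OF G] that)
    then show ?thesis
      using iso[of a] iso[of b] that inner_formD(3)[OF H, of "T a" "T b"] inner_formD(3)[OF G, of a b]
      by (simp add: linear_add[OF T] inner_formD(5,6)[OF G] inner_formD(5,6)[OF H])
  qed
  obtain k a where d: "w = k + a" "k \<in> {k. T k = 0}" "\<And>k'. k' \<in> {k. T k = 0} \<Longrightarrow> G a k' = 0"
      "\<And>k'. k' \<in> {k. T k = 0} \<Longrightarrow> G k' a = 0"
    using orthogonal_decomposition[OF fd G K, of w] by metis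
  have Tk: "T k = 0" using d(2) by simp
  have "G k b = 0" using b[of k] d(2) inner_formD(3)[OF G, of k b] by simp
  then show "H (T w) (T b) = G w b" using pol[of a b] b d(3)
    by (simp add: d(1) linear_add[OF T] Tk inner_formD(5)[OF G])
  have "G w w = G k k + G a a" using d(2-4) by (simp add: d(1) inner_formD(5,6)[OF G])
  then show "H (T w) (T w) \<le> G w w"
    using iso[of a] d(3) inner_form_nonneg[OF G, of k]
    by (simp add: d(1) linear_add[OF T] Tk)
qed

text \<open>On horizontal vectors, \<open>G - f\<^sup>*H\<close> vanishes to first order because it is positive
  semidefinite.\<close>

lemma submersion_affine:
  fixes f :: "'a::real_normed_vector \<Rightarrow> 'b::real_normed_vector"
  assumes "local_metric U G" "local_metric W H" and S: "open S" "S \<subseteq> U" "f ` S \<subseteq> W" "smooth_on S f"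
    and surj: "\<And>x. x \<in> S \<Longrightarrow> surj (\<D> f x)"
    and iso: "\<And>x b. x \<in> S \<Longrightarrow> (\<And>k. \<D> f x k = 0 \<Longrightarrow> G x b k = 0) \<Longrightarrow>
      H (f x) (\<D> f x b) (\<D> f x b) = G x b b"
    and vert: "\<And>x u k. x \<in> S \<Longrightarrow> \<D> f x k = 0 \<Longrightarrow>
      \<D> f x (christoffel G x u k) = second_derivative f x u k"
    and x: "x \<in> S"
  shows "\<D> f x (christoffel G x u v) =
    christoffel H (f x) (\<D> f x u) (\<D> f x v) + second_derivative f x u v"
proof -
  interpret A: local_metric U G by fact
  interpret B: local_metric W H by fact
  have xU: "x \<in> U" and fW: "f x \<in> W" using x S by auto
  let ?T = "\<D> f x" and ?s = "second_derivative f x"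
  define hor where "hor b \<longleftrightarrow> (\<forall>k. ?T k = 0 \<longrightarrow> G x b k = 0)" for b
  have T: "linear ?T" by (rule smooth_on_linear[OF S(4) x])
  note GD = inner_formD[OF A.form[OF xU]] and HD = inner_formD[OF B.form[OF fW]]
  have H0: "H (f x) (?T w) (?T b) = G x w b" if "hor b" for w b
    by (rule horizontal_isometry(1)[OF A.fd A.form[OF xU] B.form[OF fW] T iso[OF x]])
      (use that in \<open>auto simp: hor_def\<close>)
  define Q where "Q y b c = G y b c - H (f y) (\<D> f y b) (\<D> f y c)" for y b c
  define Q' where "Q' b c a = metric_derivative G x a b c -
     (metric_derivative H (f x) (?T a) (?T b) (?T c) + H (f x) (?s a b) (?T c) + H (f x) (?T b)
         (?s a c))" for b c a
  have QD: "((\<lambda>y. Q y b c) has_derivative Q' b c) (at x)" for b c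
    unfolding Q_def Q'_def
    by (intro has_derivative_diff has_derivative_compose_bilinear[OF A.fd assms(2) S(1,3,4) x])
      (unfold metric_derivative_def, rule smooth_onD[OF local_metric.smooth[OF assms(1)] xU])
  \<comment> \<open>The constant vector \<open>b\<close> is horizontal only at \<open>x\<close>. At
    nearby points the defect \<open>Q y b b\<close> is merely nonnegative, but it vanishes at
    \<open>x\<close>, so \<open>x\<close> is a local minimum and the derivative is zero.\<close>
  have Q0: "Q' b b = (\<lambda>_. 0)" if b: "hor b" for b
  proof (rule has_derivative_local_min[OF QD[of b b]])
    have "Q x b b = 0" using H0[OF b, of b] by (simp add: Q_def)
    moreover have "0 \<le> Q y b b" if "y \<in> S" for y
    proof -
      have yU: "y \<in> U" "f y \<in> W" using that S by auto
      show ?thesis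
        using horizontal_isometry(2)[OF A.fd A.form[OF yU(1)] B.form[OF yU(2)]
            smooth_on_linear[OF S(4) that] iso[OF that], of 0 b]
        by (simp add: Q_def inner_formD(11)[OF A.form[OF yU(1)]])
    qed
    moreover have "\<forall>\<^sub>F y in at x. y \<in> S" using S(1) x eventually_at_topological by blast
    ultimately show "\<forall>\<^sub>F y in at x. Q x b b \<le> Q y b b" by (simp add: eventually_mono)
  qed
  \<comment> \<open>Polarisation: twice the defect on \<open>b\<close>, \<open>c\<close> is a
    combination of its values on the squares of \<open>b + c\<close>, \<open>b\<close> and
    \<open>c\<close>, all of which have zero derivative at \<open>x\<close>.\<close>
  have Qpol: "Q' b c a = 0" if "hor b" "hor c" for a b c
  proof -
    have bc: "hor (b + c)" using that by (simp add: hor_def GD)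
    have 1: "((\<lambda>y. Q y (b + c) (b + c) - Q y b b - Q y c c) has_derivative (\<lambda>a. 0 - 0 - 0)) (at x)"
      using has_derivative_diff[OF has_derivative_diff[OF QD[of "b + c" "b + c"] QD[of b b]] QD[of c c]]
      by (simp only: Q0[OF bc] Q0[OF that(1)] Q0[OF that(2)])
    have 2: "((\<lambda>y. 2 *\<^sub>R Q y b c) has_derivative (\<lambda>a. 2 *\<^sub>R Q' b c a)) (at x)"
      by (rule bounded_linear.has_derivative[OF bounded_linear_scaleR_right QD])
    have "(0::real) - 0 - 0 = 2 *\<^sub>R Q' b c a"
    proof (rule has_derivative_unique_open[OF S(1) x 1 2])
      fix y assume y: "y \<in> S"
      then have "y \<in> U" "f y \<in> W" using S by auto
      note G = inner_formD[OF A.form[OF this(1)]] and H = inner_formD[OF B.form[OF this(2)]]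
      show "Q y (b + c) (b + c) - Q y b b - Q y c c = 2 *\<^sub>R Q y b c"
        unfolding Q_def linear_add[OF smooth_on_linear[OF S(4) y]] G(5,6) H(5,6)
        using G(3)[of c b] H(3)[of "\<D> f y c" "\<D> f y b"] by simp
    qed
    then show ?thesis by simp
  qed
  have K: "subspace {k. ?T k = 0}" 
    by (auto simp: subspace_def linear_add[OF T] linear_scale[OF T] linear_0[OF T])
  have dec: "\<exists>k b. w = k + b \<and> ?T k = 0 \<and> hor b" for w
  proof -
    obtain k b where d: "w = k + b" "k \<in> {k. ?T k = 0}" "\<And>k'. k' \<in> {k. ?T k = 0} \<Longrightarrow> G x b k' = 0"
      by (rule orthogonal_decomposition[OF A.fd A.form[OF xU] K, of w]) blast
    then show ?thesis unfolding hor_def by (intro exI[of _ k] exI[of _ b]) simp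
  qed
  \<comment> \<open>By surjectivity every vector \<open>n\<close> of the target is the image of a
    horizontal one, so testing Koszul's formula against horizontal vectors determines the image of
    the symbol.\<close>
  have hh: "?T (christoffel G x b c) = christoffel H (f x) (?T b) (?T c) + ?s b c" if b: "hor b" and c:
      "hor c" for b c
  proof (rule inner_form_eqI[OF B.form[OF fW]])
    fix n
    obtain w0 where w0: "n = ?T w0" using surj[OF x] by (metis surjD)
    obtain k w where w: "w0 = k + w" "?T k = 0" "hor w" using dec by blast
    have n: "n = ?T w" by (simp add: w0 w linear_add[OF T])
    have "G x (christoffel G x b c) w = H (f x) (christoffel H (f x) (?T b) (?T c) + ?s b c) (?T w)"
      by (rule koszul_pullback[where P=hor, OF assms(1,2) xU fW S(1) x S(4) b c w(3)])
        (use Qpol in \<open>simp add: Q'_def\<close>)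
    then show "H (f x) (?T (christoffel G x b c)) n = H (f x)
        (christoffel H (f x) (?T b) (?T c) + ?s b c) n"
      unfolding n using H0[OF w(3)] by simp
  qed
  obtain k b where u: "u = k + b" "?T k = 0" "hor b" using dec by blast
  obtain l c where v: "v = l + c" "?T l = 0" "hor c" using dec by blast
  note lA = linear_add[OF A.lin(1)[OF xU]] linear_add[OF A.lin(2)[OF xU]]
  note ls = linear_add[OF second_derivative_linear(1)[OF S(1) x S(4)]]
      linear_add[OF second_derivative_linear(2)[OF S(1) x S(4)]]
  \<comment> \<open>\<open>vert\<close> has the vertical vector in the second slot; symmetry of the
    symbol and of the second derivative moves it to the first.\<close>
  have kc: "?T (christoffel G x k c) = ?s k c"
    using vert[OF x u(2), of c] A.christoffel_sym[OF xU, of k c]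
        second_derivative_sym[OF S(1) x S(4), of k c] by simp
  show ?thesis
    unfolding u(1) v(1) lA ls linear_add[OF T] vert[OF x v(2)] kc hh[OF u(3) v(3)]
    by (simp add: u(2) v(2))
qed

text \<open>Let Z be the difference of the two sides. It lies in the kernel of the derivative of
  \<open>f\<close>, by \<open>vert\<close> and by differentiating the constant function
  \<open>f (i y)\<close> twice; hence it is tangent to the level set. By Koszul's formula it is
  orthogonal to every tangent vector, in particular to itself. In geometric terms, the level set is
  totally geodesic.\<close>

lemma inclusion_affine:
  fixes i :: "'k::real_normed_vector \<Rightarrow> 'a::real_normed_vector" and f :: "'a \<Rightarrow> 'b::real_normed_vector"
  assumes "local_metric U G" "local_metric O' G'" and O: "open P" "P \<subseteq> O'" "i ` P \<subseteq> S" "smooth_on P i"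
    and S: "open S" "S \<subseteq> U" "smooth_on S f" and const: "\<And>y. y \<in> P \<Longrightarrow> f (i y) = q"
    and iso: "\<And>y b c. y \<in> P \<Longrightarrow> G' y b c = G (i y) (\<D> i y b) (\<D> i y c)"
    and ker: "\<And>y v. y \<in> P \<Longrightarrow> \<D> f (i y) v = 0 \<Longrightarrow> v \<in> range (\<D> i y)"
    and vert: "\<And>x u k. x \<in> S \<Longrightarrow> \<D> f x k = 0 \<Longrightarrow>
      \<D> f x (christoffel G x u k) = second_derivative f x u k"
    and x: "x \<in> P"
  shows "\<D> i x (christoffel G' x u v) =
    christoffel G (i x) (\<D> i x u) (\<D> i x v) + second_derivative i x u v"
proof -
  interpret A: local_metric U G by fact
  interpret B: local_metric O' G' by fact
  let ?D = "\<lambda>y. \<D> i y" and ?f = "\<lambda>y. \<D> f y"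
  have iS: "i y \<in> S" if "y \<in> P" for y using O(3) that by blast
  have xO: "x \<in> O'" and ixU: "i x \<in> U" using x O S by auto
  have iU: "i ` P \<subseteq> U" using O(3) S(2) by blast
  have D0: "?f (i y) (?D y v) = 0" if y: "y \<in> P" for y v
  proof -
    have 1: "((\<lambda>y. f (i y)) has_derivative (\<lambda>v. ?f (i y) (?D y v))) (at y)"
      by (rule has_derivative_compose[OF smooth_onD[OF O(4) y] smooth_onD[OF S(3) iS[OF y]]])
    show ?thesis
      by (rule has_derivative_unique_open[OF O(1) y 1 has_derivative_const[of q]]) (rule const)
  qed
  have dd: "((\<lambda>y. ?D y v) has_derivative (\<lambda>u. second_derivative i x u v)) (at x)" for v
    unfolding second_derivative_def by (rule smooth_onD[OF smooth_on_deriv[OF O(4)] x])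
  \<comment> \<open>The second derivative of the constant function \<open>f (i y)\<close>.\<close>
  have DD0: "second_derivative f (i x) (?D x u) (?D x v) + ?f (i x) (second_derivative i x u v) = 0" for u v
  proof -
    have c: "((\<lambda>y. ?f (i y) w) has_derivative (\<lambda>u. second_derivative f (i x) (?D x u) w)) (at x)" for w
      unfolding second_derivative_def
      by (rule has_derivative_compose[OF smooth_onD[OF O(4) x]
          smooth_onD[OF smooth_on_deriv[OF S(3)] iS[OF x]]])
    have 1: "((\<lambda>y. ?f (i y) (?D y v)) has_derivative
        (\<lambda>u. second_derivative f (i x) (?D x u) (?D x v) + ?f (i x) (second_derivative i x u v))) (at x)"
      by (rule has_derivative_apply[where A="\<lambda>y. ?f (i y)", OF A.fd O(1) x smooth_on_linear[OF S(3) iS]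
          _ dd c])
        (use c in \<open>auto simp: differentiable_def\<close>)
    show ?thesis
      by (rule has_derivative_unique_open[OF O(1) x 1 has_derivative_const[of 0]]) (rule D0)
  qed
  let ?X = "christoffel G (i x) (?D x u) (?D x v) + second_derivative i x u v"
  note fl = smooth_on_linear[OF S(3) iS[OF x]] and Dl = smooth_on_linear[OF O(4) x]
  note GD = inner_formD[OF A.form[OF ixU]]
  have "?f (i x) ?X = 0"
    unfolding linear_add[OF fl] vert[OF iS[OF x] D0[OF x]] by (rule DD0)
  then have "?f (i x) (?X - ?D x (christoffel G' x u v)) = 0"
    by (simp only: linear_diff[OF fl] D0[OF x] diff_0_right)
  \<comment> \<open>Being tangent, the difference is the image of some \<open>z\<close>, which can
    now be used as the test vector in Koszul's formula.\<close>
  then obtain z where z: "?X - ?D x (christoffel G' x u v) = ?D x z" using ker[OF x] by blast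
  have "G' x (christoffel G' x u v) z = G (i x) ?X (?D x z)"
    by (rule koszul_pullback[where P="\<lambda>_. True", OF assms(2,1) xO ixU O(1) x O(4) TrueI TrueI TrueI
          isometry_metric_derivative[OF assms(2,1) O(1,2) iU O(4) iso x]])
  then have "G (i x) (?X - ?D x (christoffel G' x u v)) (?D x z) = 0"
    unfolding GD(7) by (simp add: iso[OF x])
  then have "?D x z = 0" unfolding z using GD(4)[of "?D x z"] by force
  then show "?D x (christoffel G' x u v) = ?X" using z by simp
qed

section \<open>The fibers of a submersion\<close>

lemma fin_dim_subspace_full:
  fixes S :: "'a::real_normed_vector set"
  assumes fd: "fin_dim TYPE('a)" and S: "subspace S" "dim S = dim (UNIV :: 'a set)"
  shows "S = UNIV"
proof -
  obtain B :: "'a set" where B: "finite B" "span B = UNIV" using fd unfolding fin_dim_def by blast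
  obtain C where C: "C \<subseteq> S" "independent C" "S \<subseteq> span C" "card C = dim S" using basis_exists by blast
  obtain D :: "'a set" where D: "independent D" "UNIV \<subseteq> span D" "card D = dim (UNIV :: 'a set)"
    using basis_exists[of UNIV] by metis
  have fin: "finite A" if "independent A" for A :: "'a set"
    using independent_span_bound[OF B(1) that] B(2) by simp
  have "x \<in> S" for x
  proof (rule ccontr)
    assume "x \<notin> S"
    then have x: "x \<notin> span C" using span_minimal[OF C(1) S(1)] by blast
    then have "independent (insert x C)" using C(2) by (simp add: independent_insert)
    then have "card (insert x C) \<le> card D"
      using independent_span_bound[OF fin[OF D(1)]] D(2) by (metis subset_UNIV top.extremum_uniqueI)
    moreover have "x \<notin> C" using x span_base by blast
    ultimately show False using fin[OF C(2)] C(4) D(3) S(2) by simp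
  qed
  then show ?thesis by blast
qed

text \<open>Rank and nullity. The Euclidean complement of the kernel is mapped bijectively onto the
  target, so only the domain has to carry an inner product.\<close>

lemma dim_kernel:
  fixes D :: "'a::euclidean_space \<Rightarrow> 'b::real_normed_vector"
  assumes D: "linear D" "surj D"
  shows "dim {x. D x = 0} + dim (UNIV :: 'b set) = DIM('a)"
proof -
  let ?K = "{x. D x = 0}" and ?P = "{y \<in> UNIV. \<forall>x\<in>{x. D x = 0}. orthogonal x y}"
  have K: "subspace ?K" by (auto simp: subspace_def linear_add[OF D(1)] linear_scale[OF D(1)]
      linear_0[OF D(1)])
  have P: "subspace ?P" by (auto simp: subspace_def orthogonal_clauses)
  have i: "inner_form ((\<bullet>) :: 'a \<Rightarrow> 'a \<Rightarrow> real)"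
    by (auto simp: inner_form_def inner_commute intro!: linearI simp: inner_add_right)
  have "D ` ?P = UNIV"
  proof -
    have "\<exists>y\<in>?P. n = D y" for n
    proof -
      obtain w where w: "n = D w" using D(2) by (metis surjD)
      obtain k b where d: "w = k + b" "k \<in> ?K" "\<And>k'. k' \<in> ?K \<Longrightarrow> b \<bullet> k' = 0"
        by (rule orthogonal_decomposition[OF fin_dim_euclidean i K, of w]) blast
      have "b \<in> ?P" using d(3) by (auto simp: orthogonal_def inner_commute)
      moreover have "n = D b" using d(1,2) by (simp add: w linear_add[OF D(1)])
      ultimately show ?thesis by blast
    qed
    then show ?thesis by blast
  qed
  moreover have "inj_on D ?P"
  proof (subst linear_injective_on_subspace_0[OF D(1) P], intro ballI impI)
    fix x assume "x \<in> ?P" "D x = 0"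
    then have "orthogonal x x" by blast
    then show "x = 0" by (simp add: orthogonal_self)
  qed
  then have "dim (D ` ?P) = dim ?P"
    by (intro eucl.dim_image_eq D(1)) (simp only: span_eq_iff[THEN iffD2, OF P])
  ultimately have "dim ?P = dim (UNIV :: 'b set)" by simp
  then show ?thesis
    using dim_subspace_orthogonal_to_vectors[OF K subspace_UNIV subset_UNIV] by simp
qed

text \<open>The part of the setting without metrics, sufficient to make the fiber a manifold.
  \<open>dim_less\<close> ensures that the subtraction of natural numbers in \<open>dim_F\<close> is
  not truncated.\<close>

locale submersion_fiber = smooth_map_ctxt M N \<pi>
  for M :: "('p, 'm::euclidean_space) manifold" and N :: "('q, 'n::real_normed_vector) manifold"
    and \<pi> :: "'p \<Rightarrow> 'q" +
  fixes F :: "('p, 'k::euclidean_space) manifold" and q :: 'q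
  assumes rank: "p \<in> points M \<Longrightarrow> c \<in> charts_at M p \<Longrightarrow> d \<in> charts_at N (\<pi> p) \<Longrightarrow>
      dim (range (coord_deriv \<pi> c d p)) = dimension N"
    and F: "F = fiber M \<pi> q" and dim_F: "dimension F = dimension M - dimension N"
    and dim_less: "dimension N < dimension M"
begin

lemma surj_deriv:
  assumes "c \<in> charts_at M p" "d \<in> charts_at N (\<pi> p)"
  shows "surj (coord_deriv \<pi> c d p)"
proof (rule fin_dim_subspace_full[OF N.fd])
  show "subspace (range (coord_deriv \<pi> c d p))"
    by (rule linear_subspace_image[OF coord_deriv_linear[OF assms] subspace_UNIV])
  show "dim (range (coord_deriv \<pi> c d p)) = dim (UNIV :: 'n set)"
    using rank[OF M.charts_at_points[OF assms(1)] assms] by (simp add: dimension_def)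
qed

lemma dim_vertical:
  assumes "c \<in> charts_at M p" "d \<in> charts_at N (\<pi> p)"
  shows "dim {x. coord_deriv \<pi> c d p x = 0} = DIM('k)"
  using dim_kernel[OF coord_deriv_linear[OF assms] surj_deriv[OF assms]] dim_F dim_less
  by (simp add: dimension_def)

text \<open>With a right inverse \<open>S\<close> of the derivative \<open>D\<close> of \<open>f\<close> at a point, the map
  \<open>x + S (f x - D x)\<close> is a local diffeomorphism that transforms \<open>f\<close> into the linear map \<open>D\<close>.\<close>

lemma straighten:
  assumes c: "c \<in> charts_at M p" and d: "d \<in> charts_at N (\<pi> p)"
  obtains S \<Phi> \<Psi> U' V' where "bounded_linear S" "\<And>y. coord_deriv \<pi> c d p (S y) = y"
    "\<And>x. \<Phi> x = x + S (coord_rep \<pi> c d x - coord_deriv \<pi> c d p x)"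
    "open U'" "cmap c p \<in> U'" "U' \<subseteq> coord_domain c d" "open V'" "homeomorphism U' V' \<Phi> \<Psi>"
    "smooth_on V' \<Psi>" "smooth_on U' \<Phi>" "\<And>x. x \<in> U' \<Longrightarrow> inj (\<D> \<Phi> x)"
    "\<And>x. coord_deriv \<pi> c d p (\<Phi> x) = coord_rep \<pi> c d x"
    "\<And>x u. x \<in> U' \<Longrightarrow> coord_deriv \<pi> c d p (\<D> \<Phi> x u) = \<D> (coord_rep \<pi> c d) x u"
    "\<And>u. \<D> \<Phi> (cmap c p) u = u"
proof -
  have cd: "c \<in> atlas M" "d \<in> atlas N" using c d by (auto simp: M.charts_at_iff N.charts_at_iff)
  define f where "f = coord_rep \<pi> c d"
  define D where "D = coord_deriv \<pi> c d p"
  let ?S0 = "coord_domain c d"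
  have S0: "open ?S0" "cmap c p \<in> ?S0" "smooth_on ?S0 f"
    using domain_open[OF cd] cmap_in_domain[OF c d] coord_smooth[OF cd] by (auto simp: f_def)
  have D: "linear D" "surj D" using coord_deriv_linear[OF c d] surj_deriv[OF c d] by (auto simp: D_def)
  have bD: "bounded_linear D" using fin_dim_bounded_linear[OF M.fd D(1)] .
  have Df: "D = \<D> f (cmap c p)" by (simp add: D_def f_def coord_deriv_def)
  obtain S where S: "linear S" "D \<circ> S = id" using linear_surjective_right_inverse[OF D] by blast
  have DS: "D (S y) = y" for y using S(2) by (metis comp_apply id_apply)
  have bS: "bounded_linear S" by (rule fin_dim_bounded_linear[OF N.fd S(1)])
  define \<Phi> where "\<Phi> x = x + S (f x - D x)" for x
  have sm: "smooth_on ?S0 \<Phi>"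
    unfolding \<Phi>_def by (intro smooth_on_add smooth_on_bounded_linear_comp[OF _ bS] smooth_on_diff S0
        smooth_on_bounded_linear bD bounded_linear_ident)
  have d\<Phi>: "\<D> \<Phi> x = (\<lambda>u. u + S (\<D> f x u - D u))" if "x \<in> ?S0" for x
    unfolding \<Phi>_def
    by (intro frechet_derivative_eq has_derivative_add has_derivative_ident
        bounded_linear.has_derivative[OF bS]
        has_derivative_diff smooth_onD[OF S0(3) that] bounded_linear_imp_has_derivative[OF bD])
  have d0: "\<D> \<Phi> (cmap c p) u = u" for u
    by (simp add: d\<Phi>[OF S0(2)] Df linear_0[OF S(1)])
  then have "inj (\<D> \<Phi> (cmap c p))" by (simp add: inj_def)
  then obtain U' V' \<Psi> where uv: "open U'" "U' \<subseteq> ?S0" "cmap c p \<in> U'" "open V'" "homeomorphism U' V' \<Phi> \<Psi>"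
    "smooth_on V' \<Psi>" "\<And>x. x \<in> U' \<Longrightarrow> inj (\<D> \<Phi> x)"
    using smooth_inverse_function[OF S0(1) sm S0(2)] by blast
  have 1: "D (\<Phi> x) = f x" for x by (simp add: \<Phi>_def linear_add[OF D(1)] linear_diff[OF D(1)] DS)
  have 2: "D (\<D> \<Phi> x u) = \<D> f x u" if "x \<in> U'" for x u
  proof -
    have "x \<in> ?S0" using that uv(2) by blast
    then show ?thesis by (simp add: d\<Phi> linear_add[OF D(1)] linear_diff[OF D(1)] DS)
  qed
  show ?thesis
    by (rule that[of S \<Phi> U' V' \<Psi>, folded f_def D_def])
      (use bS DS \<Phi>_def uv 1 2 d0 smooth_on_subset[OF sm uv(2)] in auto)
qed

abbreviation fiber_top :: "'p topology" where
  "fiber_top \<equiv> subtopology (mtop M) {p. \<pi> p = q}"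

lemma fiber_points: "p \<in> points F \<longleftrightarrow> p \<in> points M \<and> \<pi> p = q"
  by (simp add: F fiber_def Let_def)

lemma fiber_mtop: "mtop F = fiber_top"
  by (simp add: F fiber_def Let_def)

lemma fiber_atlas: "c \<in> atlas F \<longleftrightarrow> topological_chart fiber_top c \<and>
    (\<forall>d\<in>atlas M. smooth_on (cmap c ` (cdom c \<inter> cdom d)) (coord_rep id c d) \<and>
      (\<forall>p\<in>cdom c \<inter> cdom d. inj (coord_deriv id c d p)))"
  by (simp add: F fiber_def Let_def)

lemma fiber_chart_openin:
  assumes "topological_chart fiber_top c" "openin (mtop M) A"
  shows "openin fiber_top (cdom c \<inter> A)"
proof -
  have "openin fiber_top ({p. \<pi> p = q} \<inter> A)" using assms(2) by (auto simp: openin_subtopology)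
  then have "openin fiber_top (cdom c \<inter> ({p. \<pi> p = q} \<inter> A))"
    using topological_chartD(1)[OF assms(1)] by blast
  moreover have "cdom c \<inter> ({p. \<pi> p = q} \<inter> A) = cdom c \<inter> A"
    using topological_chartD(2)[OF assms(1)] by auto
  ultimately show ?thesis by simp
qed

text \<open>In the straightened coordinates \<Phi> the fiber is an open part of the affine subspace
  \<open>S a + ?K\<close>, where \<open>?K\<close> is the kernel of \<open>?D\<close> and
  \<open>a\<close> represents \<open>q\<close>. Identifying \<open>?K\<close> with the model space
  \<open>'k\<close> gives the slice chart \<kappa>, with inverse \<rho>.\<close>

lemma fiber_chart_exists:
  assumes p: "p \<in> points F"
  shows "\<exists>e\<in>atlas F. p \<in> cdom e"
proof -
  have pM: "p \<in> points M" and q: "\<pi> p = q" using p by (auto simp: fiber_points)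
  obtain c where c: "c \<in> charts_at M p" using M.charts_at_ex[OF pM] by blast
  obtain d where d: "d \<in> charts_at N (\<pi> p)" using N.charts_at_ex[OF maps_points[OF pM]] by blast
  have cd: "c \<in> atlas M" "d \<in> atlas N" using c d by (auto simp: M.charts_at_iff N.charts_at_iff)
  note ch = M.chart[OF cd(1)] and dh = N.chart[OF cd(2)]
  let ?D = "coord_deriv \<pi> c d p" and ?f = "coord_rep \<pi> c d"
  obtain S \<Phi> \<Psi> U' V' where S: "bounded_linear S" "\<And>y. ?D (S y) = y"
    and \<Phi>: "\<And>x. \<Phi> x = x + S (?f x - ?D x)"
    and U': "open U'" "cmap c p \<in> U'" "U' \<subseteq> coord_domain c d" and V': "open V'"
    and hom: "homeomorphism U' V' \<Phi> \<Psi>" and sm: "smooth_on V' \<Psi>" "smooth_on U' \<Phi>"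
    and D\<Phi>: "\<And>x. ?D (\<Phi> x) = ?f x"
    using straighten[OF c d] by metis
  note h = hom[unfolded homeomorphism_def]
  have D: "linear ?D" by (rule coord_deriv_linear[OF c d])
  let ?K = "{x. ?D x = 0}"
  have K: "subspace ?K" by (auto simp: subspace_def linear_add[OF D] linear_scale[OF D] linear_0[OF D])
  \<comment> \<open>\<open>J\<close> exists because the model space of the fiber has the dimension
    of the kernel; this is where the assumption on \<open>dimension F\<close> enters.\<close>
  obtain J :: "'k \<Rightarrow> 'm" and L where J: "linear J" "linear L" "J ` UNIV = ?K" "\<And>x. x \<in> UNIV \<Longrightarrow> L (J x) = x"
    "\<And>x. x \<in> ?K \<Longrightarrow> J (L x) = x"
    by (rule isometries_subspaces[OF subspace_UNIV K, where 'a='k]) (auto simp: dim_vertical[OF c d])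
  have bJ: "bounded_linear J" and bL: "bounded_linear L"
    using fin_dim_bounded_linear[OF fin_dim_euclidean] J(1,2) by auto
  have DJ: "?D (J k) = 0" for k using J(3) by blast
  define a where "a = cmap d q"
  have dq: "d \<in> charts_at N q" using d q by simp
  define A where "A = {p \<in> cdom c. cmap c p \<in> U'}"
  have AM: "openin (mtop M) A" unfolding A_def by (rule topological_chart_open_preimage[OF ch U'(1)])
  define P where "P = {p. \<pi> p = q} \<inter> A"
  \<comment> \<open>On the fiber \<open>?D\<close> sends both \<open>\<Phi> (cmap c p)\<close> and
    \<open>S a\<close> to \<open>a\<close>, so the difference lies in the kernel, where
    \<open>L\<close> inverts \<open>J\<close>.\<close>
  define \<kappa> where "\<kappa> p = L (\<Phi> (cmap c p) - S a)" for p
  define \<rho> where "\<rho> k = cinv c (\<Psi> (J k + S a))" for k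
  have fx: "?f (cmap c p) = a" if "p \<in> P" for p
    using coord_rep_cmap[OF ch, of p \<pi> d] that by (simp add: P_def A_def a_def)
  have J\<kappa>: "J (\<kappa> p) + S a = \<Phi> (cmap c p)" if "p \<in> P" for p
  proof -
    have "?D (\<Phi> (cmap c p) - S a) = 0" by (simp add: linear_diff[OF D] D\<Phi> fx[OF that] S(2))
    then show ?thesis unfolding \<kappa>_def using J(5) by simp
  qed
  have \<kappa>V: "J (\<kappa> p) + S a \<in> V'" "\<rho> (\<kappa> p) = p" if "p \<in> P" for p
  proof -
    have x: "cmap c p \<in> U'" "p \<in> cdom c" using that by (auto simp: P_def A_def)
    show "J (\<kappa> p) + S a \<in> V'" unfolding J\<kappa>[OF that] using h x by blast
    show "\<rho> (\<kappa> p) = p" unfolding \<rho>_def J\<kappa>[OF that] using h x topological_chartD(5)[OF ch x(2)] by simp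
  qed
  have \<rho>P: "\<rho> k \<in> P" "\<kappa> (\<rho> k) = k" "cmap c (\<rho> k) = \<Psi> (J k + S a)" if k: "J k + S a \<in> V'" for k
  proof -
    let ?x = "\<Psi> (J k + S a)"
    have x: "?x \<in> U'" "\<Phi> ?x = J k + S a" using h k by auto
    have xc: "?x \<in> cmap c ` cdom c" and xd: "?x \<in> coord_domain c d" using x(1) U'(3) by auto
    note i = topological_chartD(6,7)[OF ch xc]
    obtain p' where p': "?x = cmap c p'" "p' \<in> cdom c" "\<pi> p' \<in> cdom d" using xd by auto
    have \<rho>: "\<rho> k = p'" unfolding \<rho>_def p'(1) by (rule topological_chartD(5)[OF ch p'(2)])
    have fa: "?f ?x = a" using D\<Phi>[of ?x] by (simp add: x(2) linear_add[OF D] DJ S(2))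
    have "cmap d (\<pi> p') = cmap d q"
      using fa[unfolded p'(1)] a_def coord_rep_cmap[OF ch p'(2), of \<pi> d] by simp
    then have "\<pi> p' = q"
      using topological_chartD(4)[OF dh] p'(3) dq by (simp add: inj_on_def N.charts_at_iff)
    then show "\<rho> k \<in> P" unfolding \<rho> P_def A_def using p' x(1) by auto
    show "cmap c (\<rho> k) = ?x" unfolding \<rho> p'(1) by (rule refl)
    then show "\<kappa> (\<rho> k) = k" unfolding \<kappa>_def by (simp add: x(2) J(4))
  qed
  have img: "\<kappa> ` P = {k. J k + S a \<in> V'}" using \<kappa>V(1) \<rho>P(1,2) by force
  have sJ: "smooth_on UNIV (\<lambda>k. J k + S a)"
    by (intro smooth_on_add smooth_on_bounded_linear bJ smooth_on_const open_UNIV)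
  have oimg: "open (\<kappa> ` P)"
  proof -
    have "open ((\<lambda>k. J k + S a) -` V')"
      by (rule open_vimage[OF V' smooth_on_continuous[OF sJ]])
    then show ?thesis unfolding img by (simp add: vimage_def)
  qed
  have PX: "openin fiber_top P" unfolding P_def using AM by (auto simp: openin_subtopology)
  have subt: "subtopology fiber_top P = subtopology (mtop M) P"
    by (simp add: subtopology_subtopology P_def Int_absorb1 inf_assoc[symmetric])
  have PM: "P \<subseteq> points M" using openin_subset[OF AM] by (auto simp: P_def)
  let ?e = "(P, \<kappa>)"
  have "homeomorphic_maps (subtopology (mtop M) P) (top_of_set (\<kappa> ` P)) \<kappa> \<rho>"
    unfolding homeomorphic_maps_def
  proof (intro conjI ballI)
    have 1: "continuous_map (subtopology (mtop M) P) euclidean (cmap c)"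
      by (rule continuous_map_from_subtopology_mono[OF topological_chart_continuous(1)[OF ch]])
        (auto simp: P_def A_def)
    have 2: "continuous_map (subtopology (mtop M) P) (top_of_set U') (cmap c)"
      using 1 PM by (auto simp: continuous_map_in_subtopology P_def A_def)
    have "continuous_on U' (\<lambda>x. L (\<Phi> x - S a))"
      by (intro bounded_linear.continuous_on[OF bL] continuous_intros smooth_on_continuous[OF sm(2)])
    then have "continuous_map (subtopology (mtop M) P) euclidean ((\<lambda>x. L (\<Phi> x - S a)) \<circ> cmap c)"
      by (intro continuous_map_compose[OF 2]) simp
    then have "continuous_map (subtopology (mtop M) P) euclidean \<kappa>"
      by (simp add: \<kappa>_def[abs_def] o_def)
    then show "continuous_map (subtopology (mtop M) P) (top_of_set (\<kappa> ` P)) \<kappa>"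
      using PM by (auto simp: continuous_map_in_subtopology)
    have 3: "continuous_on (\<kappa> ` P) (\<lambda>k. \<Psi> (J k + S a))"
      by (rule continuous_on_compose2[OF smooth_on_continuous[OF sm(1)]
          continuous_on_subset[OF smooth_on_continuous[OF sJ]]])
        (auto simp: img)
    have 4: "continuous_map (top_of_set (\<kappa> ` P)) (top_of_set (cmap c ` cdom c)) (\<lambda>k. \<Psi> (J k + S a))"
    proof -
      have "\<Psi> (J k + S a) \<in> cmap c ` cdom c" if "k \<in> \<kappa> ` P" for k
      proof -
        have "\<Psi> (J k + S a) \<in> U'" using that h unfolding img by blast
        then show ?thesis using U'(3) by blast
      qed
      then show ?thesis using 3 by (auto simp: continuous_map_in_subtopology)
    qed
    have "continuous_map (top_of_set (\<kappa> ` P)) (mtop M) \<rho>"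
      using continuous_map_compose[OF 4 topological_chart_continuous(2)[OF ch]] by
          (simp add: \<rho>_def[abs_def] o_def)
    then show "continuous_map (top_of_set (\<kappa> ` P)) (subtopology (mtop M) P) \<rho>"
      using \<rho>P(1) by (auto simp: continuous_map_in_subtopology img)
    show "\<rho> (\<kappa> x) = x" if "x \<in> topspace (subtopology (mtop M) P)" for x
      using \<kappa>V(2) that by simp
    show "\<kappa> (\<rho> y) = y" if "y \<in> topspace (top_of_set (\<kappa> ` P))" for y
      using \<rho>P(2) that by (simp add: img)
  qed
  then have tc: "topological_chart fiber_top ?e"
    unfolding topological_chart_def using PX oimg homeomorphic_map_maps by (auto simp: subt)
  have ce: "cinv ?e k = \<rho> k" if "k \<in> \<kappa> ` P" for k
    using topological_chartD(5)[OF tc] \<kappa>V(2) that by auto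
  have "?e \<in> atlas F"
    unfolding fiber_atlas
  proof (rule conjI[OF tc], rule ballI, rule conjI)
    fix d' assume d': "d' \<in> atlas M"
    let ?O = "\<kappa> ` (P \<inter> cdom d')"
    have O: "open ?O"
      using topological_chart_open_image[OF tc fiber_chart_openin[OF tc
          topological_chartD(1)[OF M.chart[OF d']]]] by simp
    have maps: "(\<lambda>k. \<Psi> (J k + S a)) ` ?O \<subseteq> M.Id.coord_domain c d'"
      using \<rho>P(3) \<kappa>V by (auto simp: P_def A_def img) (metis (no_types, lifting) IntI imageI)
    have s1: "smooth_on ?O (\<lambda>k. \<Psi> (J k + S a))"
      by (rule smooth_on_compose[OF fin_dim_euclidean O V' _ smooth_on_subset[OF sJ] sm(1)])
        (use \<kappa>V(1) in auto)
    have s2: "smooth_on ?O (\<lambda>k. coord_rep id c d' (\<Psi> (J k + S a)))"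
      by (rule smooth_on_compose[OF fin_dim_euclidean O M.Id.domain_open[OF cd(1) d'] maps s1
          M.Id.coord_smooth[OF cd(1) d']])
    have eq: "coord_rep id c d' (\<Psi> (J k + S a)) = coord_rep id ?e d' k" if "k \<in> ?O" for k
    proof -
      have k: "k \<in> \<kappa> ` P" using that by blast
      show ?thesis
        unfolding coord_rep_def o_apply ce[OF k] \<rho>_def by (rule refl)
    qed
    show "smooth_on (cmap ?e ` (cdom ?e \<inter> cdom d')) (coord_rep id ?e d')"
      using smooth_on_cong[OF O s2 eq] by simp
    show "\<forall>p\<in>cdom ?e \<inter> cdom d'. inj (coord_deriv id ?e d' p)"
    proof
      fix p assume "p \<in> cdom ?e \<inter> cdom d'"
      then have p: "p \<in> P" "p \<in> cdom d'" by auto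
      then have pc: "c \<in> charts_at M p" "d' \<in> charts_at M p"
        using cd d' by (auto simp: M.charts_at_iff P_def A_def)
      let ?k = "\<kappa> p" and ?y = "J (\<kappa> p) + S a"
      have yV: "?y \<in> V'" by (rule \<kappa>V(1)[OF p(1)])
      have \<Psi>y: "\<Psi> ?y = cmap c p" using \<rho>P(3)[OF yV] \<kappa>V(2)[OF p(1)] by simp
      have xU: "cmap c p \<in> U'" using p(1) by (simp add: P_def A_def)
      have dJ: "((\<lambda>k. J k + S a) has_derivative J) (at ?k)"
        using has_derivative_add_const[OF bounded_linear_imp_has_derivative[OF bJ]] .
      have d\<Psi>: "((\<lambda>k. \<Psi> (J k + S a)) has_derivative (\<lambda>u. \<D> \<Psi> ?y (J u))) (at ?k)"
        by (rule has_derivative_compose[OF dJ smooth_onD[OF sm(1) yV]])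
      have "((\<lambda>k. coord_rep id c d' (\<Psi> (J k + S a))) has_derivative
          (\<lambda>u. coord_deriv id c d' p (\<D> \<Psi> ?y (J u)))) (at ?k)"
        using has_derivative_compose[OF d\<Psi>, of "coord_rep id c d'"] M.Id.coord_deriv[OF pc(1), of d'] pc(2)
        by (simp add: \<Psi>y)
      then have "(coord_rep id ?e d' has_derivative
          (\<lambda>u. coord_deriv id c d' p (\<D> \<Psi> ?y (J u)))) (at ?k)"
        by (rule has_derivative_transform_within_open[OF _ O]) (use p eq in auto)
      then have cd_eq: "coord_deriv id ?e d' p = (\<lambda>u. coord_deriv id c d' p (\<D> \<Psi> ?y (J u)))"
        unfolding coord_deriv_def[of id ?e] by (simp add: frechet_derivative_eq)
      \<comment> \<open>The derivative of \<Psi> is injective because it has the derivative of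
        \<Phi> as a left inverse; with injective \<open>J\<close> and an invertible transition map
        the slice chart is an immersion.\<close>
      have dd: "\<D> \<Phi> (cmap c p) (\<D> \<Psi> ?y u) = u" for u
      proof -
        have 1: "((\<lambda>y. \<Phi> (\<Psi> y)) has_derivative (\<lambda>u. \<D> \<Phi> (cmap c p) (\<D> \<Psi> ?y u))) (at ?y)"
          using has_derivative_compose[OF smooth_onD[OF sm(1) yV], of \<Phi>] smooth_onD[OF sm(2) xU] by
              (simp add: \<Psi>y)
        show ?thesis
          by (rule has_derivative_unique_open[OF V' yV 1 has_derivative_ident]) (use h in blast)
      qed
      show "inj (coord_deriv id ?e d' p)"
      proof (rule injI)
        fix u v assume "coord_deriv id ?e d' p u = coord_deriv id ?e d' p v"
        then have "\<D> \<Psi> ?y (J u) = \<D> \<Psi> ?y (J v)"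
          unfolding cd_eq using M.coord_deriv_id_inverse[OF pc] by metis
        then have "J u = J v" using dd by metis
        then show "u = v" using J(4) by (metis UNIV_I)
      qed
    qed
  qed
  moreover have "p \<in> P" using U'(2) c q by (simp add: P_def A_def M.charts_at_iff)
  ultimately show ?thesis by force
qed

end

section \<open>The smooth structure of the fiber\<close>

context submersion_fiber
begin

lemma fiber_chartD:
  assumes "c \<in> atlas F" "e \<in> atlas M"
  shows "open (cmap c ` (cdom c \<inter> cdom e))" "smooth_on (cmap c ` (cdom c \<inter> cdom e)) (coord_rep id c e)"
    "p \<in> cdom c \<Longrightarrow> p \<in> cdom e \<Longrightarrow> inj (coord_deriv id c e p)"
proof -
  have tc: "topological_chart fiber_top c" using assms(1) by (simp add: fiber_atlas)
  show "open (cmap c ` (cdom c \<inter> cdom e))"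
    by (rule topological_chart_open_image[OF tc fiber_chart_openin[OF tc
        topological_chartD(1)[OF M.chart[OF assms(2)]]]]) simp
  show "smooth_on (cmap c ` (cdom c \<inter> cdom e)) (coord_rep id c e)"
    "p \<in> cdom c \<Longrightarrow> p \<in> cdom e \<Longrightarrow> inj (coord_deriv id c e p)"
    using assms unfolding fiber_atlas by blast+
qed

text \<open>A left inverse of the derivative of an immersion turns the immersion into a local diffeomorphism,
  which expresses one fiber chart smoothly through the other.\<close>

lemma fiber_transition_smooth:
  assumes c: "c \<in> atlas F" and d: "d \<in> atlas F"
  shows "smooth_on (cmap c ` (cdom c \<inter> cdom d)) (coord_rep id c d)"
proof -
  have tc: "topological_chart fiber_top c" and td: "topological_chart fiber_top d"
    using c d by (auto simp: fiber_atlas)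
  have o: "open (cmap c ` (cdom c \<inter> cdom d))"
    by (rule topological_chart_open_image[OF tc])
      (use topological_chartD(1)[OF tc] topological_chartD(1)[OF td] in auto)
  show ?thesis
  proof (rule smooth_on_local[OF o])
    fix x assume "x \<in> cmap c ` (cdom c \<inter> cdom d)"
    then obtain p where p: "x = cmap c p" "p \<in> cdom c" "p \<in> cdom d" by blast
    have "p \<in> points M" using topological_chartD(2)[OF tc] p(2) by auto
    then obtain e where e: "e \<in> charts_at M p" using M.charts_at_ex by blast
    then have eA: "e \<in> atlas M" "p \<in> cdom e" by (auto simp: M.charts_at_iff)
    let ?D = "cmap d ` (cdom d \<inter> cdom e)"
    note fd = fiber_chartD[OF d eA(1)] and fc = fiber_chartD[OF c eA(1)]
    have z: "cmap d p \<in> ?D" using p(3) eA(2) by blast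
    have der: "(coord_rep id d e has_derivative coord_deriv id d e p) (at (cmap d p))"
      unfolding coord_deriv_def by (rule smooth_onD[OF fd(2) z])
    obtain L where L: "bounded_linear L" "\<And>u. L (coord_deriv id d e p u) = u"
      using linear_left_inverse[OF fin_dim_euclidean has_derivative_linear[OF der] fd(3)[OF p(3) eA(2)]]
          by metis
    have sm: "smooth_on ?D (\<lambda>y. L (coord_rep id d e y))" by
        (rule smooth_on_bounded_linear_comp[OF fd(1) L(1) fd(2)])
    have "\<D> (\<lambda>y. L (coord_rep id d e y)) (cmap d p) = (\<lambda>u. u)"
      using frechet_derivative_eq[OF bounded_linear.has_derivative[OF L(1) der]] by (simp add: L(2))
    then have inj: "inj (\<D> (\<lambda>y. L (coord_rep id d e y)) (cmap d p))" by (simp add: inj_def)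
    obtain U' V' h where uv: "open U'" "U' \<subseteq> ?D" "cmap d p \<in> U'" "open V'"
      "homeomorphism U' V' (\<lambda>y. L (coord_rep id d e y)) h" "smooth_on V' h"
      "\<And>x. x \<in> U' \<Longrightarrow> inj (\<D> (\<lambda>y. L (coord_rep id d e y)) x)"
      by (rule smooth_inverse_function[OF fd(1) sm z inj]) (rule that, assumption+)
    let ?A = "{p' \<in> cdom d. cmap d p' \<in> U'}"
    let ?T = "cmap c ` (cdom c \<inter> cdom e \<inter> ?A)"
    have "openin fiber_top (cdom c \<inter> cdom e \<inter> ?A)"
      using fiber_chart_openin[OF tc topological_chartD(1)[OF M.chart[OF eA(1)]]]
        topological_chart_open_preimage[OF td uv(1)] by (rule openin_Int)
    then have T: "open ?T" by (rule topological_chart_open_image[OF tc]) auto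
    have ic: "coord_rep id c e (cmap c p') = cmap e p'" if "p' \<in> cdom c" for p'
      using coord_rep_cmap[OF tc that, of id e] by simp
    have id: "coord_rep id d e (cmap d p') = cmap e p'" if "p' \<in> cdom d" for p'
      using coord_rep_cmap[OF td that, of id e] by simp
    have hL: "h (L (cmap e p')) = cmap d p'" "L (cmap e p') \<in> V'" if "p' \<in> ?A" for p'
    proof -
      have "h (L (coord_rep id d e (cmap d p'))) = cmap d p'" "L (coord_rep id d e (cmap d p')) \<in> V'"
        using uv(5) that unfolding homeomorphism_def by auto
      then show "h (L (cmap e p')) = cmap d p'" "L (cmap e p') \<in> V'" using id that by auto
    qed
    have "smooth_on ?T (\<lambda>y. h (L (coord_rep id c e y)))"
    proof (rule smooth_on_compose[OF fin_dim_euclidean T uv(4) _ _ uv(6)])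
      show "(\<lambda>y. L (coord_rep id c e y)) ` ?T \<subseteq> V'" using hL(2) ic by auto
      show "smooth_on ?T (\<lambda>y. L (coord_rep id c e y))"
        by (rule smooth_on_bounded_linear_comp[OF T L(1) smooth_on_subset[OF fc(2)]]) auto
    qed
    then have "smooth_on ?T (coord_rep id c d)"
    proof (rule smooth_on_cong[OF T])
      fix y assume "y \<in> ?T"
      then obtain p' where p': "y = cmap c p'" "p' \<in> cdom c" "p' \<in> ?A" by blast
      show "h (L (coord_rep id c e y)) = coord_rep id c d y"
        using hL(1)[OF p'(3)] ic[OF p'(2)] coord_rep_cmap[OF tc p'(2), of id d] by (simp add: p'(1))
    qed
    moreover have "x \<in> ?T" using p eA uv(3) by auto
    ultimately show "\<exists>U. open U \<and> x \<in> U \<and> smooth_on U (coord_rep id c d)" using T by blast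
  qed
qed

lemma smooth_manifold_fiber: "smooth_manifold F"
  unfolding smooth_manifold_def
proof (intro conjI ballI)
  show "\<exists>B::'k set. finite B \<and> span B = UNIV" using finite_Basis span_Basis by blast
  show "Hausdorff_space (mtop F)" "second_countable (mtop F)"
    using M.manifold unfolding fiber_mtop smooth_manifold_def
    by (auto intro: Hausdorff_space_subtopology second_countable_subtopology)
  show "points F \<subseteq> \<Union> (cdom ` atlas F)" using fiber_chart_exists by blast
  show "topological_chart (mtop F) c" if "c \<in> atlas F" for c
    using that by (simp add: fiber_mtop fiber_atlas)
  show "smooth_on (cmap c ` (cdom c \<inter> cdom d)) (coord_rep id c d)" if "c \<in> atlas F" "d \<in> atlas F" for c d
    by (rule fiber_transition_smooth[OF that])
qed

lemma smooth_inclusion: "smooth_map F M id"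
  unfolding smooth_map_def
proof (intro conjI ballI)
  show "continuous_map (mtop F) (mtop M) id"
    unfolding fiber_mtop by (intro continuous_map_from_subtopology continuous_map_id)
  show "smooth_on (cmap c ` (cdom c \<inter> id -` cdom d)) (coord_rep id c d)" if "c \<in> atlas F" "d \<in> atlas M"
      for c d
    using fiber_chartD(2)[OF that] by simp
qed

end

sublocale submersion_fiber \<subseteq> I: smooth_map_ctxt F M id
  by unfold_locales (rule smooth_manifold_fiber, rule smooth_inclusion)

section \<open>Tangent spaces of the fiber and restriction of forms and vertical fields\<close>

context submersion_fiber
begin

lemma fiber_point: "p \<in> points F \<Longrightarrow> p \<in> points M" "p \<in> points F \<Longrightarrow> \<pi> p = q"
  by (auto simp: fiber_points)

lemma inclusion_inj:
  assumes "c \<in> charts_at F p" "e \<in> charts_at M p"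
  shows "inj (coord_deriv id c e p)"
  using fiber_chartD(3) assms by (auto simp: I.M.charts_at_iff M.charts_at_iff)

lemma inclusion_linear:
  assumes "c \<in> charts_at F p" "e \<in> charts_at M p"
  shows "linear (coord_deriv id c e p)"
  using I.coord_deriv_linear[OF assms(1), of e] assms(2) by simp

lemma inclusion_domain_open: "c \<in> atlas F \<Longrightarrow> e \<in> atlas M \<Longrightarrow> open (I.coord_domain c e)"
  by (rule I.domain_open)

lemma inclusion_rep:
  assumes "c \<in> atlas F" "e \<in> atlas M" "y \<in> I.coord_domain c e"
  shows "c \<in> charts_at F (cinv c y)" "e \<in> charts_at M (cinv c y)" "cmap c (cinv c y) = y"
    "coord_rep id c e y = cmap e (cinv c y)" "cinv e (coord_rep id c e y) = cinv c y"
    "y \<in> cmap c ` cdom c" "coord_rep id c e y \<in> cmap e ` cdom e" "\<pi> (cinv c y) = q"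
    "\<D> (coord_rep id c e) y = coord_deriv id c e (cinv c y)"
proof -
  obtain p where p: "y = cmap c p" "p \<in> cdom c" "p \<in> cdom e" using assms(3) by auto
  then have pc: "c \<in> charts_at F p" "e \<in> charts_at M p"
    using assms by (auto simp: I.M.charts_at_iff M.charts_at_iff)
  have cy: "cinv c y = p" unfolding p(1) by (rule I.M.cinv_cmap_at[OF pc(1)])
  show "c \<in> charts_at F (cinv c y)" "e \<in> charts_at M (cinv c y)" "cmap c (cinv c y) = y"
    unfolding cy using pc p by auto
  show 1: "coord_rep id c e y = cmap e (cinv c y)" by (simp add: coord_rep_def)
  show "cinv e (coord_rep id c e y) = cinv c y" unfolding 1 cy by (rule M.cinv_cmap_at[OF pc(2)])
  show "y \<in> cmap c ` cdom c" "coord_rep id c e y \<in> cmap e ` cdom e" unfolding 1 cy using p by auto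
  show "\<pi> (cinv c y) = q" unfolding cy by (rule fiber_point(2)[OF I.M.charts_at_points[OF pc(1)]])
  show "\<D> (coord_rep id c e) y = coord_deriv id c e (cinv c y)"
    unfolding coord_deriv_def cy using p(1) by simp
qed

text \<open>The tangent space of the fiber is the vertical space. One inclusion is the derivative of
  \<pi> being constant on the fiber, the other follows by comparing dimensions.\<close>

lemma inclusion_range:
  assumes c: "c \<in> charts_at F p" and e: "e \<in> charts_at M p" and d: "d \<in> charts_at N q"
  shows "range (coord_deriv id c e p) = {v. coord_deriv \<pi> e d p v = 0}"
proof -
  have cA: "c \<in> atlas F" "p \<in> cdom c" and eA: "e \<in> atlas M" "p \<in> cdom e"
    using c e by (auto simp: I.M.charts_at_iff M.charts_at_iff)
  have q: "\<pi> p = q" by (rule fiber_point(2)[OF I.M.charts_at_points[OF c]])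
  have d': "d \<in> charts_at N (\<pi> p)" using d q by simp
  have D: "linear (coord_deriv \<pi> e d p)" by (rule coord_deriv_linear[OF e d'])
  let ?I = "coord_deriv id c e p" and ?K = "{v. coord_deriv \<pi> e d p v = 0}"
  have sub: "range ?I \<subseteq> ?K"
  proof (intro image_subsetI CollectI)
    fix u
    let ?O = "I.coord_domain c e"
    have x: "cmap c p \<in> ?O" using cA eA by auto
    have ix: "coord_rep id c e (cmap c p) = cmap e p"
      using inclusion_rep(4)[OF cA(1) eA(1) x] I.M.cinv_cmap_at[OF c] by simp
    have 1: "((\<lambda>y. coord_rep \<pi> e d (coord_rep id c e y)) has_derivative
        (\<lambda>u. coord_deriv \<pi> e d p (?I u))) (at (cmap c p))"
      using has_derivative_compose[OF I.coord_deriv[OF c], of e "coord_rep \<pi> e d"] coord_deriv[OF e d'] e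
      by (simp add: ix)
    show "coord_deriv \<pi> e d p (?I u) = 0"
    proof (rule has_derivative_unique_open[OF inclusion_domain_open[OF cA(1) eA(1)] x 1
        has_derivative_const[of "cmap d q"]])
      fix y assume y: "y \<in> ?O"
      show "coord_rep \<pi> e d (coord_rep id c e y) = cmap d q"
        unfolding coord_rep_def[of \<pi>] o_apply inclusion_rep(5,8)[OF cA(1) eA(1) y] by (rule refl)
    qed
  qed
  have "dim (range ?I) = dim (UNIV :: 'k set)"
    by (rule eucl.dim_image_eq[OF inclusion_linear[OF c e]]) (use inclusion_inj[OF c e] in simp)
  then have dim: "dim ?K \<le> dim (range ?I)" using dim_vertical[OF e d'] by simp
  show ?thesis
    by (rule subspace_dim_equal[OF linear_subspace_image[OF inclusion_linear[OF c e] subspace_UNIV] _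
        sub dim])
      (auto simp: subspace_def linear_add[OF D] linear_scale[OF D] linear_0[OF D])
qed

lemma vertical_space_coord:
  assumes e: "e \<in> charts_at M p" and d: "d \<in> charts_at N (\<pi> p)" and v: "v \<in> tangent_space M p"
  shows "v \<in> vertical_space M N \<pi> p \<longleftrightarrow> coord_deriv \<pi> e d p (v e) = 0"
proof -
  have p: "p \<in> points M" by (rule M.charts_at_points[OF e])
  have "differential M N \<pi> p v = 0 \<longleftrightarrow> differential M N \<pi> p v d = 0"
  proof
    assume "differential M N \<pi> p v d = 0"
    then show "differential M N \<pi> p v = 0"
      by (intro N.tangent_eqI[OF differential_tangent[OF v p] N.tangent_zero d]) simp
  qed simp
  then show ?thesis using v by (simp add: vertical_space_def differential_coord[OF v e d])
qed

lemma differential_inclusion: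
  assumes v: "v \<in> tangent_space F p" and c: "c \<in> charts_at F p" and e: "e \<in> charts_at M p"
  shows "differential F M id p v e = coord_deriv id c e p (v c)"
    "differential F M id p v \<in> tangent_space M p"
  using I.differential_coord[OF v c, of e] I.differential_tangent[OF v I.M.charts_at_points[OF c]] e by
      simp_all

lemma differential_inclusion_coord_vector:
  assumes c: "c \<in> charts_at F p" and e: "e \<in> charts_at M p"
  shows "differential F M id p (coord_vector F c p u) = coord_vector M e p (coord_deriv id c e p u)"
  by (rule M.tangent_eqI[OF differential_inclusion(2)[OF I.M.coord_vector_tangent[OF c] c e]
      M.coord_vector_tangent[OF e] e])
    (simp add: differential_inclusion(1)[OF I.M.coord_vector_tangent[OF c] c e]
      I.M.coord_vector_self[OF c] M.coord_vector_self[OF e])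

lemma differential_inclusion_add:
  assumes "v \<in> tangent_space F p" "w \<in> tangent_space F p" "p \<in> points F"
  shows "differential F M id p (v + w) = differential F M id p v + differential F M id p w"
proof -
  obtain c where c: "c \<in> charts_at F p" using I.M.charts_at_ex[OF assms(3)] by blast
  obtain e where e: "e \<in> charts_at M p" using M.charts_at_ex[OF fiber_point(1)[OF assms(3)]] by blast
  note di = differential_inclusion[OF _ c e]
  show ?thesis
    by (rule M.tangent_eqI[OF di(2)[OF I.M.tangent_add[OF assms(1,2)]]
        M.tangent_add[OF di(2)[OF assms(1)] di(2)[OF assms(2)]] e])
      (simp add: di(1)[OF I.M.tangent_add[OF assms(1,2)]] di(1)[OF assms(1)] di(1)[OF assms(2)]
        linear_add[OF inclusion_linear[OF c e]])
qed

lemma differential_inclusion_scale: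
  assumes "v \<in> tangent_space F p" "p \<in> points F"
  shows "differential F M id p (tangent_scale a v) = tangent_scale a (differential F M id p v)"
proof -
  obtain c where c: "c \<in> charts_at F p" using I.M.charts_at_ex[OF assms(2)] by blast
  obtain e where e: "e \<in> charts_at M p" using M.charts_at_ex[OF fiber_point(1)[OF assms(2)]] by blast
  note di = differential_inclusion[OF _ c e]
  have "differential F M id p (tangent_scale a v) e = a *\<^sub>R differential F M id p v e"
    unfolding di(1)[OF I.M.tangent_scale[OF assms(1)]] di(1)[OF assms(1)]
    by (simp add: tangent_scale_def linear_scale[OF inclusion_linear[OF c e]])
  then show ?thesis
    by (intro M.tangent_eqI[OF di(2)[OF I.M.tangent_scale[OF assms(1)]]
        M.tangent_scale[OF di(2)[OF assms(1)]] e])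
      (simp add: tangent_scale_def)
qed

text \<open>A fiber chart need not lie in a single chart of \<open>M\<close>, but smoothness is
  local and the charts of \<open>M\<close> cover the fiber.\<close>

lemma smooth_on_fiber_chart:
  assumes c: "c \<in> atlas F" and sm: "\<And>e. e \<in> atlas M \<Longrightarrow> smooth_on (I.coord_domain c e) h"
  shows "smooth_on (cmap c ` cdom c) h"
proof (rule smooth_on_local[OF I.M.image_open[OF c]])
  fix x assume "x \<in> cmap c ` cdom c"
  then obtain p where p: "x = cmap c p" "p \<in> cdom c" by blast
  then have "c \<in> charts_at F p" using c by (simp add: I.M.charts_at_iff)
  then obtain e where "e \<in> charts_at M p" using M.charts_at_ex fiber_point(1) I.M.charts_at_points by metis
  then have e: "e \<in> atlas M" "x \<in> I.coord_domain c e" using p by (auto simp: M.charts_at_iff)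
  then show "\<exists>U. open U \<and> x \<in> U \<and> smooth_on U h" using sm inclusion_domain_open[OF c] by blast
qed

lemma smooth_rep: "c \<in> atlas F \<Longrightarrow> e \<in> atlas M \<Longrightarrow> smooth_on (I.coord_domain c e) (coord_rep id c e)"
  by (rule I.coord_smooth)

lemma smooth_on_rep_compose:
  assumes "c \<in> atlas F" "e \<in> atlas M" "smooth_on (cmap e ` cdom e) h"
  shows "smooth_on (I.coord_domain c e) (\<lambda>y. h (coord_rep id c e y))"
  by (rule smooth_on_compose[OF fin_dim_euclidean inclusion_domain_open[OF assms(1,2)]
      M.image_open[OF assms(2)]
        I.coord_rep_maps[OF assms(1)] smooth_rep[OF assms(1,2)] assms(3)])

lemma one_form_restrict:
  assumes \<eta>: "one_form M \<eta>"
  shows "one_form F (restrict_form F M \<eta>)"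
  unfolding one_form_def
proof (intro conjI ballI allI)
  fix p v w a assume p: "p \<in> points F" and v: "v \<in> tangent_space F p" and w: "w \<in> tangent_space F p"
  have t: "differential F M id p v \<in> tangent_space M p" "differential F M id p w \<in> tangent_space M p"
    using I.differential_tangent[OF v p] I.differential_tangent[OF w p] by simp_all
  have ax: "\<eta> p (v' + w') = \<eta> p v' + \<eta> p w' \<and> \<eta> p (tangent_scale a v') = a * \<eta> p v'"
    if "v' \<in> tangent_space M p" "w' \<in> tangent_space M p" for v' w'
    using \<eta> fiber_point(1)[OF p] that unfolding one_form_def by simp
  show "restrict_form F M \<eta> p (v + w) = restrict_form F M \<eta> p v + restrict_form F M \<eta> p w"
    "restrict_form F M \<eta> p (tangent_scale a v) = a * restrict_form F M \<eta> p v"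
    unfolding restrict_form_def differential_inclusion_add[OF v w p] differential_inclusion_scale[OF v p]
    using ax[OF t] by auto
next
  fix c u assume c: "c \<in> atlas F"
  show "smooth_on (cmap c ` cdom c) (\<lambda>x. restrict_form F M \<eta> (cinv c x) (coord_vector F c (cinv c x) u))"
  proof (rule smooth_on_fiber_chart[OF c])
    fix e assume e: "e \<in> atlas M"
    let ?A = "\<lambda>y u. \<eta> (cinv e y) (coord_vector M e (cinv e y) u)"
    have lin: "linear (?A y)" if "y \<in> cmap e ` cdom e" for y
    proof -
      note i = M.cinv_chart[OF e that]
      have p: "cinv e y \<in> points M" by (rule M.charts_at_points[OF i(1)])
      have ax: "\<eta> (cinv e y) (v' + w') = \<eta> (cinv e y) v' + \<eta> (cinv e y) w' \<and> \<eta> (cinv e y)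
          (tangent_scale a v') = a * \<eta> (cinv e y) v'"
        if "v' \<in> tangent_space M (cinv e y)" "w' \<in> tangent_space M (cinv e y)" for v' w' a
        using \<eta> p that unfolding one_form_def by simp
      note t = M.coord_vector_tangent[OF i(1)]
      show ?thesis
        by (rule linearI) (simp_all add: M.coord_vector_add[OF i(1)] M.coord_vector_scale[OF i(1)]
            ax[OF t t])
    qed
    have 1: "smooth_on (I.coord_domain c e) (\<lambda>y. ?A (coord_rep id c e y) (\<D> (coord_rep id c e) y u))"
    proof (rule smooth_on_apply[where A="\<lambda>y. ?A (coord_rep id c e y)", OF M.fd
        inclusion_domain_open[OF c e]])
      show "linear (?A (coord_rep id c e y))" if "y \<in> I.coord_domain c e" for y
        by (rule lin[OF inclusion_rep(7)[OF c e that]])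
      show "smooth_on (I.coord_domain c e) (\<lambda>y. ?A (coord_rep id c e y) w)" for w
        by (rule smooth_on_rep_compose[OF c e]) (use \<eta> e in \<open>simp add: one_form_def\<close>)
      show "smooth_on (I.coord_domain c e) (\<lambda>y. \<D> (coord_rep id c e) y u)"
        by (rule smooth_on_deriv[OF smooth_rep[OF c e]])
    qed
    show "smooth_on (I.coord_domain c e) (\<lambda>x. restrict_form F M \<eta> (cinv c x)
        (coord_vector F c (cinv c x) u))"
    proof (rule smooth_on_cong[OF inclusion_domain_open[OF c e] 1])
      fix y assume y: "y \<in> I.coord_domain c e"
      note i = inclusion_rep[OF c e y]
      show "?A (coord_rep id c e y) (\<D> (coord_rep id c e) y u)
          = restrict_form F M \<eta> (cinv c y) (coord_vector F c (cinv c y) u)"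
        unfolding restrict_form_def i(5) i(9) differential_inclusion_coord_vector[OF i(1,2)] by (rule refl)
    qed
  qed
qed

text \<open>A vertical vector has exactly one preimage under the differential of the inclusion, by
  \<open>inclusion_range\<close> and injectivity, so the \<open>THE\<close> in
  \<open>restrict_field\<close> is well defined.\<close>

lemma vector_field_restrict:
  assumes V: "vertical_field M N \<pi> V"
  shows "vector_field F (restrict_field F M V)"
    and "p \<in> points F \<Longrightarrow> differential F M id p (restrict_field F M V p) = V p"
proof -
  have VM: "vector_field M V" using V by (simp add: vertical_field_def)
  have ex1: "\<exists>!v. v \<in> tangent_space F p \<and> differential F M id p v = V p" if p: "p \<in> points F" for p
  proof -
    have pM: "p \<in> points M" and pq: "\<pi> p = q" using fiber_point[OF p] by auto
    obtain c where c: "c \<in> charts_at F p" using I.M.charts_at_ex[OF p] by blast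
    obtain e where e: "e \<in> charts_at M p" using M.charts_at_ex[OF pM] by blast
    obtain d where d: "d \<in> charts_at N (\<pi> p)" using N.charts_at_ex[OF maps_points[OF pM]] by blast
    note VT = M.vector_fieldD(1)[OF VM, of p]
    have "V p \<in> vertical_space M N \<pi> p" using V pM by (simp add: vertical_field_def)
    then have "coord_deriv \<pi> e d p (V p e) = 0" using vertical_space_coord[OF e d VT] by simp
    then have "V p e \<in> range (coord_deriv id c e p)" using inclusion_range[OF c e, of d] d pq by simp
    then obtain u where u: "V p e = coord_deriv id c e p u" by blast
    note t = I.M.coord_vector_tangent[OF c, of u]
    show ?thesis
    proof (rule ex1I[of _ "coord_vector F c p u"], intro conjI t)
      show "differential F M id p (coord_vector F c p u) = V p"
        unfolding differential_inclusion_coord_vector[OF c e] u[symmetric] by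
            (rule M.coord_vector_eq[OF VT e])
      fix v assume v: "v \<in> tangent_space F p \<and> differential F M id p v = V p"
      then have "coord_deriv id c e p (v c) = coord_deriv id c e p u"
        using differential_inclusion(1)[OF conjunct1[OF v] c e] u by simp
      then have "v c = u" using inclusion_inj[OF c e] by (simp add: inj_eq)
      then show "v = coord_vector F c p u"
        by (intro I.M.tangent_eqI[OF conjunct1[OF v] t c]) (simp add: I.M.coord_vector_self[OF c])
    qed
  qed
  have r: "restrict_field F M V p \<in> tangent_space F p \<and> differential F M id p (restrict_field F M V p) =
      V p"
    if "p \<in> points F" for p
    using theI'[OF ex1[OF that]] that by (simp add: restrict_field_def)
  then show "p \<in> points F \<Longrightarrow> differential F M id p (restrict_field F M V p) = V p" by blast
  show "vector_field F (restrict_field F M V)"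
  proof (rule I.M.vector_fieldI)
    show "restrict_field F M V p \<in> tangent_space F p" for p
    proof (cases "p \<in> points F")
      case False
      then show ?thesis using I.M.tangent_zero[of p] by (simp add: restrict_field_def)
    qed (use r in blast)
    fix c assume c: "c \<in> atlas F"
    show "smooth_on (cmap c ` cdom c) (field_rep (restrict_field F M V) c)"
    proof (rule smooth_on_fiber_chart[OF c])
      fix e assume e: "e \<in> atlas M"
      show "smooth_on (I.coord_domain c e) (field_rep (restrict_field F M V) c)"
      \<comment> \<open>The restricted field is only known implicitly, as the solution of the linear
        equation that its image is \<open>V\<close>; smoothness comes from solving that
        equation.\<close>
      proof (rule smooth_on_solve[where A="\<lambda>y. \<D> (coord_rep id c e) y"
            and w="\<lambda>y. field_rep V e (coord_rep id c e y)", OF fin_dim_euclidean fin_dim_euclidean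
                inclusion_domain_open[OF c e]])
        fix y assume y: "y \<in> I.coord_domain c e"
        note i = inclusion_rep[OF c e y]
        show "linear (\<D> (coord_rep id c e) y)" unfolding i(9) by (rule inclusion_linear[OF i(1,2)])
        show "inj (\<D> (coord_rep id c e) y)" unfolding i(9) by (rule inclusion_inj[OF i(1,2)])
        note rr = r[OF I.M.charts_at_points[OF i(1)]]
        show "\<D> (coord_rep id c e) y (field_rep (restrict_field F M V) c y) = field_rep V e
            (coord_rep id c e y)"
          unfolding i(9) field_rep_def i(5)
          using differential_inclusion(1)[OF conjunct1[OF rr] i(1,2)] conjunct2[OF rr] by simp
      next
        show "smooth_on (I.coord_domain c e) (\<lambda>y. \<D> (coord_rep id c e) y u)" for u
          by (rule smooth_on_deriv[OF smooth_rep[OF c e]])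
        show "smooth_on (I.coord_domain c e) (\<lambda>y. field_rep V e (coord_rep id c e y))"
          by (rule smooth_on_rep_compose[OF c e M.vector_fieldD(2)[OF VM e]])
      qed
    qed
  qed
qed

end

section \<open>Fibers of a submersion with parallel vertical distribution\<close>

lemma local_connection_subset:
  assumes "local_connection U \<Gamma>" "open S" "S \<subseteq> U"
  shows "local_connection S \<Gamma>"
proof -
  interpret local_connection U \<Gamma> by fact
  show ?thesis
    by (rule local_connection.intro) (use fd lin assms(2,3) smooth_on_subset[OF smooth] in auto)
qed

section \<open>Extension of vertical vectors to vertical fields\<close>

context submersion_fiber
begin

lemma submersion_rep:
  assumes "e \<in> atlas M" "d \<in> atlas N" "x \<in> coord_domain e d"
  shows "e \<in> charts_at M (cinv e x)" "d \<in> charts_at N (\<pi> (cinv e x))" "cmap e (cinv e x) = x"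
    "coord_rep \<pi> e d x = cmap d (\<pi> (cinv e x))" "x \<in> cmap e ` cdom e"
    "\<D> (coord_rep \<pi> e d) x = coord_deriv \<pi> e d (cinv e x)"
proof -
  obtain p where p: "x = cmap e p" "p \<in> cdom e" "\<pi> p \<in> cdom d" using assms(3) by auto
  then have pc: "e \<in> charts_at M p" "d \<in> charts_at N (\<pi> p)"
    using assms by (auto simp: M.charts_at_iff N.charts_at_iff)
  have ex: "cinv e x = p" unfolding p(1) by (rule M.cinv_cmap_at[OF pc(1)])
  show "e \<in> charts_at M (cinv e x)" "d \<in> charts_at N (\<pi> (cinv e x))" "cmap e (cinv e x) = x"
    unfolding ex using pc p by auto
  show "coord_rep \<pi> e d x = cmap d (\<pi> (cinv e x))" by (simp add: coord_rep_def)
  show "x \<in> cmap e ` cdom e" using p by blast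
  show "\<D> (coord_rep \<pi> e d) x = coord_deriv \<pi> e d (cinv e x)"
    unfolding coord_deriv_def ex using p(1) by simp
qed

lemma vertical_zero:
  assumes "p \<in> points M"
  shows "0 \<in> vertical_space M N \<pi> p"
proof -
  obtain e where e: "e \<in> charts_at M p" using M.charts_at_ex[OF assms] by blast
  obtain d where d: "d \<in> charts_at N (\<pi> p)" using N.charts_at_ex[OF maps_points[OF assms]] by blast
  show ?thesis
    unfolding vertical_space_coord[OF e d M.tangent_zero] by
        (simp add: linear_0[OF coord_deriv_linear[OF e d]])
qed

text \<open>In straightened coordinates the submersion is linear and its kernel is constant, so the
  constant field \<open>k\<close> is vertical there. It is pulled back to the chart and cut off,
  which preserves verticality.\<close>

lemma extend_vertical:
  assumes e: "e \<in> charts_at M p" and d: "d \<in> charts_at N (\<pi> p)" and k: "coord_deriv \<pi> e d p k = 0"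
  obtains Y where "vertical_field M N \<pi> Y" "Y p e = k"
proof -
  have ed: "e \<in> atlas M" "d \<in> atlas N" using e d by (auto simp: M.charts_at_iff N.charts_at_iff)
  obtain \<Phi> U' where U': "open U'" "cmap e p \<in> U'" "U' \<subseteq> coord_domain e d" and sm: "smooth_on U' \<Phi>"
    and inj: "\<And>x. x \<in> U' \<Longrightarrow> inj (\<D> \<Phi> x)"
    and D: "\<And>x u. x \<in> U' \<Longrightarrow> coord_deriv \<pi> e d p (\<D> \<Phi> x u) = \<D> (coord_rep \<pi> e d) x u"
    and id: "\<And>u. \<D> \<Phi> (cmap e p) u = u"
    using straighten[OF e d] by metis
  have U'e: "U' \<subseteq> cmap e ` cdom e" using U'(3) by blast
  have "\<exists>y. \<D> \<Phi> x y = k" if "x \<in> U'" for x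
    using linear_injective_imp_surjective[OF smooth_on_linear[OF sm that] inj[OF that]] by (metis surjD)
  \<comment> \<open>The pullback of the constant field \<open>k\<close> under \<Phi>.\<close>
  then obtain Z where Z: "\<And>x. x \<in> U' \<Longrightarrow> \<D> \<Phi> x (Z x) = k" by metis
  have sZ: "smooth_on U' Z"
    by (rule smooth_on_solve[where A="\<lambda>x. \<D> \<Phi> x" and w="\<lambda>x. k",
          OF fin_dim_euclidean fin_dim_euclidean U'(1) smooth_on_linear[OF sm] inj
              smooth_on_deriv[OF sm] smooth_on_const[OF U'(1)] Z])
  obtain Y where Y: "vector_field M Y" "Y p e = Z (cmap e p)"
    "\<And>r. Y r \<noteq> 0 \<Longrightarrow> r \<in> cdom e \<and> cmap e r \<in> U' \<and> (\<exists>a. Y r = coord_vector M e r (a *\<^sub>R Z (cmap e r)))"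
    using extend_local_field[OF M.manifold e U'(1,2) U'e sZ] by metis
  have "Y r \<in> vertical_space M N \<pi> r" if r: "r \<in> points M" for r
  proof (cases "Y r = 0")
    case True
    then show ?thesis using vertical_zero[OF r] by simp
  next
    case False
    then obtain a where a: "r \<in> cdom e" "cmap e r \<in> U'" "Y r = coord_vector M e r (a *\<^sub>R Z (cmap e r))"
      using Y(3) by blast
    have er: "e \<in> charts_at M r" using a(1) ed by (simp add: M.charts_at_iff)
    have x: "cmap e r \<in> coord_domain e d" using a(2) U'(3) by blast
    note i = submersion_rep[OF ed x, unfolded M.cinv_cmap_at[OF er]]
    have "coord_deriv \<pi> e d r (Z (cmap e r)) = 0"
      using D[OF a(2), of "Z (cmap e r)"] Z[OF a(2)] k i(6) by simp
    then show ?thesis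
      unfolding a(3) vertical_space_coord[OF er i(2) M.coord_vector_tangent[OF er]]
      by (simp add: M.coord_vector_self[OF er] linear_scale[OF coord_deriv_linear[OF er i(2)]])
  qed
  moreover have "Z (cmap e p) = k" using Z[OF U'(2)] id by simp
  ultimately show ?thesis using that[of Y] Y(1,2) by (simp add: vertical_field_def)
qed

end

locale parallel_submersion = submersion_fiber M N \<pi> F q + GM: riemannian_euclidean M g + GN:
    riemannian_ctxt N gN
  for M :: "('p, 'm::euclidean_space) manifold" and N :: "('q, 'n::real_normed_vector) manifold"
    and \<pi> :: "'p \<Rightarrow> 'q" and F :: "('p, 'k::euclidean_space) manifold" and q
    and g :: "('p, 'm) metric_field" and gN :: "('q, 'n) metric_field" +
  assumes isometric: "p \<in> points M \<Longrightarrow> v \<in> horizontal_space M g N \<pi> p \<Longrightarrow>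
      gN (\<pi> p) (differential M N \<pi> p v) (differential M N \<pi> p v) = g p v v"
    and parallel: "vertical_parallel M g N \<pi>"
begin

abbreviation gF :: "('p, 'k) metric_field" where "gF \<equiv> induced_metric F M g"

lemma induced_rep:
  assumes "c \<in> atlas F" "e \<in> atlas M" "y \<in> I.coord_domain c e"
  shows "metric_rep F gF c y u w = metric_rep M g e (coord_rep id c e y)
    (\<D> (coord_rep id c e) y u) (\<D> (coord_rep id c e) y w)"
proof -
  note i = inclusion_rep[OF assms]
  show ?thesis
    unfolding metric_rep_def induced_metric_def i(5) i(9) differential_inclusion_coord_vector[OF i(1,2)]
        by (rule refl)
qed

lemma riemannian_induced: "riemannian_metric F gF"
  unfolding riemannian_metric_def
proof (intro conjI ballI allI impI)
  fix p u v assume p: "p \<in> points F" and u: "u \<in> tangent_space F p" and v: "v \<in> tangent_space F p"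
  have pM: "p \<in> points M" by (rule fiber_point(1)[OF p])
  have t: "differential F M id p w \<in> tangent_space M p" if "w \<in> tangent_space F p" for w
    using I.differential_tangent[OF that p] by simp
  show "gF p (u + v) w = gF p u w + gF p v w" if w: "w \<in> tangent_space F p" for w
    unfolding induced_metric_def differential_inclusion_add[OF u v p]
    by (rule GM.metric_add[OF pM t[OF u] t[OF v] t[OF w]])
  show "gF p (tangent_scale a u) v = a * gF p u v" for a
    unfolding induced_metric_def differential_inclusion_scale[OF u p] by
        (rule GM.metric_scale[OF pM t[OF u] t[OF v]])
  show "gF p u v = gF p v u"
    unfolding induced_metric_def by (rule GM.metric_sym[OF pM t[OF u] t[OF v]])
next
  fix p v assume p: "p \<in> points F" and v: "v \<in> tangent_space F p" and nz: "v \<noteq> 0"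
  obtain c where c: "c \<in> charts_at F p" using I.M.charts_at_ex[OF p] by blast
  obtain e where e: "e \<in> charts_at M p" using M.charts_at_ex[OF fiber_point(1)[OF p]] by blast
  have "v c \<noteq> 0" using I.M.tangent_eqI[OF v I.M.tangent_zero c] nz by auto
  then have "differential F M id p v e \<noteq> 0"
    unfolding differential_inclusion(1)[OF v c e]
    using inclusion_inj[OF c e] linear_injective_0[OF inclusion_linear[OF c e]] by blast
  then have "differential F M id p v \<noteq> 0" by auto
  then show "0 < gF p v v"
    unfolding induced_metric_def by (rule GM.metric_pos[OF fiber_point(1)[OF p]
        differential_inclusion(2)[OF v c e]])
next
  fix c u w assume c: "c \<in> atlas F"
  show "smooth_on (cmap c ` cdom c) (\<lambda>x. gF (cinv c x) (coord_vector F c (cinv c x) u)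
      (coord_vector F c (cinv c x) w))"
    unfolding metric_rep_def[symmetric]
  proof (rule smooth_on_fiber_chart[OF c])
    fix e assume e: "e \<in> atlas M"
    interpret L: local_metric "cmap e ` cdom e" "metric_rep M g e" by (rule GM.local_metric_rep[OF e])
    let ?O = "I.coord_domain c e" and ?i = "coord_rep id c e"
    note O = inclusion_domain_open[OF c e]
    have f: "inner_form (metric_rep M g e (?i y))" if "y \<in> ?O" for y by
        (rule L.form[OF inclusion_rep(7)[OF c e that]])
    have d: "smooth_on ?O (\<lambda>y. \<D> ?i y z)" for z by (rule smooth_on_deriv[OF smooth_rep[OF c e]])
    have 1: "smooth_on ?O (\<lambda>y. metric_rep M g e (?i y) a (\<D> ?i y w))" for a
      by (rule smooth_on_apply[where A="\<lambda>y. metric_rep M g e (?i y) a", OF M.fd O inner_formD(1)[OF f]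
            smooth_on_rep_compose[OF c e local_metric.smooth[OF GM.local_metric_rep[OF e]]] d])
    have 2: "smooth_on ?O (\<lambda>y. metric_rep M g e (?i y) (\<D> ?i y u) (\<D> ?i y w))"
      by (rule smooth_on_apply[where A="\<lambda>y a. metric_rep M g e (?i y) a (\<D> ?i y w)",
            OF M.fd O inner_formD(2)[OF f] 1 d])
    show "smooth_on ?O (\<lambda>x. metric_rep F gF c x u w)"
      by (rule smooth_on_cong[OF O 2 induced_rep[OF c e, symmetric]])
  qed
qed

end

sublocale parallel_submersion \<subseteq> GF: riemannian_euclidean F "induced_metric F M g"
  by (intro riemannian_euclidean.intro riemannian_ctxt.intro I.M.manifold_ctxt_axioms
      riemannian_ctxt_axioms.intro riemannian_induced)

section \<open>The submersion and the inclusion of the fiber are affine\<close>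

context parallel_submersion
begin

text \<open>\<open>k\<close> is extended to a vertical field \<open>Y\<close> and \<open>u\<close>
  to a field \<open>X\<close>. Parallelism says that the differential kills the sum of the
  derivative of \<open>Y\<close> and the symbol. Differentiating the verticality of \<open>Y\<close>
  along \<open>u\<close> says that it sends that derivative to minus the second derivative of the
  submersion. Comparing the two gives the claim.\<close>

lemma vertical_christoffel:
  assumes e: "e \<in> charts_at M p" and d: "d \<in> charts_at N (\<pi> p)" and k: "coord_deriv \<pi> e d p k = 0"
  shows "coord_deriv \<pi> e d p (christoffel (metric_rep M g e) (cmap e p) u k)
    = second_derivative (coord_rep \<pi> e d) (cmap e p) u k"
proof -
  have ed: "e \<in> atlas M" "d \<in> atlas N" using e d by (auto simp: M.charts_at_iff N.charts_at_iff)
  obtain Y where Y: "vertical_field M N \<pi> Y" "Y p e = k" using extend_vertical[OF e d k] by blast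
  have YM: "vector_field M Y" using Y(1) by (simp add: vertical_field_def)
  have p: "p \<in> points M" by (rule M.charts_at_points[OF e])
  obtain X where X: "vector_field M X" "X p = coord_vector M e p u"
    using extend_tangent[OF M.manifold M.coord_vector_tangent[OF e] p] by metis
  have "vertical_field M N \<pi> (coord_connection M g X Y)"
    using parallel X(1) Y(1) unfolding vertical_parallel_def GM.levi_civita_eq[OF X(1) YM, symmetric] by
        blast
  then have vc: "vector_field M (coord_connection M g X Y)"
      "coord_connection M g X Y p \<in> vertical_space M N \<pi> p"
    using p by (auto simp: vertical_field_def)
  let ?D = "coord_deriv \<pi> e d p" and ?dY = "\<D> (field_rep Y e) (cmap e p)"
  have lin: "linear ?D" by (rule coord_deriv_linear[OF e d])
  have "?D (coord_connection M g X Y p e) = 0"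
    using vc(2) vertical_space_coord[OF e d M.vector_fieldD(1)[OF vc(1)]] by simp
  then have 0: "?D (?dY u) + ?D (christoffel (metric_rep M g e) (cmap e p) u k) = 0"
    using e by (simp add: coord_connection_def X(2) Y(2) M.coord_vector_self[OF e] linear_add[OF lin])
  let ?S = "coord_domain e d"
  note S = domain_open[OF ed] cmap_in_domain[OF e d] coord_smooth[OF ed]
  have 1: "((\<lambda>x. \<D> (coord_rep \<pi> e d) x (field_rep Y e x)) has_derivative
      (\<lambda>u. second_derivative (coord_rep \<pi> e d) (cmap e p) u (field_rep Y e (cmap e p)) +
        \<D> (coord_rep \<pi> e d) (cmap e p) (?dY u))) (at (cmap e p))"
    by (rule has_derivative_frechet_apply[OF M.fd S M.field_rep_deriv[OF YM e]])
  have "second_derivative (coord_rep \<pi> e d) (cmap e p) u (field_rep Y e (cmap e p)) +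
        \<D> (coord_rep \<pi> e d) (cmap e p) (?dY u) = 0"
  proof (rule has_derivative_unique_open[OF S(1,2) 1 has_derivative_const[of 0]])
    fix x assume x: "x \<in> ?S"
    note i = submersion_rep[OF ed x]
    have "Y (cinv e x) \<in> vertical_space M N \<pi> (cinv e x)"
      using Y(1) M.charts_at_points[OF i(1)] by (simp add: vertical_field_def)
    then show "\<D> (coord_rep \<pi> e d) x (field_rep Y e x) = 0"
      unfolding vertical_space_coord[OF i(1,2) M.vector_fieldD(1)[OF YM]] i(6) field_rep_def .
  qed
  then have "second_derivative (coord_rep \<pi> e d) (cmap e p) u k + ?D (?dY u) = 0"
    by (simp add: M.field_rep_cmap[OF e] Y(2) coord_deriv_def)
  then show ?thesis using 0 by (metis add.commute add_right_cancel)
qed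

lemma horizontal_isometric:
  assumes e: "e \<in> charts_at M p" and d: "d \<in> charts_at N (\<pi> p)"
    and b: "\<And>k. coord_deriv \<pi> e d p k = 0 \<Longrightarrow> metric_rep M g e (cmap e p) b k = 0"
  shows "metric_rep N gN d (cmap d (\<pi> p)) (coord_deriv \<pi> e d p b) (coord_deriv \<pi> e d p b)
    = metric_rep M g e (cmap e p) b b"
proof -
  have p: "p \<in> points M" by (rule M.charts_at_points[OF e])
  let ?v = "coord_vector M e p b"
  note v = M.coord_vector_tangent[OF e, of b]
  have "?v \<in> horizontal_space M g N \<pi> p"
    unfolding horizontal_space_def
  proof (intro CollectI conjI v ballI)
    fix w assume w: "w \<in> vertical_space M N \<pi> p"
    then have wt: "w \<in> tangent_space M p" by (simp add: vertical_space_def)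
    show "g p ?v w = 0"
      unfolding GM.metric_coord[OF e v wt] M.coord_vector_self[OF e]
      by (rule b) (use w vertical_space_coord[OF e d wt] in simp)
  qed
  from isometric[OF p this] show ?thesis
    unfolding GM.metric_coord[OF e v v] GN.metric_coord[OF d differential_tangent[OF v p]
        differential_tangent[OF v p]]
      differential_coord[OF v e d] M.coord_vector_self[OF e] .
qed

lemma submersion_affine_coord:
  assumes ed: "e \<in> atlas M" "d \<in> atlas N" and x: "x \<in> coord_domain e d"
  shows "\<D> (coord_rep \<pi> e d) x (christoffel (metric_rep M g e) x u v) =
    christoffel (metric_rep N gN d) (coord_rep \<pi> e d x) (\<D> (coord_rep \<pi> e d) x u)
      (\<D> (coord_rep \<pi> e d) x v) + second_derivative (coord_rep \<pi> e d) x u v"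
proof (rule submersion_affine[where G="metric_rep M g e" and H="metric_rep N gN d" and f="coord_rep \<pi> e d",
      OF GM.local_metric_rep[OF ed(1)] GN.local_metric_rep[OF ed(2)] domain_open[OF ed] _
          coord_rep_maps[OF ed(1)]
        coord_smooth[OF ed] _ _ _ x])
  show "coord_domain e d \<subseteq> cmap e ` cdom e" by blast
  fix x assume x: "x \<in> coord_domain e d"
  note i = submersion_rep[OF ed x]
  show "surj (\<D> (coord_rep \<pi> e d) x)" unfolding i(6) by (rule surj_deriv[OF i(1,2)])
  show "metric_rep N gN d (coord_rep \<pi> e d x) (\<D> (coord_rep \<pi> e d) x b)
      (\<D> (coord_rep \<pi> e d) x b) = metric_rep M g e x b b"
    if "\<And>k. \<D> (coord_rep \<pi> e d) x k = 0 \<Longrightarrow> metric_rep M g e x b k = 0" for b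
    using horizontal_isometric[OF i(1,2), of b] that unfolding i(3) i(4) i(6) by blast
  show "\<D> (coord_rep \<pi> e d) x (christoffel (metric_rep M g e) x u k)
      = second_derivative (coord_rep \<pi> e d) x u k"
    if "\<D> (coord_rep \<pi> e d) x k = 0" for u k
    using vertical_christoffel[OF i(1,2), of k u] that unfolding i(3) i(6) by blast
qed

text \<open>The chart \<open>d\<close> around \<open>q\<close> presents the fiber locally as a level
  set of \<open>coord_rep \<pi> e d\<close>, as \<open>inclusion_affine\<close> requires.\<close>

lemma inclusion_affine_coord:
  assumes c: "c \<in> atlas F" and e: "e \<in> atlas M" and d: "d \<in> charts_at N q" and y: "y \<in> I.coord_domain c e"
  shows "\<D> (coord_rep id c e) y (christoffel (metric_rep F gF c) y u v) =
    christoffel (metric_rep M g e) (coord_rep id c e y) (\<D> (coord_rep id c e) y u)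
      (\<D> (coord_rep id c e) y v) + second_derivative (coord_rep id c e) y u v"
proof -
  have dA: "d \<in> atlas N" using d by (simp add: N.charts_at_iff)
  have iS: "coord_rep id c e y \<in> coord_domain e d" if "y \<in> I.coord_domain c e" for y
  proof -
    note i = inclusion_rep[OF c e that]
    show ?thesis unfolding i(4) by (rule cmap_in_domain[OF i(2)]) (simp add: i(8) d)
  qed
  show ?thesis
  proof (rule inclusion_affine[where S="coord_domain e d" and f="coord_rep \<pi> e d" and q="cmap d q",
        OF GM.local_metric_rep[OF e] GF.local_metric_rep[OF c] inclusion_domain_open[OF c e] _ _
            smooth_rep[OF c e]
          domain_open[OF e dA] _ coord_smooth[OF e dA] _ induced_rep[OF c e] _ _ y])
    show "I.coord_domain c e \<subseteq> cmap c ` cdom c" "coord_domain e d \<subseteq> cmap e ` cdom e" by blast+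
    show "coord_rep id c e ` I.coord_domain c e \<subseteq> coord_domain e d" using iS by blast
    fix y assume y: "y \<in> I.coord_domain c e"
    note i = inclusion_rep[OF c e y]
    show "coord_rep \<pi> e d (coord_rep id c e y) = cmap d q"
      unfolding coord_rep_def[of \<pi>] o_apply i(5) i(8) by (rule refl)
    have d': "d \<in> charts_at N (\<pi> (cinv c y))" using d i(8) by simp
    fix v assume "\<D> (coord_rep \<pi> e d) (coord_rep id c e y) v = 0"
    then show "v \<in> range (\<D> (coord_rep id c e) y)"
      unfolding submersion_rep(6)[OF e dA iS[OF y]] i(5) i(9) inclusion_range[OF i(1,2) d] by simp
  next
    fix x u k assume x: "x \<in> coord_domain e d" and k: "\<D> (coord_rep \<pi> e d) x k = 0"
    note i = submersion_rep[OF e dA x]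
    show "\<D> (coord_rep \<pi> e d) x (christoffel (metric_rep M g e) x u k)
      = second_derivative (coord_rep \<pi> e d) x u k"
      using vertical_christoffel[OF i(1,2), of k u] k unfolding i(3) i(6) by blast
  qed
qed

text \<open>The two affine maps transport the curvature of the fiber into that of \<open>M\<close>
  and the curvature of \<open>M\<close> onto that of \<open>N\<close>; together with skew-symmetry
  this is the input of the algebraic trace comparison. The basis \<open>B\<close> depends on
  \<open>d\<close> and \<open>q\<close> only, so the last summand is the same for all points of the
  fiber.\<close>

lemma curvature_traces_fiber:
  assumes p: "p \<in> points F" and c: "c \<in> charts_at F p" and e: "e \<in> charts_at M p" and d: "d \<in> charts_at N q"
    and E': "orthonormal_basis (metric_rep F gF c (cmap c p)) E'"
    and B: "orthonormal_basis (metric_rep N gN d (cmap d q)) B"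
  obtains E where "orthonormal_basis (metric_rep M g e (cmap e p)) E"
    "\<And>u v. ricci_trace (metric_rep M g e) (cmap e p) E (coord_deriv id c e p u) (coord_deriv id c e p v)
      = ricci_trace (metric_rep F gF c) (cmap c p) E' u v"
    "scalar_trace (metric_rep M g e) (cmap e p) E
      = scalar_trace (metric_rep F gF c) (cmap c p) E'
      + scalar_trace (metric_rep N gN d) (cmap d q) B"
proof -
  have cA: "c \<in> atlas F" and eA: "e \<in> atlas M" and dA: "d \<in> atlas N"
    using c e d by (auto simp: I.M.charts_at_iff M.charts_at_iff N.charts_at_iff)
  have pq: "\<pi> p = q" by (rule fiber_point(2)[OF p])
  have d': "d \<in> charts_at N (\<pi> p)" using d pq by simp
  interpret LM: local_metric "cmap e ` cdom e" "metric_rep M g e" by (rule GM.local_metric_rep[OF eA])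
  interpret LF: local_metric "cmap c ` cdom c" "metric_rep F gF c" by (rule GF.local_metric_rep[OF cA])
  interpret LN: local_metric "cmap d ` cdom d" "metric_rep N gN d" by (rule GN.local_metric_rep[OF dA])
  have x: "cmap e p \<in> coord_domain e d" by (rule cmap_in_domain[OF e d'])
  have y: "cmap c p \<in> I.coord_domain c e" using I.cmap_in_domain[OF c, of e] e by simp
  have fx: "coord_rep \<pi> e d (cmap e p) = cmap d q"
    using coord_rep_cmap[OF M.charts_at_chart[OF e], of p \<pi> d] e pq by (simp add: M.charts_at_iff)
  have iy: "coord_rep id c e (cmap c p) = cmap e p"
    using coord_rep_cmap[OF I.M.charts_at_chart[OF c], of p id e] c by (simp add: I.M.charts_at_iff)
  have DT: "\<D> (coord_rep \<pi> e d) (cmap e p) = coord_deriv \<pi> e d p"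
    and Di: "\<D> (coord_rep id c e) (cmap c p) = coord_deriv id c e p"
    by (simp_all add: coord_deriv_def)
  have dN: "cmap d q \<in> cmap d ` cdom d" by (rule N.cmap_in[OF d])
  have T: "linear (coord_deriv \<pi> e d p)" by (rule coord_deriv_linear[OF e d'])
  have conM: "local_connection (coord_domain e d) (christoffel (metric_rep M g e))"
    by (rule local_connection_subset[OF LM.local_connection_axioms domain_open[OF eA dA]]) blast
  have conF: "local_connection (I.coord_domain c e) (christoffel (metric_rep F gF c))"
    by (rule local_connection_subset[OF LF.local_connection_axioms inclusion_domain_open[OF cA eA]]) blast
  show ?thesis
  proof (rule curvature_traces_submersion[where i="coord_deriv id c e p" and T="coord_deriv \<pi> e d p"
        and R="coord_curvature (christoffel (metric_rep M g e)) (cmap e p)"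
        and R'="coord_curvature (christoffel (metric_rep F gF c)) (cmap c p)"
        and RN="coord_curvature (christoffel (metric_rep N gN d)) (cmap d q)",
        OF M.fd GM.metric_rep_form[OF e] GF.metric_rep_form[OF c] GN.metric_rep_form[OF d]
            inclusion_linear[OF c e]
          T inclusion_range[OF c e d] surj_deriv[OF e d'] _ _ _ _ LN.curvature_linear[OF dN] _ E' B])
    show "metric_rep F gF c (cmap c p) u v = metric_rep M g e (cmap e p) (coord_deriv id c e p u)
        (coord_deriv id c e p v)" for u v
      using induced_rep[OF cA eA y] unfolding iy Di .
    show "metric_rep N gN d (cmap d q) (coord_deriv \<pi> e d p w) (coord_deriv \<pi> e d p b) = metric_rep M g
        e (cmap e p) w b"
      if "\<And>k. coord_deriv \<pi> e d p k = 0 \<Longrightarrow> metric_rep M g e (cmap e p) b k = 0" for b w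
      by (rule horizontal_isometry(1)[OF M.fd GM.metric_rep_form[OF e] GN.metric_rep_form[OF d] T
            horizontal_isometric[OF e d', unfolded pq] that])
    show "coord_curvature (christoffel (metric_rep M g e)) (cmap e p) (coord_deriv id c e p u)
        (coord_deriv id c e p v)
        (coord_deriv id c e p w)
      = coord_deriv id c e p (coord_curvature (christoffel (metric_rep F gF c)) (cmap c p) u v w)" for u v w
      using affine_curvature[OF conF LM.local_connection_axioms smooth_rep[OF cA eA] I.coord_rep_maps[OF cA]
          inclusion_affine_coord[OF cA eA d] y, of u v w]
      unfolding iy Di by (rule sym)
    show "coord_deriv \<pi> e d p (coord_curvature (christoffel (metric_rep M g e)) (cmap e p) u v w)
      = coord_curvature (christoffel (metric_rep N gN d)) (cmap d q) (coord_deriv \<pi> e d p u)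
          (coord_deriv \<pi> e d p v)
        (coord_deriv \<pi> e d p w)" for u v w
      using affine_curvature[OF conM LN.local_connection_axioms coord_smooth[OF eA dA] coord_rep_maps[OF eA]
          submersion_affine_coord[OF eA dA] x, of u v w]
      unfolding fx DT .
    show "metric_rep M g e (cmap e p) (coord_curvature (christoffel (metric_rep M g e)) (cmap e p) u v w) z
      = - metric_rep M g e (cmap e p) w (coord_curvature (christoffel (metric_rep M g e)) (cmap e p) u v
          z)" for u v w z
      by (rule LM.curvature_skew[OF M.cmap_in[OF e]])
  qed (rule that)
qed

text \<open>The constant \<open>\<rho>\<close> is the scalar curvature of \<open>N\<close> at \<open>q\<close>.\<close>

lemma ricci_scalar_fiber:
  assumes "q \<in> points N"
  obtains \<rho> where
    "\<And>p X Y X' Y'. p \<in> points F \<Longrightarrow> vector_field F X \<Longrightarrow> vector_field F Y \<Longrightarrow> vector_field M X' \<Longrightarrow>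
      vector_field M Y' \<Longrightarrow> X' p = differential F M id p (X p) \<Longrightarrow> Y' p = differential F M id p (Y p) \<Longrightarrow>
      ricci M g X' Y' p = ricci F gF X Y p"
    "\<And>p. p \<in> points F \<Longrightarrow> scalar_curvature M g p = scalar_curvature F gF p + \<rho>"
proof -
  obtain d where d: "d \<in> charts_at N q" using N.charts_at_ex[OF assms] by blast
  obtain B where B: "orthonormal_basis (metric_rep N gN d (cmap d q)) B"
    using orthonormal_basis_ex[OF N.fd GN.metric_rep_form[OF d]] .
  show ?thesis
  proof (rule that)
    fix p assume p: "p \<in> points F"
    obtain c where c: "c \<in> charts_at F p" using I.M.charts_at_ex[OF p] by blast
    obtain e where e: "e \<in> charts_at M p" using M.charts_at_ex[OF fiber_point(1)[OF p]] by blast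
    obtain E' where E': "orthonormal_basis (metric_rep F gF c (cmap c p)) E'"
      using orthonormal_basis_ex[OF fin_dim_euclidean GF.metric_rep_form[OF c]] .
    obtain E where E: "orthonormal_basis (metric_rep M g e (cmap e p)) E"
      and ric: "\<And>u v. ricci_trace (metric_rep M g e) (cmap e p) E (coord_deriv id c e p u) (coord_deriv id c e p v)
        = ricci_trace (metric_rep F gF c) (cmap c p) E' u v"
      and scal: "scalar_trace (metric_rep M g e) (cmap e p) E
        = scalar_trace (metric_rep F gF c) (cmap c p) E'
        + scalar_trace (metric_rep N gN d) (cmap d q) B"
      by (rule curvature_traces_fiber[OF p c e d E' B]) (rule that, assumption+)
    show "scalar_curvature M g p = scalar_curvature F gF p
        + scalar_trace (metric_rep N gN d) (cmap d q) B"
      unfolding GM.scalar_curvature_coord[OF e E] GF.scalar_curvature_coord[OF c E'] by (rule scal)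
    fix X Y X' Y'
    assume X: "vector_field F X" and Y: "vector_field F Y" and X': "vector_field M X'" and Y':
        "vector_field M Y'"
      and eq: "X' p = differential F M id p (X p)" "Y' p = differential F M id p (Y p)"
    show "ricci M g X' Y' p = ricci F gF X Y p"
      unfolding GM.ricci_coord[OF X' Y' e E] GF.ricci_coord[OF X Y c E'] eq
        differential_inclusion(1)[OF I.M.vector_fieldD(1)[OF X] c e]
            differential_inclusion(1)[OF I.M.vector_fieldD(1)[OF Y] c e]
      by (rule ric)
  qed
qed

text \<open>The Lie derivative involves the first derivative of the potential field, so
  \<open>V\<close> and \<open>V'\<close> must be related along the whole fiber; it is tensorial in
  the other two fields, for which agreement at \<open>p\<close> suffices.\<close>

lemma lie_metric_fiber:
  assumes p: "p \<in> points F" and V: "vector_field F V" and V': "vector_field M V'"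
    and rel: "\<And>r. r \<in> points F \<Longrightarrow> differential F M id r (V r) = V' r"
    and X: "vector_field F X" and Y: "vector_field F Y" and X': "vector_field M X'" and Y':
        "vector_field M Y'"
    and eq: "X' p = differential F M id p (X p)" "Y' p = differential F M id p (Y p)"
  shows "lie_metric M g V' X' Y' p = lie_metric F gF V X Y p"
proof -
  obtain c where c: "c \<in> charts_at F p" using I.M.charts_at_ex[OF p] by blast
  obtain e where e: "e \<in> charts_at M p" using M.charts_at_ex[OF fiber_point(1)[OF p]] by blast
  have cA: "c \<in> atlas F" and eA: "e \<in> atlas M" using c e by (auto simp: I.M.charts_at_iff M.charts_at_iff)
  let ?i = "coord_rep id c e" and ?D = "coord_deriv id c e p" and ?s =
      "second_derivative (coord_rep id c e) (cmap c p)"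
  note O = inclusion_domain_open[OF cA eA] and sm = smooth_rep[OF cA eA]
  have y: "cmap c p \<in> I.coord_domain c e" using I.cmap_in_domain[OF c, of e] e by simp
  have iy: "?i (cmap c p) = cmap e p"
    using coord_rep_cmap[OF I.M.charts_at_chart[OF c], of p id e] c by (simp add: I.M.charts_at_iff)
  have Di: "\<D> ?i (cmap c p) = ?D" by (simp add: coord_deriv_def)
  have co: "V' p e = ?D (V p c)" "X' p e = ?D (X p c)" "Y' p e = ?D (Y p c)"
    unfolding eq rel[OF p, symmetric] by (rule differential_inclusion(1)[OF I.M.vector_fieldD(1) c e],
        fact)+
  let ?dV = "\<D> (field_rep V c) (cmap c p)" and ?dV' = "\<D> (field_rep V' e) (cmap e p)"
  \<comment> \<open>The derivative of the relation between \<open>V\<close> and \<open>V'\<close>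
    along the inclusion.\<close>
  have dV: "?dV' (?D u) = ?s u (V p c) + ?D (?dV u)" for u
  proof -
    have 1: "((\<lambda>y. field_rep V' e (?i y)) has_derivative (\<lambda>u. ?dV' (?D u))) (at (cmap c p))"
      using has_derivative_compose[OF smooth_onD[OF sm y], of "field_rep V' e"]
          M.field_rep_deriv[OF V' e] by (simp add: iy Di)
    have 2: "((\<lambda>y. \<D> ?i y (field_rep V c y)) has_derivative
        (\<lambda>u. ?s u (field_rep V c (cmap c p)) + \<D> ?i (cmap c p) (?dV u))) (at (cmap c p))"
      by (rule has_derivative_frechet_apply[OF I.M.fd O y sm I.M.field_rep_deriv[OF V c]])
    have "?dV' (?D u) = ?s u (field_rep V c (cmap c p)) + \<D> ?i (cmap c p) (?dV u)"
    proof (rule has_derivative_unique_open[OF O y 1 2])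
      fix y assume y: "y \<in> I.coord_domain c e"
      note i = inclusion_rep[OF cA eA y]
      show "field_rep V' e (?i y) = \<D> ?i y (field_rep V c y)"
        unfolding field_rep_def i(5) i(9) rel[OF I.M.charts_at_points[OF i(1)], symmetric]
        by (rule differential_inclusion(1)[OF I.M.vector_fieldD(1)[OF V] i(1,2)])
    qed
    then show ?thesis by (simp add: I.M.field_rep_cmap[OF c] Di)
  qed
  have sub: "I.coord_domain c e \<subseteq> cmap c ` cdom c" by blast
  have md: "metric_derivative (metric_rep F gF c) (cmap c p) u v w =
      metric_derivative (metric_rep M g e) (cmap e p) (?D u) (?D v) (?D w)
      + metric_rep M g e (cmap e p) (?s u v) (?D w) + metric_rep M g e (cmap e p) (?D v) (?s u w)" for u v w
    using isometry_metric_derivative[OF GF.local_metric_rep[OF cA] GM.local_metric_rep[OF eA] O sub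
        I.coord_rep_maps[OF cA] sm induced_rep[OF cA eA] y]
    unfolding iy Di .
  have ind: "metric_rep F gF c (cmap c p) u v = metric_rep M g e (cmap e p) (?D u) (?D v)" for u v
    using induced_rep[OF cA eA y] unfolding iy Di .
  note f = inner_formD(5,6)[OF GM.metric_rep_form[OF e]]
  \<comment> \<open>The second derivatives of the inclusion arising from the metric and from the
    potential field agree by symmetry.\<close>
  show ?thesis
    unfolding GM.lie_metric_coord[OF V' X' Y' e GM.vector_field_lie_bracket[OF V' X']
        GM.vector_field_lie_bracket[OF V' Y']]
      GF.lie_metric_coord[OF V X Y c GF.vector_field_lie_bracket[OF V X]
          GF.vector_field_lie_bracket[OF V Y]]
      co dV ind md f
    by (simp add: second_derivative_sym[OF O y sm, of "V p c"])
qed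

end

theorem theorem4p2:
  fixes M :: "('p, 'm::euclidean_space) manifold"
    and N :: "('q, 'n::real_normed_vector) manifold"
    and F :: "('p, 'k::euclidean_space) manifold"
    and g :: "('p, 'm) metric_field"
    and gN :: "('q, 'n) metric_field"
    and V :: "('p, 'm) vfield"
    and \<eta> :: "('p, 'm) form1"
    and \<pi> :: "'p \<Rightarrow> 'q"
    and q :: 'q
    and lam \<mu> \<alpha> \<beta> :: real
  assumes "eta_ricci_yamabe_soliton M g V \<eta> lam \<mu> \<alpha> \<beta>"
    and "riemannian_submersion M g N gN \<pi>"
    and "vertical_field M N \<pi> V"
    and "vertical_parallel M g N \<pi>"
    and "q \<in> points N"
    and "F = fiber M \<pi> q"
    and "dimension F = dimension M - dimension N"
  shows "\<exists>lam' \<mu>'. eta_ricci_yamabe_soliton F (induced_metric F M g)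
           (restrict_field F M V) (restrict_form F M \<eta>) lam' \<mu>' \<alpha> \<beta>"
proof -
  note s = assms(2)[unfolded riemannian_submersion_def riemannian_manifold_def]
  interpret parallel_submersion M N \<pi> F q g gN
    using s assms(4,6,7) by unfold_locales auto
  have VM: "vector_field M V" and \<eta>: "one_form M \<eta>"
    and sol: "\<And>X Y p. vector_field M X \<Longrightarrow> vector_field M Y \<Longrightarrow> p \<in> points M \<Longrightarrow>
      lie_metric M g V X Y p + 2 * \<alpha> * ricci M g X Y p + (2 * lam - \<beta> * scalar_curvature M g p) * g p
          (X p) (Y p)
      + 2 * \<mu> * (\<eta> p (X p) * \<eta> p (Y p)) = 0"
    using assms(1) unfolding eta_ricci_yamabe_soliton_def by auto
  note VF = vector_field_restrict[OF assms(3)]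
  obtain \<rho> where ric: "\<And>p X Y X' Y'. p \<in> points F \<Longrightarrow> vector_field F X \<Longrightarrow> vector_field F Y \<Longrightarrow> vector_field M
      X' \<Longrightarrow>
      vector_field M Y' \<Longrightarrow> X' p = differential F M id p (X p) \<Longrightarrow> Y' p = differential F M id p (Y p) \<Longrightarrow>
      ricci M g X' Y' p = ricci F gF X Y p"
    and scal: "\<And>p. p \<in> points F \<Longrightarrow> scalar_curvature M g p = scalar_curvature F gF p + \<rho>"
    by (rule ricci_scalar_fiber[OF assms(5)]) (rule that, assumption+)
  \<comment> \<open>Since the scalar curvature of \<open>M\<close> along the fiber exceeds that of
    the fiber by the constant \<rho>, the term \<open>- \<beta> * \<rho>\<close> joins
    \<open>2 * lam\<close>, which shifts \<open>lam\<close> by half of it; \<mu> is kept.\<close>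
  have "eta_ricci_yamabe_soliton F gF (restrict_field F M V) (restrict_form F M \<eta>) (lam - \<beta> * \<rho> / 2) \<mu> \<alpha> \<beta>"
    unfolding eta_ricci_yamabe_soliton_def riemannian_manifold_def
  proof (intro conjI allI impI ballI smooth_manifold_fiber riemannian_induced VF(1) one_form_restrict[OF \<eta>])
    fix X Y p assume X: "vector_field F X" and Y: "vector_field F Y" and p: "p \<in> points F"
    have pM: "p \<in> points M" by (rule fiber_point(1)[OF p])
    have t: "differential F M id p (Z p) \<in> tangent_space M p" if "vector_field F Z" for Z
      using I.differential_tangent[OF I.M.vector_fieldD(1)[OF that] p] by simp
    \<comment> \<open>The extension matches \<open>X\<close> only at \<open>p\<close>. This is
      enough because every term of the soliton equation is tensorial in its two arguments.\<close>
    obtain X' where X': "vector_field M X'" "X' p = differential F M id p (X p)"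
      using extend_tangent[OF M.manifold t[OF X] pM] .
    obtain Y' where Y': "vector_field M Y'" "Y' p = differential F M id p (Y p)"
      using extend_tangent[OF M.manifold t[OF Y] pM] .
    have 1: "2 * (lam - \<beta> * \<rho> / 2) - \<beta> * scalar_curvature F gF p = 2 * lam - \<beta> * scalar_curvature M g p"
      by (simp add: scal[OF p] algebra_simps)
    have 2: "gF p (X p) (Y p) = g p (X' p) (Y' p)" by (simp add: induced_metric_def X' Y')
    have 3: "restrict_form F M \<eta> p (X p) = \<eta> p (X' p)" "restrict_form F M \<eta> p (Y p) = \<eta> p (Y' p)"
      by (simp_all add: restrict_form_def X' Y')
    have 4: "lie_metric M g V X' Y' p = lie_metric F gF (restrict_field F M V) X Y p"
      by (rule lie_metric_fiber[OF p VF(1) VM VF(2) X Y X'(1) Y'(1) X'(2) Y'(2)])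
    show "lie_metric F gF (restrict_field F M V) X Y p + 2 * \<alpha> * ricci F gF X Y p
        + (2 * (lam - \<beta> * \<rho> / 2) - \<beta> * scalar_curvature F gF p) * gF p (X p) (Y p)
        + 2 * \<mu> * (restrict_form F M \<eta> p (X p) * restrict_form F M \<eta> p (Y p)) = 0"
      unfolding 1 2 3 ric[OF p X Y X'(1) Y'(1) X'(2) Y'(2), symmetric] 4[symmetric]
      by (rule sol[OF X'(1) Y'(1) pM])
  qed
  then show ?thesis by blast
qed

end
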